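(* Consider a quadruple-point event $\mathrm{Q}$ of generic immersions of a closed oriented surface into $\mathbb{R}^3$. Let $j$ be the number of outward coorientations of the sheets before the event, i.e. the number of faces of the local tetrahedron before the event whose coorientation points out of the tetrahedron, so that the event is of type $\mathrm{Q}^{4-j}$. Then $$dSt_{(2)}=2j-4 .$$
   Context: Let $\Sigma$ be a closed oriented surface. An immersion $S:\Sigma\looparrowright\mathbb{R}^3$ is generic if its image has only transverse intersections of two or three smooth sheets. The orientations of $\Sigma$ and of $\mathbb{R}^3$ induce a coorientation (a choice of normal direction) of the immersed surface. Alexander numbering: each region (component of the complement of the image of $S$) is assigned a half-integer, with value $-\tfrac32$ on the region containing infinity, increasing by $1$ when a sheet is crossed in the direction of its coorientation. The index $\mathrm{ind}(t)$ of a triple point $t$ is the average of the Alexander numbers of the eight regions locally adjacent to $t$. With $T(S)$ the set of triple points of $S$, define $$St_{(2)}(S)=\sum_{t\in T(S)}\mathrm{ind}(t).$$ Quadruple-point event: an event $\mathrm{Q}$ is a local modification in a small ball, within a regular homotopy, in which four sheets, any three of them in general position, pass through a common point: one sheet crosses over the triple point formed by the other three. Immediately before and immediately after the event the four sheets bound a small tetrahedron whose four vertices are triple points; it shrinks to the quadruple point and reappears inverted. The immersion is unchanged outside the ball. Define $$dSt_{(2)}=St_{(2)}(\text{after the event})-St_{(2)}(\text{before the event}).$$ Types and sign convention: a face of the tetrahedron is called positive (outward) if its coorientation points out of the tetrahedron. The event has type $\mathrm{Q}^{k}$, $k\in\{2,3,4\}$, where $4-k$ is the smaller of the numbers of positive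 faces of the tetrahedra before and after the event. The sign convention is that the positive direction of a $\mathrm{Q}$-event is the one in which the number of outward coorientations increases; for $\mathrm{Q}^2$ this number equals $2$ both before and after. Events are taken in this direction, so $j\in\{0,1,2\}$. *)

theory Defs
  imports "HOL-Analysis.Analysis"
begin

section \<open>Closed oriented surfaces and smooth maps\<close>

text \<open>\<open>Ck_on\<close> and \<open>smooth_on\<close> are only used for open sets \<open>U\<close>; there they say that all iterated
  partial derivatives up to order \<open>k\<close> (of every order) exist and are continuous.\<close>

primrec Ck_on :: "nat \<Rightarrow> ('a::euclidean_space \<Rightarrow> 'b::real_normed_vector) \<Rightarrow> 'a set \<Rightarrow> bool" where
  "Ck_on 0 f U \<longleftrightarrow> continuous_on U f"
| "Ck_on (Suc k) f U \<longleftrightarrow> f differentiable_on U \<and>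
     (\<forall>b\<in>Basis. Ck_on k (\<lambda>x. frechet_derivative f (at x) b) U)"

definition smooth_on :: "'a set \<Rightarrow> ('a::euclidean_space \<Rightarrow> 'b::real_normed_vector) \<Rightarrow> bool" where
  "smooth_on U f \<longleftrightarrow> (\<forall>k. Ck_on k f U)"

text \<open>A chart is a pair \<open>(U, \<phi>)\<close>; its inverse parametrisation is \<open>inv_into U \<phi>\<close>.\<close>

type_synonym 'a atlas = "('a set \<times> ('a \<Rightarrow> real^2)) set"

definition oriented_atlas :: "'a::topological_space set \<Rightarrow> 'a atlas \<Rightarrow> bool" where
  "oriented_atlas M \<A> \<longleftrightarrow>
     (\<Union>(U, \<phi>)\<in>\<A>. U) = M \<and>
     (\<forall>(U, \<phi>)\<in>\<A>. openin (top_of_set M) U \<and> open (\<phi> ` U) \<and>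
        homeomorphism U (\<phi> ` U) \<phi> (inv_into U \<phi>)) \<and>
     (\<forall>(U, \<phi>)\<in>\<A>. \<forall>(V, \<psi>)\<in>\<A>.
        smooth_on (\<phi> ` (U \<inter> V)) (\<psi> \<circ> inv_into U \<phi>) \<and>
        (\<forall>z\<in>\<phi> ` (U \<inter> V).
           det (matrix (frechet_derivative (\<psi> \<circ> inv_into U \<phi>) (at z))) > 0))"

text \<open>Connectedness is not required. The Hausdorff axiom is the type class; second countability
  follows from compactness.\<close>

definition closed_oriented_surface :: "'a::t2_space set \<Rightarrow> 'a atlas \<Rightarrow> bool" where
  "closed_oriented_surface M \<A> \<longleftrightarrow> compact M \<and> oriented_atlas M \<A>"


section \<open>Generic immersions and their coorientation\<close>

definition immersion :: "'a atlas \<Rightarrow> ('a \<Rightarrow> real^3) \<Rightarrow> bool" where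
  "immersion \<A> S \<longleftrightarrow> (\<forall>(U, \<phi>)\<in>\<A>. smooth_on (\<phi> ` U) (S \<circ> inv_into U \<phi>) \<and>
     (\<forall>z\<in>\<phi> ` U. inj (frechet_derivative (S \<circ> inv_into U \<phi>) (at z))))"

text \<open>The coorientation at \<open>x\<close> is the unit normal \<open>n\<close> for which an oriented basis of the tangent
  plane, followed by \<open>n\<close>, is an oriented basis of \<open>\<real>\<^sup>3\<close>. Transition maps of the atlas have positive
  Jacobian, so it does not depend on the chart that is chosen.\<close>

definition coorientation :: "'a atlas \<Rightarrow> ('a \<Rightarrow> real^3) \<Rightarrow> 'a \<Rightarrow> real^3" where
  "coorientation \<A> S x =
     (let (U, \<phi>) = (SOME c. c \<in> \<A> \<and> x \<in> fst c);
          d = frechet_derivative (S \<circ> inv_into U \<phi>) (at (\<phi> x))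
      in sgn (cross3 (d (axis 1 1)) (d (axis 2 1))))"

definition fibre :: "'a set \<Rightarrow> ('a \<Rightarrow> real^3) \<Rightarrow> real^3 \<Rightarrow> 'a set" where
  "fibre M S q = {x \<in> M. S x = q}"

text \<open>The sheets through a common image point, at the parameters in \<open>P\<close>, are mutually transverse iff
  their normals are linearly independent.\<close>

definition general_position :: "'a atlas \<Rightarrow> ('a \<Rightarrow> real^3) \<Rightarrow> 'a set \<Rightarrow> bool" where
  "general_position \<A> S P \<longleftrightarrow> finite P \<and> inj_on (coorientation \<A> S) P \<and>
     independent (coorientation \<A> S ` P)"

definition generic_immersion :: "'a set \<Rightarrow> 'a atlas \<Rightarrow> ('a \<Rightarrow> real^3) \<Rightarrow> bool" where
  "generic_immersion M \<A> S \<longleftrightarrow> immersion \<A> S \<and>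
     (\<forall>q. card (fibre M S q) \<le> 3 \<and> general_position \<A> S (fibre M S q))"

definition triple_points :: "'a set \<Rightarrow> ('a \<Rightarrow> real^3) \<Rightarrow> (real^3) set" where
  "triple_points M S = {q. card (fibre M S q) = 3}"


section \<open>Alexander numbering and the invariant\<close>

text \<open>A numbering is a function on \<open>\<real>\<^sup>3\<close>, constant on each region; its values on the image of \<open>S\<close>
  are irrelevant. A sheet is crossed at a point with a single preimage. The region containing
  infinity is the unbounded one.\<close>

definition alexander_numbering ::
  "'a set \<Rightarrow> 'a atlas \<Rightarrow> ('a \<Rightarrow> real^3) \<Rightarrow> (real^3 \<Rightarrow> real) \<Rightarrow> bool" where
  "alexander_numbering M \<A> S A \<longleftrightarrow>
     (\<forall>R\<in>components (- S ` M). \<exists>a. a - 1/2 \<in> \<int> \<and> (\<forall>q\<in>R. A q = a)) \<and>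
     (\<forall>R\<in>components (- S ` M). \<not> bounded R \<longrightarrow> (\<forall>q\<in>R. A q = - 3/2)) \<and>
     (\<forall>x\<in>M. fibre M S (S x) = {x} \<longrightarrow>
        (\<forall>\<^sub>F e in at_right 0.
           A (S x + e *\<^sub>R coorientation \<A> S x) = A (S x - e *\<^sub>R coorientation \<A> S x) + 1))"

text \<open>The eight regions locally adjacent to a triple point \<open>q\<close> correspond to the eight choices of a
  side of each of the three sheets, i.e. to the sign functions \<open>\<sigma>\<close> on the fibre; the region of
  \<open>\<sigma>\<close> contains \<open>q + e v\<close> for small \<open>e > 0\<close> and every direction \<open>v\<close> in the corresponding open
  octant of the three tangent planes.\<close>

definition octant ::
  "'a set \<Rightarrow> 'a atlas \<Rightarrow> ('a \<Rightarrow> real^3) \<Rightarrow> real^3 \<Rightarrow> ('a \<Rightarrow> real) \<Rightarrow> (real^3) set" where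
  "octant M \<A> S q \<sigma> = {v. \<forall>x\<in>fibre M S q. \<sigma> x * (v \<bullet> coorientation \<A> S x) > 0}"

definition octant_number :: "'a set \<Rightarrow> 'a atlas \<Rightarrow> ('a \<Rightarrow> real^3) \<Rightarrow> (real^3 \<Rightarrow> real) \<Rightarrow>
    real^3 \<Rightarrow> ('a \<Rightarrow> real) \<Rightarrow> real" where
  "octant_number M \<A> S A q \<sigma> =
     (THE a. \<forall>v\<in>octant M \<A> S q \<sigma>. \<forall>\<^sub>F e in at_right 0. A (q + e *\<^sub>R v) = a)"

definition index ::
  "'a set \<Rightarrow> 'a atlas \<Rightarrow> ('a \<Rightarrow> real^3) \<Rightarrow> (real^3 \<Rightarrow> real) \<Rightarrow> real^3 \<Rightarrow> real" where
  "index M \<A> S A q = (\<Sum>\<sigma>\<in>fibre M S q \<rightarrow>\<^sub>E {-1, 1}. octant_number M \<A> S A q \<sigma>) / 8"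

definition St2 :: "'a set \<Rightarrow> 'a atlas \<Rightarrow> ('a \<Rightarrow> real^3) \<Rightarrow> (real^3 \<Rightarrow> real) \<Rightarrow> real" where
  "St2 M \<A> S A = (\<Sum>q\<in>triple_points M S. index M \<A> S A q)"


section \<open>The tetrahedron and its outward faces\<close>

text \<open>\<open>Q\<close> consists of four labels and \<open>D i \<subseteq> M\<close> parametrises the sheet with label \<open>i\<close>. The
  tetrahedron \<open>\<Delta>\<close> is a region of the complement whose closure is a homeomorphic copy of a straight
  tetrahedron with vertices \<open>v i\<close>, such that the face opposite \<open>v i\<close> is exactly the part of the
  closure on the sheet \<open>i\<close>. Hence the vertex \<open>v i\<close> becomes a triple point on the three sheets
  other than \<open>i\<close>.\<close>

definition tetrahedron ::
  "'a set \<Rightarrow> ('a \<Rightarrow> real^3) \<Rightarrow> 'a set \<Rightarrow> ('a \<Rightarrow> 'a set) \<Rightarrow> (real^3) set \<Rightarrow> bool" where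
  "tetrahedron M S Q D \<Delta> \<longleftrightarrow> \<Delta> \<in> components (- S ` M) \<and>
     (\<exists>(v :: 'a \<Rightarrow> real^3) h k.
        inj_on v Q \<and> \<not> affine_dependent (v ` Q) \<and>
        homeomorphism (convex hull (v ` Q)) (closure \<Delta>) h k \<and>
        h ` interior (convex hull (v ` Q)) = \<Delta> \<and>
        (\<forall>i\<in>Q. h ` (convex hull (v ` (Q - {i}))) = closure \<Delta> \<inter> S ` D i))"

text \<open>The points of a face that lie on no further sheet are those off its edges and vertices.\<close>

definition outward_face ::
  "'a set \<Rightarrow> 'a atlas \<Rightarrow> ('a \<Rightarrow> real^3) \<Rightarrow> 'a set \<Rightarrow> (real^3) set \<Rightarrow> bool" where
  "outward_face M \<A> S F \<Delta> \<longleftrightarrow>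
     (\<forall>x\<in>F. S x \<in> closure \<Delta> \<and> fibre M S (S x) = {x} \<longrightarrow>
        (\<forall>\<^sub>F e in at_right 0. S x - e *\<^sub>R coorientation \<A> S x \<in> \<Delta> \<and>
           S x + e *\<^sub>R coorientation \<A> S x \<notin> closure \<Delta>))"

definition outward_number ::
  "'a set \<Rightarrow> 'a atlas \<Rightarrow> ('a \<Rightarrow> real^3) \<Rightarrow> 'a set \<Rightarrow> ('a \<Rightarrow> 'a set) \<Rightarrow> (real^3) set \<Rightarrow> nat" where
  "outward_number M \<A> S Q D \<Delta> = card {i \<in> Q. outward_face M \<A> S (D i) \<Delta>}"


section \<open>Quadruple-point events\<close>

definition regular_homotopy ::
  "'a atlas \<Rightarrow> real \<Rightarrow> real \<Rightarrow> (real \<Rightarrow> 'a \<Rightarrow> real^3) \<Rightarrow> bool" where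
  "regular_homotopy \<A> a b H \<longleftrightarrow>
     (\<forall>(U, \<phi>)\<in>\<A>. smooth_on ({a<..<b} \<times> \<phi> ` U) (\<lambda>(t, z). H t (inv_into U \<phi> z))) \<and>
     (\<forall>t\<in>{a<..<b}. immersion \<A> (H t))"

text \<open>The sheet \<open>i\<close> crosses over the triple point \<open>q t\<close> formed by the other three sheets at time
  \<open>\<tau>\<close>: writing \<open>q t\<close> as a point \<open>y t\<close> of the sheet \<open>i\<close> plus \<open>s t\<close> times the coorientation there,
  the signed height \<open>s t\<close> changes its sign at \<open>\<tau>\<close>. (\<open>\<sigma>\<close> is the direction of crossing.)\<close>

definition crosses_over :: "'a::topological_space atlas \<Rightarrow> (real \<Rightarrow> 'a \<Rightarrow> real^3) \<Rightarrow> real \<Rightarrow> real^3 \<Rightarrow>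
    'a set \<Rightarrow> ('a \<Rightarrow> 'a set) \<Rightarrow> 'a \<Rightarrow> bool" where
  "crosses_over \<A> H \<tau> p Q D i \<longleftrightarrow>
     (\<exists>(q :: real \<Rightarrow> real^3) (y :: real \<Rightarrow> 'a) (s :: real \<Rightarrow> real). \<exists>\<sigma>\<in>{-1, 1}.
        (q \<longlongrightarrow> p) (at \<tau>) \<and> (y \<longlongrightarrow> i) (at \<tau>) \<and>
        (\<forall>\<^sub>F t in at \<tau>.
           q t \<in> (\<Inter>k\<in>Q - {i}. H t ` D k) \<and> y t \<in> D i \<and>
           q t = H t (y t) + s t *\<^sub>R coorientation \<A> (H t) (y t) \<and>
           \<sigma> * s t * (t - \<tau>) > 0))"

text \<open>The event happens at time \<open>\<tau>\<close> and at the point \<open>p\<close>, in a regular homotopy \<open>H\<close> with times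
  in \<open>{a<..<b}\<close>. The four sheets are labelled by the four preimages of \<open>p\<close>. The homotopy is
  supported in \<open>cball p r'\<close>; the slightly larger \<open>ball p r\<close> is so small that it meets nothing but
  the four sheets \<open>D i\<close>, and that no three of these meet there at time \<open>\<tau>\<close> except at \<open>p\<close>. That the
  tetrahedron reappears inverted is not assumed, but a consequence of the crossing.\<close>

definition quadruple_point_event ::
  "'a::t2_space set \<Rightarrow> 'a atlas \<Rightarrow> real \<Rightarrow> real \<Rightarrow> (real \<Rightarrow> 'a \<Rightarrow> real^3) \<Rightarrow> real \<Rightarrow> real^3 \<Rightarrow>
   ('a \<Rightarrow> 'a set) \<Rightarrow> (real \<Rightarrow> (real^3) set) \<Rightarrow> bool" where
  "quadruple_point_event M \<A> a b H \<tau> p D \<Delta> \<longleftrightarrow>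
     a < \<tau> \<and> \<tau> < b \<and> regular_homotopy \<A> a b H \<and>
     (\<forall>t\<in>{a<..<b} - {\<tau>}. generic_immersion M \<A> (H t)) \<and>
     (let Q = fibre M (H \<tau>) p in
        card Q = 4 \<and>
        (\<forall>P\<subseteq>Q. card P = 3 \<longrightarrow> general_position \<A> (H \<tau>) P) \<and>
        (\<exists>r r'. 0 < r' \<and> r' < r \<and>
           (\<forall>t\<in>{a<..<b}. \<forall>x\<in>M.
              if H \<tau> x \<in> cball p r' then H t x \<in> cball p r' else H t x = H \<tau> x) \<and>
           {x \<in> M. H \<tau> x \<in> ball p r} = (\<Union>i\<in>Q. D i) \<and> disjoint_family_on D Q \<and>
           (\<forall>i\<in>Q. i \<in> D i \<and> openin (top_of_set M) (D i) \<and>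
              (\<forall>t\<in>{a<..<b}. inj_on (H t) (D i))) \<and>
           (\<forall>q\<in>ball p r - {p}. card (fibre M (H \<tau>) q) \<le> 2 \<and>
              general_position \<A> (H \<tau>) (fibre M (H \<tau>) q))) \<and>
        (\<exists>i\<in>Q. crosses_over \<A> H \<tau> p Q D i) \<and>
        (\<forall>\<^sub>F t in at \<tau>. tetrahedron M (H t) Q D (\<Delta> t)) \<and>
        (\<forall>e>0. \<forall>\<^sub>F t in at \<tau>. \<Delta> t \<subseteq> ball p e))"

text \<open>In the following, \<open>j\<close> and \<open>j'\<close> are the numbers of outward faces immediately before and after
  the event.\<close>

definition outward_before_after :: "'a::t2_space set \<Rightarrow> 'a atlas \<Rightarrow> (real \<Rightarrow> 'a \<Rightarrow> real^3) \<Rightarrow> real \<Rightarrow>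
    real^3 \<Rightarrow> ('a \<Rightarrow> 'a set) \<Rightarrow> (real \<Rightarrow> (real^3) set) \<Rightarrow> nat \<Rightarrow> nat \<Rightarrow> bool" where
  "outward_before_after M \<A> H \<tau> p D \<Delta> j j' \<longleftrightarrow>
     (\<forall>\<^sub>F s in at_left \<tau>. outward_number M \<A> (H s) (fibre M (H \<tau>) p) D (\<Delta> s) = j) \<and>
     (\<forall>\<^sub>F t in at_right \<tau>. outward_number M \<A> (H t) (fibre M (H \<tau>) p) D (\<Delta> t) = j')"

definition positive_direction :: "nat \<Rightarrow> nat \<Rightarrow> bool" where
  "positive_direction j j' \<longleftrightarrow> j < j' \<or> (j = 2 \<and> j' = 2)"

definition event_type :: "nat \<Rightarrow> nat \<Rightarrow> nat \<Rightarrow> bool" where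
  "event_type k j j' \<longleftrightarrow> k \<in> {2, 3, 4} \<and> 4 - k = min j j'"

end

theory Submission
  imports Defs
begin

text \<open>Near any point of space, and at all times near a given one, each sheet of the homotopy is the zero
  set of a function that is close to the linear form given by its coorientation and is positive on the
  side to which the coorientation points (\<open>sheet_function_exists\<close>). Off the image, and near a
  given point, a numbering equals a constant plus the number of sheets that have the point on their
  positive side (\<open>numbering_counts_sheets\<close>): both sides jump by one across every simple point, and double and
  triple points can be avoided. So the index of a triple point is that constant, plus \<open>3/2\<close> for its
  own three sheets, plus the number of further sheets nearby that have it on their positive side
  (\<open>index_of_triple_point\<close>).

  Numberings shortly before and shortly after the event agree at each point off the image at the time
  of the event, because they agree far away and their differences within a small ball are counts of
  sheets that do not change (\<open>numberings_agree_off_image\<close>). Hence triple points away from the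
  quadruple point keep their index, and near it the constant is the same before and after. The four
  sheets there have exactly four triple points, the vertices of the tetrahedron; let the height of
  the vertex opposite to the sheet \<open>i\<close> be the value at it of the function of that sheet. The
  change of the invariant is then the change of the number of positive heights
  (\<open>St2_split\<close>).

  The four coorientations satisfy a linear relation, all of whose coefficients are nonzero. By almost
  linearity the heights, multiplied by these coefficients, have one common sign
  (\<open>vertex_heights_aligned\<close>). When one sheet crosses over the opposite triple point, this sign
  changes, so all four heights change their signs: the tetrahedron reappears inverted. A face is
  outward exactly if the height of the opposite vertex is negative (\<open>outward_face_iff\<close>), since the
  tetrahedron lies on the side of the sheet where that vertex is. So there are \<open>4 - j\<close> positive
  heights before the event and \<open>j\<close> after it, the number of outward faces becomes \<open>4 - j\<close>, and the
  invariant changes by \<open>j - (4 - j) = 2 * j - 4\<close>.\<close>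

section \<open>Almost linear functions and their common zeros\<close>

lemma dual_vectors_exist:
  fixes c :: "'i \<Rightarrow> 'b::euclidean_space"
  assumes "inj_on c I" and "independent (c ` I)"
  obtains e where "\<forall>i\<in>I. \<forall>k\<in>I. c k \<bullet> e i = (if i = k then 1 else 0)"
proof -
  have "\<exists>v. \<forall>k\<in>I. c k \<bullet> v = (if i = k then 1 else 0)" if "i \<in> I" for i
  proof -
    obtain g :: "'b \<Rightarrow> real" where g: "linear g" "\<forall>x\<in>c ` I. g x = (if x = c i then 1 else 0)"
      using linear_independent_extend[OF assms(2), of "\<lambda>x. if x = c i then 1 else 0"] by auto
    have "c k \<bullet> adjoint g 1 = (if i = k then 1 else 0)" if "k \<in> I" for k
      using g assms(1) that \<open>i \<in> I\<close> by (auto simp: adjoint_works inj_on_def)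
    then show ?thesis by blast
  qed
  then obtain e where "\<forall>i\<in>I. \<forall>k\<in>I. c k \<bullet> e i = (if i = k then 1 else 0)"
    using bchoice[of I "\<lambda>i v. \<forall>k\<in>I. c k \<bullet> v = (if i = k then 1 else 0)"] by auto
  then show ?thesis by (rule that)
qed

text \<open>One bound \<open>V\<close> serves all bounded right-hand sides, so that the accuracy \<open>\<epsilon>\<close> of a linear approximation
  can be chosen before the direction in which one wants to move.\<close>
lemma bounded_solutions_exist:
  fixes c :: "'i \<Rightarrow> 'b::euclidean_space"
  assumes "finite I" and "inj_on c I" and "independent (c ` I)"
  obtains V where "V > 0"
    "\<And>a. \<forall>i\<in>I. \<bar>a i\<bar> \<le> 1 \<Longrightarrow> \<exists>v. norm v \<le> V \<and> (\<forall>i\<in>I. c i \<bullet> v = a i)"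
proof -
  obtain e where e: "\<forall>i\<in>I. \<forall>k\<in>I. c k \<bullet> e i = (if i = k then 1 else 0)"
    by (rule dual_vectors_exist[OF assms(2,3)])
  define V where "V = 1 + (\<Sum>i\<in>I. norm (e i))"
  show thesis
  proof
    show "V > 0" unfolding V_def by (simp add: add_pos_nonneg sum_nonneg)
    fix a :: "'i \<Rightarrow> real" assume a: "\<forall>i\<in>I. \<bar>a i\<bar> \<le> 1"
    let ?v = "\<Sum>i\<in>I. a i *\<^sub>R e i"
    have "norm ?v \<le> (\<Sum>i\<in>I. norm (e i))"
      by (rule order_trans[OF norm_sum])
        (auto intro!: sum_mono simp: mult_left_le_one_le a)
    moreover have "c k \<bullet> ?v = a k" if "k \<in> I" for k
    proof -
      have "c k \<bullet> ?v = (\<Sum>i\<in>I. if i = k then a i else 0)"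
        unfolding inner_sum_right by (rule sum.cong) (auto simp: e that)
      then show ?thesis using that assms(1) by simp
    qed
    ultimately show "\<exists>v. norm v \<le> V \<and> (\<forall>i\<in>I. c i \<bullet> v = a i)"
      unfolding V_def by (intro exI[of _ ?v]) auto
  qed
qed

text \<open>A quantitative form of independence: it bounds the distance of two points by the values that the
  functions of three transverse sheets take at them.\<close>
lemma norm_le_sum_inner_basis:
  fixes c :: "'i \<Rightarrow> 'b::euclidean_space"
  assumes "finite I" and "inj_on c I" and "independent (c ` I)" and "card I = DIM('b)"
  obtains C where "C > 0" "\<And>d. norm d \<le> C * (\<Sum>i\<in>I. \<bar>c i \<bullet> d\<bar>)"
proof -
  obtain e where e: "\<forall>i\<in>I. \<forall>k\<in>I. c k \<bullet> e i = (if i = k then 1 else 0)"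
    by (rule dual_vectors_exist[OF assms(2,3)])
  define C where "C = 1 + (\<Sum>i\<in>I. norm (e i))"
  have span: "span (c ` I) = UNIV"
    using card_ge_dim_independent[OF _ assms(3), of UNIV] assms by (auto simp: card_image)
  show thesis
  proof
    show "C > 0" unfolding C_def by (simp add: add_pos_nonneg sum_nonneg)
    fix d :: 'b
    let ?v = "\<Sum>i\<in>I. (c i \<bullet> d) *\<^sub>R e i"
    have "c k \<bullet> ?v = c k \<bullet> d" if "k \<in> I" for k
    proof -
      have "c k \<bullet> ?v = (\<Sum>i\<in>I. if i = k then c i \<bullet> d else 0)"
        unfolding inner_sum_right by (rule sum.cong) (auto simp: e that)
      then show ?thesis using that assms(1) by simp
    qed
    then have "\<forall>x\<in>c ` I. orthogonal (d - ?v) x"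
      by (auto simp: orthogonal_def inner_diff_left inner_diff_right inner_commute[of _ "c _"])
    then have "orthogonal (d - ?v) (d - ?v)"
      using orthogonal_to_span[of "d - ?v" "c ` I" "d - ?v"] span by auto
    then have "d = ?v" by (simp add: orthogonal_self)
    then have "norm d = norm ?v" by (rule arg_cong)
    also have "\<dots> \<le> (\<Sum>i\<in>I. \<bar>c i \<bullet> d\<bar> * norm (e i))"
      by (rule order_trans[OF norm_sum]) simp
    also have "\<dots> \<le> (\<Sum>i\<in>I. C * \<bar>c i \<bullet> d\<bar>)"
    proof (rule sum_mono)
      fix i assume "i \<in> I"
      then have "norm (e i) \<le> C" unfolding C_def
        using member_le_sum[of i I "\<lambda>i. norm (e i)"] assms(1) by auto
      then show "\<bar>c i \<bullet> d\<bar> * norm (e i) \<le> C * \<bar>c i \<bullet> d\<bar>"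
        by (simp add: mult.commute[of _ "norm (e i)"] mult_right_mono)
    qed
    finally show "norm d \<le> C * (\<Sum>i\<in>I. \<bar>c i \<bullet> d\<bar>)" by (simp add: sum_distrib_left)
  qed
qed

text \<open>A relation with a vanishing coefficient would be a relation among the remaining vectors, which are
  independent.\<close>
lemma linear_relation_nonzero_coefficients:
  fixes c :: "'i \<Rightarrow> 'b::euclidean_space"
  assumes "card I = DIM('b) + 1"
    and ind: "\<And>i. i \<in> I \<Longrightarrow> inj_on c (I - {i}) \<and> independent (c ` (I - {i}))"
    and inj: "inj_on c I"
  obtains l where "\<forall>i\<in>I. l i \<noteq> 0" "(\<Sum>i\<in>I. l i *\<^sub>R c i) = (0::'b)"
proof -
  have fin: "finite I" using assms(1) card.infinite by fastforce
  have "dependent (c ` I)"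
    using dependent_biggerset[of "c ` I"] assms(1) fin inj by (simp add: card_image)
  then obtain u where u: "\<exists>v\<in>c ` I. u v \<noteq> 0" "(\<Sum>v\<in>c ` I. u v *\<^sub>R v) = 0"
    using dependent_finite[of "c ` I"] fin by auto
  have sum: "(\<Sum>i\<in>I. u (c i) *\<^sub>R c i) = 0"
    using u(2) by (simp add: sum.reindex[OF inj])
  have "u (c i) \<noteq> 0" if "i \<in> I" for i
  proof
    assume z: "u (c i) = 0"
    have "(\<Sum>k\<in>I - {i}. u (c k) *\<^sub>R c k) = 0"
      using sum z by (simp add: sum.remove[OF fin that])
    then have "(\<Sum>v\<in>c ` (I - {i}). u v *\<^sub>R v) = 0"
      using ind[OF that] by (simp add: sum.reindex)
    then have "\<forall>v\<in>c ` (I - {i}). u v = 0"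
      using ind[OF that] dependent_finite[of "c ` (I - {i})"] fin by auto
    then show False using u(1) z by auto
  qed
  then have "\<forall>i\<in>I. u (c i) \<noteq> 0" by blast
  then show thesis using sum by (rule that[of "\<lambda>i. u (c i)"])
qed

text \<open>A substitute for being \<open>C\<^sup>1\<close>-close to a linear form: it involves no derivative, passes
  to subsets, and for a fixed \<open>\<epsilon>\<close> it can hold for a whole interval of times on one ball.\<close>
definition almost_linear_on :: "'b::euclidean_space set \<Rightarrow> real \<Rightarrow> ('b \<Rightarrow> real) \<Rightarrow> 'b \<Rightarrow> bool" where
  "almost_linear_on B \<epsilon> g c \<longleftrightarrow>
     (\<forall>w\<in>B. \<forall>w'\<in>B. \<bar>g w - g w' - c \<bullet> (w - w')\<bar> \<le> \<epsilon> * norm (w - w'))"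

lemma almost_linear_onD:
  "almost_linear_on B \<epsilon> g c \<Longrightarrow> w \<in> B \<Longrightarrow> w' \<in> B \<Longrightarrow>
    \<bar>g w - g w' - c \<bullet> (w - w')\<bar> \<le> \<epsilon> * norm (w - w')"
  unfolding almost_linear_on_def by blast

lemma almost_linear_on_subset:
  "almost_linear_on B \<epsilon> g c \<Longrightarrow> B' \<subseteq> B \<Longrightarrow> almost_linear_on B' \<epsilon> g c"
  unfolding almost_linear_on_def by blast

lemma almost_linear_on_continuous:
  assumes "almost_linear_on B \<epsilon> g c"
  shows "continuous_on B g"
proof -
  have "(\<bar>\<epsilon>\<bar> + norm c)-lipschitz_on B g"
  proof (rule lipschitz_onI)
    fix w w' assume w: "w \<in> B" "w' \<in> B"
    have "\<bar>g w - g w'\<bar> \<le> \<epsilon> * norm (w - w') + \<bar>c \<bullet> (w - w')\<bar>"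
      using almost_linear_onD[OF assms w] by linarith
    also have "\<dots> \<le> \<bar>\<epsilon>\<bar> * norm (w - w') + norm c * norm (w - w')"
      by (intro add_mono mult_right_mono Cauchy_Schwarz_ineq2) auto
    finally show "dist (g w) (g w') \<le> (\<bar>\<epsilon>\<bar> + norm c) * dist w w'"
      by (simp add: dist_norm algebra_simps)
  qed auto
  then show ?thesis by (rule lipschitz_on_continuous_on)
qed

text \<open>Along \<open>v\<close> all the functions \<open>\<sigma> i * g i\<close> increase at least with slope \<open>1/2\<close>. Pushed by
  \<open>9 * \<rho>'\<close> in this direction, the two points enter a part of the sign region that contains the segment
  between them, and the paths of the push stay in the region as well.\<close>
lemma constant_on_sign_region:
  fixes q :: "'b::euclidean_space"
  assumes unit: "\<And>i. i \<in> I \<Longrightarrow> norm (c i) = 1"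
    and v: "\<And>i. i \<in> I \<Longrightarrow> c i \<bullet> v = \<sigma> i" "norm v \<le> V" and \<sigma>: "\<And>i. i \<in> I \<Longrightarrow> \<sigma> i \<in> {-1, 1}"
    and \<epsilon>: "0 \<le> \<epsilon>" "\<epsilon> * V \<le> 1/2" "\<epsilon> \<le> 1/2"
    and al: "\<And>i. i \<in> I \<Longrightarrow> almost_linear_on (ball q \<rho>) \<epsilon> (g i) (c i)"
    and seg: "\<And>w1 w2. closed_segment w1 w2 \<subseteq> {w \<in> ball q \<rho>. \<forall>i\<in>I. g i w \<noteq> 0} \<Longrightarrow> F w1 = F w2"
    and \<rho>': "0 < \<rho>'" "\<rho>' * (1 + 9 * V) \<le> \<rho>"
    and w: "w \<in> ball q \<rho>'" "\<And>i. i \<in> I \<Longrightarrow> \<sigma> i * g i w > 0"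
    and w': "w' \<in> ball q \<rho>'" "\<And>i. i \<in> I \<Longrightarrow> \<sigma> i * g i w' > 0"
  shows "F w = F w'"
proof -
  let ?O = "{w \<in> ball q \<rho>. \<forall>i\<in>I. g i w \<noteq> 0}"
  have V: "V \<ge> 0" using v(2) norm_ge_zero[of v] by linarith
  have inball: "u + s *\<^sub>R v \<in> ball q \<rho>" if "u \<in> ball q \<rho>'" "0 \<le> s" "s \<le> 9 * \<rho>'" for u s
  proof -
    have "s * norm v \<le> (9 * \<rho>') * V" using that v(2) V \<rho>'(1) by (intro mult_mono) auto
    moreover have "norm (u + s *\<^sub>R v - q) \<le> norm (u - q) + s * norm v"
      using norm_triangle_ineq[of "u - q" "s *\<^sub>R v"] that by (simp add: algebra_simps)
    ultimately show ?thesis using that(1) \<rho>'(2)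
      by (simp add: dist_norm norm_minus_commute algebra_simps)
  qed
  have slope: "\<sigma> i * g i w'' \<ge> \<sigma> i * g i w + \<sigma> i * (c i \<bullet> (w'' - w)) - \<epsilon> * norm (w'' - w)"
    if "i \<in> I" "w \<in> ball q \<rho>" "w'' \<in> ball q \<rho>" for w w'' i
    using almost_linear_onD[OF al[OF that(1)] that(3,2)] \<sigma>[OF that(1)] by auto
  have sub: "ball q \<rho>' \<subseteq> ball q \<rho>"
    using inball[of _ 0] \<rho>' by auto
  have up: "closed_segment w (w + (9 * \<rho>') *\<^sub>R v) \<subseteq> ?O"
    if w: "w \<in> ball q \<rho>'" "\<And>i. i \<in> I \<Longrightarrow> \<sigma> i * g i w > 0" for w
  proof
    fix u assume "u \<in> closed_segment w (w + (9 * \<rho>') *\<^sub>R v)"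
    then obtain \<theta> where \<theta>: "0 \<le> \<theta>" "\<theta> \<le> 1" "u = w + (\<theta> * (9 * \<rho>')) *\<^sub>R v"
      by (auto simp: in_segment algebra_simps)
    define s where "s = \<theta> * (9 * \<rho>')"
    have s: "0 \<le> s" "s \<le> 9 * \<rho>'" unfolding s_def using \<theta> \<rho>' mult_right_mono[of \<theta> 1 "9*\<rho>'"] by auto
    have u: "u \<in> ball q \<rho>" using inball[OF w(1) s] \<theta>(3) s_def by simp
    have "\<sigma> i * g i u > 0" if i: "i \<in> I" for i
    proof -
      have "\<sigma> i * (c i \<bullet> (u - w)) = s" using \<theta>(3) v(1)[OF i] \<sigma>[OF i] by (auto simp: s_def)
      moreover have "\<epsilon> * norm (u - w) \<le> s * (1/2)"
      proof -
        have "\<epsilon> * norm (u - w) = s * (\<epsilon> * norm v)" using \<theta>(3) s by (simp add: s_def)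
        also have "\<dots> \<le> s * (\<epsilon> * V)" using s \<epsilon> v(2) by (intro mult_left_mono) auto
        also have "\<dots> \<le> s * (1/2)" using s \<epsilon> by (intro mult_left_mono) auto
        finally show ?thesis .
      qed
      ultimately show ?thesis using slope[OF i _ u, of w] w(2)[OF i] s sub w(1) by auto
    qed
    then show "u \<in> ?O" using u by fastforce
  qed
  have across: "closed_segment (w + (9 * \<rho>') *\<^sub>R v) (w' + (9 * \<rho>') *\<^sub>R v) \<subseteq> ?O"
  proof
    fix u assume "u \<in> closed_segment (w + (9 * \<rho>') *\<^sub>R v) (w' + (9 * \<rho>') *\<^sub>R v)"
    then obtain \<theta> where \<theta>: "0 \<le> \<theta>" "\<theta> \<le> 1"
      "u = (1 - \<theta>) *\<^sub>R (w + (9 * \<rho>') *\<^sub>R v) + \<theta> *\<^sub>R (w' + (9 * \<rho>') *\<^sub>R v)"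
      by (auto simp: in_segment)
    define x where "x = (1 - \<theta>) *\<^sub>R w + \<theta> *\<^sub>R w'"
    have ux: "u = x + (9 * \<rho>') *\<^sub>R v" unfolding x_def \<theta>(3) by (simp add: algebra_simps)
    have x: "x \<in> ball q \<rho>'"
      using convexD_alt[OF convex_ball w(1) w'(1) \<theta>(1,2)] by (simp add: x_def)
    have u: "u \<in> ball q \<rho>" using inball[OF x, of "9*\<rho>'"] \<rho>' ux by auto
    have xw: "norm (x - w) < 2 * \<rho>'"
      using x w(1) norm_triangle_ineq4[of "x - q" "w - q"]
      by (auto simp: dist_norm norm_minus_commute)
    have "\<sigma> i * g i u > 0" if i: "i \<in> I" for i
    proof -
      have "\<sigma> i * (c i \<bullet> (u - w)) = 9 * \<rho>' + \<sigma> i * (c i \<bullet> (x - w))"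
        using v(1)[OF i] \<sigma>[OF i] by (auto simp: ux inner_simps)
      moreover have "\<bar>\<sigma> i * (c i \<bullet> (x - w))\<bar> \<le> norm (x - w)"
        using Cauchy_Schwarz_ineq2[of "c i" "x - w"] unit[OF i] \<sigma>[OF i] by auto
      moreover have "\<epsilon> * norm (u - w) \<le> \<epsilon> * norm (x - w) + 9 * \<rho>' * (1/2)"
      proof -
        have "norm (u - w) \<le> norm (x - w) + norm ((9 * \<rho>') *\<^sub>R v)"
          using norm_triangle_ineq[of "x - w" "(9 * \<rho>') *\<^sub>R v"] by (simp add: ux algebra_simps)
        also have "norm ((9 * \<rho>') *\<^sub>R v) \<le> (9 * \<rho>') * V"
          using v(2) \<rho>'(1) by (simp add: mult_left_mono)
        finally have "norm (u - w) \<le> norm (x - w) + (9 * \<rho>') * V" by simp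
        then have "\<epsilon> * norm (u - w) \<le> \<epsilon> * norm (x - w) + (9 * \<rho>') * (\<epsilon> * V)"
          using mult_left_mono[OF _ \<epsilon>(1), of "norm (u - w)" "norm (x - w) + (9 * \<rho>') * V"]
          by (simp add: algebra_simps)
        also have "\<dots> \<le> \<epsilon> * norm (x - w) + 9 * \<rho>' * (1/2)"
          using \<epsilon> \<rho>' by (intro add_left_mono mult_left_mono) auto
        finally show ?thesis .
      qed
      moreover have "\<epsilon> * norm (x - w) \<le> 1/2 * norm (x - w)"
        using \<epsilon> by (intro mult_right_mono) auto
      ultimately show ?thesis using slope[OF i _ u, of w] w(2)[OF i] xw \<rho>' sub w(1) by auto
    qed
    then show "u \<in> ?O" using u by fastforce
  qed
  (* Out of the narrow part of the region, across its wide part, and back. *)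
  have "F w = F (w + (9 * \<rho>') *\<^sub>R v)" by (rule seg[OF up[OF w]])
  also have "\<dots> = F (w' + (9 * \<rho>') *\<^sub>R v)" by (rule seg[OF across])
  also have "\<dots> = F w'" by (rule seg[OF up[OF w'], symmetric])
  finally show ?thesis .
qed

text \<open>From \<open>q\<close> one moves by \<open>T\<close> in a direction \<open>v\<close> tangent to the sheet \<open>i\<close> and into the required side of the
  others. Going back to the zero set of \<open>g i\<close> takes a step of length at most \<open>T/4\<close> along \<open>c i\<close>, too
  short to change the other signs.\<close>
lemma simple_zero_exists:
  fixes q :: "'b::euclidean_space"
  assumes unit: "\<And>i. i \<in> I \<Longrightarrow> norm (c i) = 1"
    and i: "i \<in> I" and v: "c i \<bullet> v = 0" "\<And>k. k \<in> I - {i} \<Longrightarrow> c k \<bullet> v = \<sigma> k" "norm v \<le> V"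
    and \<sigma>: "\<And>k. k \<in> I - {i} \<Longrightarrow> \<sigma> k \<in> {-1, 1}"
    and \<epsilon>: "0 \<le> \<epsilon>" "\<epsilon> * V \<le> 1/8" "\<epsilon> \<le> 1/8"
    and al: "\<And>i. i \<in> I \<Longrightarrow> almost_linear_on (ball q \<rho>) \<epsilon> (g i) (c i)"
    and zero: "\<And>i. i \<in> I \<Longrightarrow> g i q = 0" and "\<rho> > 0"
  obtains w where "w \<in> ball q \<rho>" "g i w = 0" "\<And>k. k \<in> I - {i} \<Longrightarrow> \<sigma> k * g k w > 0"
proof -
  have V: "V \<ge> 0" using v(3) norm_ge_zero[of v] by linarith
  (* The whole path has length at most T * V + T/4 and stays in the ball. *)
  define T where "T = \<rho> / (V + 2)"
  have T: "T > 0" "T * (V + 1/4) < \<rho>"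
    unfolding T_def using \<open>\<rho> > 0\<close> V by (auto simp: field_simps)
  define u where "u = (\<lambda>s. q + T *\<^sub>R v + s *\<^sub>R c i)"
  have nu: "norm (u s - q) \<le> T * V + T/4" if "\<bar>s\<bar> \<le> T/4" for s
  proof -
    have "norm (u s - q) \<le> norm (T *\<^sub>R v) + norm (s *\<^sub>R c i)"
      unfolding u_def using norm_triangle_ineq[of "T *\<^sub>R v" "s *\<^sub>R c i"] by (simp add: algebra_simps)
    moreover have "norm (T *\<^sub>R v) \<le> T * V" "norm (s *\<^sub>R c i) \<le> T/4"
      using T v(3) that unit[OF i] by (simp_all add: mult_left_mono)
    ultimately show ?thesis by linarith
  qed
  have ub: "u s \<in> ball q \<rho>" if "\<bar>s\<bar> \<le> T/4" for s
    using nu[OF that] T by (simp add: dist_norm norm_minus_commute algebra_simps)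
  have err: "\<epsilon> * norm (u s - q) \<le> 5/32 * T" if "\<bar>s\<bar> \<le> T/4" for s
  proof -
    have "\<epsilon> * norm (u s - q) \<le> \<epsilon> * (T * V + T/4)" using nu[OF that] \<epsilon> by (intro mult_left_mono)
    also have "\<dots> = T * (\<epsilon> * V) + \<epsilon> * (T/4)" by (simp add: algebra_simps)
    also have "\<dots> \<le> T * (1/8) + 1/8 * (T/4)"
      using T \<epsilon> by (intro add_mono mult_left_mono mult_right_mono) auto
    finally show ?thesis by simp
  qed
  have cu: "\<bar>g k (u s) - c k \<bullet> (u s - q)\<bar> \<le> 5/32 * T" if "k \<in> I" "\<bar>s\<bar> \<le> T/4" for k s
    using almost_linear_onD[OF al[OF that(1)] ub[OF that(2)], of q] err[OF that(2)] zero[OF that(1)]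
      \<open>\<rho> > 0\<close> by simp
  have ci: "c i \<bullet> (u s - q) = s" for s
    using unit[OF i] v(1) by (simp add: u_def inner_simps dot_square_norm)
  have "\<exists>s\<ge>-T/4. s \<le> T/4 \<and> g i (u s) = 0"
  proof (rule IVT')
    show "g i (u (- T/4)) \<le> 0" using cu[OF i, of "-T/4"] T(1) unfolding ci by linarith
    show "0 \<le> g i (u (T/4))" using cu[OF i, of "T/4"] T(1) unfolding ci by linarith
    show "continuous_on {- T/4..T/4} (\<lambda>s. g i (u s))"
      by (rule continuous_on_compose2[OF almost_linear_on_continuous[OF al[OF i]]])
        (auto simp: u_def[symmetric] intro!: ub, auto simp: u_def intro!: continuous_intros)
  qed (use T in auto)
  then obtain s where "-T/4 \<le> s" "s \<le> T/4" "g i (u s) = 0" by blast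
  then have s: "\<bar>s\<bar> \<le> T/4" "g i (u s) = 0" by auto
  have "\<sigma> k * g k (u s) > 0" if k: "k \<in> I - {i}" for k
  proof -
    have "\<bar>s * (c k \<bullet> c i)\<bar> \<le> T/4"
      using Cauchy_Schwarz_ineq2[of "c k" "c i"] unit[of k] unit[OF i] k s(1)
        mult_mono[of "\<bar>s\<bar>" "T/4" "\<bar>c k \<bullet> c i\<bar>" 1] by (auto simp: abs_mult)
    moreover have "c k \<bullet> (u s - q) = T * \<sigma> k + s * (c k \<bullet> c i)"
      using v(2)[OF k] by (simp add: u_def inner_simps)
    moreover have "\<bar>g k (u s) - c k \<bullet> (u s - q)\<bar> \<le> 5/32 * T" using cu s(1) k by blast
    moreover have "\<sigma> k = 1 \<or> \<sigma> k = -1" using \<sigma>[OF k] by blast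
    ultimately show ?thesis
    proof (elim disjE)
      assume h: "c k \<bullet> (u s - q) = T * \<sigma> k + s * (c k \<bullet> c i)" "\<bar>s * (c k \<bullet> c i)\<bar> \<le> T/4"
        "\<bar>g k (u s) - c k \<bullet> (u s - q)\<bar> \<le> 5/32 * T" "\<sigma> k = 1"
      then have "g k (u s) > 0" using T(1) unfolding h(4) by linarith
      then show ?thesis using h(4) by simp
    next
      assume h: "c k \<bullet> (u s - q) = T * \<sigma> k + s * (c k \<bullet> c i)" "\<bar>s * (c k \<bullet> c i)\<bar> \<le> T/4"
        "\<bar>g k (u s) - c k \<bullet> (u s - q)\<bar> \<le> 5/32 * T" "\<sigma> k = -1"
      then have "g k (u s) < 0" using T(1) unfolding h(4) by linarith
      then show ?thesis using h(4) by simp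
    qed
  qed
  then show thesis by (intro that[of "u s"] ub s)
qed

text \<open>The sign patterns of the \<open>g i\<close> behave like the octants of transverse planes: \<open>F\<close> is constant on each,
  two that differ in one sign share a simple zero, across which \<open>F\<close> does not change, and all are
  reached from the pattern without positive signs by changing one sign at a time.\<close>
lemma constant_near_common_zero:
  fixes q :: "'b::euclidean_space"
  assumes fin: "finite I" and unit: "\<And>i. i \<in> I \<Longrightarrow> norm (c i) = 1"
    and V: "V > 0" "\<And>a. \<forall>i\<in>I. \<bar>a i\<bar> \<le> 1 \<Longrightarrow> \<exists>v. norm v \<le> V \<and> (\<forall>i\<in>I. c i \<bullet> v = a i)"
    and \<epsilon>: "0 \<le> \<epsilon>" "\<epsilon> * V \<le> 1/8" "\<epsilon> \<le> 1/8"
    and al: "\<And>i. i \<in> I \<Longrightarrow> almost_linear_on (ball q \<rho>) \<epsilon> (g i) (c i)"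
    and zero: "\<And>i. i \<in> I \<Longrightarrow> g i q = 0" and \<rho>: "\<rho> > 0"
    and seg: "\<And>w1 w2. closed_segment w1 w2 \<subseteq> {w \<in> ball q \<rho>. \<forall>i\<in>I. g i w \<noteq> 0} \<Longrightarrow> F w1 = F w2"
    and jump: "\<And>w i. i \<in> I \<Longrightarrow> w \<in> ball q \<rho> \<Longrightarrow> g i w = 0 \<Longrightarrow> \<forall>k\<in>I - {i}. g k w \<noteq> 0 \<Longrightarrow>
      \<exists>\<nu>. \<forall>\<^sub>F e in at_right 0. g i (w + e *\<^sub>R \<nu>) > 0 \<and> g i (w - e *\<^sub>R \<nu>) < 0 \<and>
        F (w + e *\<^sub>R \<nu>) = F (w - e *\<^sub>R \<nu>)"
  obtains \<rho>' where "0 < \<rho>'" "\<rho>' \<le> \<rho>"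
    "\<forall>w\<in>ball q \<rho>'. \<forall>w'\<in>ball q \<rho>'. (\<forall>i\<in>I. g i w \<noteq> 0) \<longrightarrow> (\<forall>i\<in>I. g i w' \<noteq> 0) \<longrightarrow> F w = F w'"
proof -
  define \<rho>' where "\<rho>' = \<rho> / (1 + 9 * V)"
  have \<rho>': "0 < \<rho>'" "\<rho>' * (1 + 9 * V) \<le> \<rho>" "\<rho>' \<le> \<rho>"
    unfolding \<rho>'_def using \<rho> V(1) by (auto simp: field_simps)
  define region where
    "region J = {w \<in> ball q \<rho>'. \<forall>i\<in>I. (if i \<in> J then 1 else -1) * g i w > 0}" for J
  have region_const: "F w = F w'" if "w \<in> region J" "w' \<in> region J" for J w w'
  proof -
    have "\<exists>v. norm v \<le> V \<and> (\<forall>i\<in>I. c i \<bullet> v = (if i \<in> J then 1 else -1))"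
      by (rule V(2)) auto
    then obtain v where v: "norm v \<le> V" "\<forall>i\<in>I. c i \<bullet> v = (if i \<in> J then 1 else -1)" by blast
    show ?thesis
    proof (rule constant_on_sign_region[where \<sigma> = "\<lambda>i. if i \<in> J then 1 else -1"
          and I = I and c = c and v = v and V = V and \<epsilon> = \<epsilon> and q = q and \<rho> = \<rho> and g = g and \<rho>' = \<rho>'])
      show "\<epsilon> * V \<le> 1/2" "\<epsilon> \<le> 1/2" using \<epsilon> by auto
      show "F w1 = F w2" if "closed_segment w1 w2 \<subseteq> {w \<in> ball q \<rho>. \<forall>i\<in>I. g i w \<noteq> 0}" for w1 w2
        using that by (rule seg)
      show "0 < (if i \<in> J then 1 else - 1) * g i w" "0 < (if i \<in> J then 1 else - 1) * g i w'"
        if "i \<in> I" for i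
        using \<open>w \<in> region J\<close> \<open>w' \<in> region J\<close> that unfolding region_def by blast+
      show "w \<in> ball q \<rho>'" "w' \<in> ball q \<rho>'" using that unfolding region_def by blast+
      show "c i \<bullet> v = (if i \<in> J then 1 else - 1)" if "i \<in> I" for i using v that by blast
    qed (use unit v(1) al \<rho>' \<epsilon>(1) in simp_all)
  qed
  have adjacent: "\<exists>w w'. w \<in> region (insert i J) \<and> w' \<in> region J \<and> F w = F w'"
    if i: "i \<in> I" "i \<notin> J" for i J
  proof -
    have "\<exists>v. norm v \<le> V \<and> (\<forall>k\<in>I. c k \<bullet> v = (if k = i then 0 else if k \<in> J then 1 else -1))"
      by (rule V(2)) auto
    then obtain v where v: "norm v \<le> V"
        "\<forall>k\<in>I. c k \<bullet> v = (if k = i then 0 else if k \<in> J then 1 else -1)" by blast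
    have al': "almost_linear_on (ball q \<rho>') \<epsilon> (g k) (c k)" if "k \<in> I" for k
      using al[OF that] by (rule almost_linear_on_subset) (use \<rho>' in auto)
    obtain w where w: "w \<in> ball q \<rho>'" "g i w = 0"
      "\<And>k. k \<in> I - {i} \<Longrightarrow> (if k \<in> J then 1 else -1) * g k w > 0"
      by (rule simple_zero_exists[of I c i v "\<lambda>k. if k \<in> J then 1 else -1" V \<epsilon> q \<rho>' g])
        (use unit i v \<epsilon> zero \<rho>'(1) al' in \<open>auto split: if_splits\<close>)
    have wk: "\<forall>k\<in>I - {i}. g k w \<noteq> 0" using w(3) by fastforce
    obtain \<nu> where \<nu>: "\<forall>\<^sub>F e in at_right 0. g i (w + e *\<^sub>R \<nu>) > 0 \<and> g i (w - e *\<^sub>R \<nu>) < 0 \<and>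
        F (w + e *\<^sub>R \<nu>) = F (w - e *\<^sub>R \<nu>)"
      using jump[OF i(1) _ w(2) wk] w(1) \<rho>' by auto
    have lim: "((\<lambda>e. w + e *\<^sub>R \<nu>) \<longlongrightarrow> w) (at_right 0)" "((\<lambda>e. w - e *\<^sub>R \<nu>) \<longlongrightarrow> w) (at_right 0)"
      by (auto intro!: tendsto_eq_intros)
    define G where "G = {w \<in> ball q \<rho>'. \<forall>k\<in>I - {i}. (if k \<in> J then 1 else -1) * g k w > 0}"
    have "open {w \<in> ball q \<rho>'. (if k \<in> J then 1 else -1) * g k w > 0}" if "k \<in> I" for k
    proof -
      have "continuous_on (ball q \<rho>') (\<lambda>w. (if k \<in> J then 1 else -1) * g k w)"
        using almost_linear_on_continuous[OF al'[OF that]] by (intro continuous_intros)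
      then have "open (ball q \<rho>' \<inter> (\<lambda>w. (if k \<in> J then 1 else -1) * g k w) -` {0<..})"
        by (rule continuous_open_preimage[OF _ open_ball open_greaterThan])
      moreover have "ball q \<rho>' \<inter> (\<lambda>w. (if k \<in> J then 1 else -1) * g k w) -` {0<..} =
          {w \<in> ball q \<rho>'. (if k \<in> J then 1 else -1) * g k w > 0}" by blast
      ultimately show ?thesis by simp
    qed
    moreover have "G = ball q \<rho>' \<inter>
        (\<Inter>k\<in>I - {i}. {w \<in> ball q \<rho>'. (if k \<in> J then 1 else -1) * g k w > 0})"
      unfolding G_def by blast
    ultimately have "open G" using fin by (simp add: open_Int open_INT)
    moreover have "w \<in> G" unfolding G_def using w by auto
    ultimately have "\<forall>\<^sub>F e in at_right 0. w + e *\<^sub>R \<nu> \<in> G \<and> w - e *\<^sub>R \<nu> \<in> G"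
      using topological_tendstoD[OF lim(1)] topological_tendstoD[OF lim(2)]
      by (auto intro: eventually_conj)
    with \<nu> have "\<forall>\<^sub>F e in at_right 0. g i (w + e *\<^sub>R \<nu>) > 0 \<and> g i (w - e *\<^sub>R \<nu>) < 0 \<and>
        F (w + e *\<^sub>R \<nu>) = F (w - e *\<^sub>R \<nu>) \<and> w + e *\<^sub>R \<nu> \<in> G \<and> w - e *\<^sub>R \<nu> \<in> G"
      by eventually_elim auto
    then obtain e where e: "g i (w + e *\<^sub>R \<nu>) > 0" "g i (w - e *\<^sub>R \<nu>) < 0"
        "F (w + e *\<^sub>R \<nu>) = F (w - e *\<^sub>R \<nu>)" "w + e *\<^sub>R \<nu> \<in> G" "w - e *\<^sub>R \<nu> \<in> G"
      using eventually_happens'[OF trivial_limit_at_right_real] by blast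
    have "w + e *\<^sub>R \<nu> \<in> region (insert i J)" "w - e *\<^sub>R \<nu> \<in> region J"
    proof -
      have "(if k \<in> insert i J then 1 else -1) * g k (w + e *\<^sub>R \<nu>) > 0"
        "(if k \<in> J then 1 else -1) * g k (w - e *\<^sub>R \<nu>) > 0" if "k \<in> I" for k
      proof -
        have "k \<noteq> i \<Longrightarrow> (if k \<in> J then 1 else -1) * g k (w + e *\<^sub>R \<nu>) > 0"
          "k \<noteq> i \<Longrightarrow> (if k \<in> J then 1 else -1) * g k (w - e *\<^sub>R \<nu>) > 0"
          using e(4,5) that unfolding G_def by blast+
        then show "(if k \<in> insert i J then 1 else -1) * g k (w + e *\<^sub>R \<nu>) > 0"
          "(if k \<in> J then 1 else -1) * g k (w - e *\<^sub>R \<nu>) > 0"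
          using e(1,2) i by (cases "k = i"; cases "k \<in> J"; simp)+
      qed
      then show "w + e *\<^sub>R \<nu> \<in> region (insert i J)" "w - e *\<^sub>R \<nu> \<in> region J"
        using e(4,5) unfolding region_def G_def by blast+
    qed
    with e(3) show ?thesis by blast
  qed
  have all: "\<forall>w\<in>region J. \<forall>w'\<in>region {}. F w = F w'" if "finite J" "J \<subseteq> I" for J
    using that
  proof (induction J)
    case empty
    then show ?case using region_const by blast
  next
    case (insert i J)
    show ?case
    proof (intro ballI)
      fix w w' assume w: "w \<in> region (insert i J)" "w' \<in> region {}"
      obtain u u' where u: "u \<in> region (insert i J)" "u' \<in> region J" "F u = F u'"
        using adjacent[of i J] insert by blast
      have "F w = F u" using region_const[OF w(1) u(1)] .
      moreover have "F u' = F w'" using u(2) w(2) insert by blast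
      ultimately show "F w = F w'" using u(3) by simp
    qed
  qed
  have nonempty: "\<exists>w. w \<in> region {}"
  proof -
    have "\<exists>w. w \<in> region J" if "J \<subseteq> I" for J
    proof (cases "\<exists>i. i \<in> I")
      case True
      then obtain i where "i \<in> I" by blast
      then show ?thesis
      proof (cases "i \<in> J")
        case True
        then show ?thesis using adjacent[OF \<open>i \<in> I\<close>, of "J - {i}"] by (force simp: insert_absorb)
      next
        case False
        then show ?thesis using adjacent[OF \<open>i \<in> I\<close>, of J] by blast
      qed
    next
      case False
      then show ?thesis using \<rho>' by (auto simp: region_def intro!: exI[of _ q])
    qed
    then show ?thesis by auto
  qed
  then obtain w0 where w0: "w0 \<in> region {}" by blast
  have "F w = F w0" if w: "w \<in> ball q \<rho>'" "\<forall>i\<in>I. g i w \<noteq> 0" for w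
  proof -
    have "\<forall>w\<in>region {i \<in> I. g i w > 0}. \<forall>w'\<in>region {}. F w = F w'"
      by (rule all) (use fin in auto)
    moreover have "w \<in> region {i \<in> I. g i w > 0}"
      using w unfolding region_def by (auto simp: not_less less_le)
    ultimately show ?thesis using w0 by blast
  qed
  then show thesis by (intro that[of \<rho>'] \<rho>') simp
qed

section \<open>Sheets of a regular homotopy as zero sets\<close>

lemma smooth_on_has_derivative:
  assumes "smooth_on U f" and "open U" and "x \<in> U"
  shows "(f has_derivative frechet_derivative f (at x)) (at x)"
proof -
  have "Ck_on (Suc 0) f U" using assms(1) unfolding smooth_on_def by blast
  then have "f differentiable (at x within U)" using assms(3) by (simp add: differentiable_on_def)
  then show ?thesis
    by (simp add: at_within_open[OF assms(3,2)] frechet_derivative_works)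
qed

lemma smooth_on_continuous_on: "smooth_on U f \<Longrightarrow> continuous_on U f"
  unfolding smooth_on_def using Ck_on.simps(1) by blast

lemma smooth_on_continuous_partial:
  assumes "smooth_on U f" and "v \<in> Basis"
  shows "continuous_on U (\<lambda>x. frechet_derivative f (at x) v)"
proof -
  have "Ck_on (Suc 0) f U" using assms(1) unfolding smooth_on_def by blast
  then show ?thesis using assms(2) by simp
qed

lemma linear_real2_expand:
  fixes L :: "real^2 \<Rightarrow> 'b::real_vector"
  assumes "linear L"
  shows "L v = v $ 1 *\<^sub>R L (axis 1 1) + v $ 2 *\<^sub>R L (axis 2 1)"
proof -
  have "v = v $ 1 *\<^sub>R axis 1 1 + v $ 2 *\<^sub>R axis 2 1"
    by (simp add: vec_eq_iff forall_2 axis_def)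
  then have "L v = L (v $ 1 *\<^sub>R axis 1 1 + v $ 2 *\<^sub>R axis 2 1)" by (rule arg_cong)
  then show ?thesis using assms by (simp add: linear_add linear_scale)
qed

text \<open>This is why an orientation preserving change of charts does not change the coorientation.\<close>
lemma cross3_linear_compose:
  fixes L :: "real^2 \<Rightarrow> real^3" and J :: "real^2 \<Rightarrow> real^2"
  assumes "linear L"
  shows "cross3 (L (J (axis 1 1))) (L (J (axis 2 1))) =
    det (matrix J) *\<^sub>R cross3 (L (axis 1 1)) (L (axis 2 1))"
  unfolding linear_real2_expand[OF assms, of "J _"] det_2 matrix_def
  by (simp add: cross3_simps)

lemma cross3_ne_zero:
  fixes L :: "real^2 \<Rightarrow> real^3"
  assumes "linear L" "inj L"
  shows "cross3 (L (axis 1 1)) (L (axis 2 1)) \<noteq> 0"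
proof
  assume "cross3 (L (axis 1 1)) (L (axis 2 1)) = 0"
  then consider "L (axis 1 1) = 0" | "L (axis 2 1) = 0" | c where "L (axis 2 1) = c *\<^sub>R L (axis 1 1)"
    by (auto simp: cross_eq_0 collinear_lemma)
  then show False
  proof cases
    case 3
    then have "L (axis 2 1) = L (c *\<^sub>R axis 1 1)" using assms(1) by (simp add: linear_scale)
    then have "axis 2 1 = (c *\<^sub>R axis 1 1 :: real^2)" using assms(2) by (simp add: inj_eq)
    then show False by (simp add: vec_eq_iff forall_2 axis_def)
  qed (use assms in \<open>auto simp: linear_injective_0 axis_eq_0_iff\<close>)
qed

text \<open>The solution is the fixed point of the contraction \<open>y \<mapsto> w - (P y - y)\<close>.\<close>
lemma perturbed_identity_surjective:
  fixes P :: "'b::euclidean_space \<Rightarrow> 'b"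
  assumes lip: "\<And>y y'. y \<in> cball 0 R \<Longrightarrow> y' \<in> cball 0 R \<Longrightarrow>
      norm ((P y - y) - (P y' - y')) \<le> \<epsilon> * norm (y - y')"
    and \<epsilon>: "0 \<le> \<epsilon>" "\<epsilon> \<le> 1/4" and R: "R > 0" and q: "norm (P 0 - q) \<le> R/8" and w: "w \<in> ball q (R/8)"
  shows "\<exists>y\<in>ball 0 R. P y = w"
proof -
  let ?T = "\<lambda>y. w - (P y - y)"
  have T: "?T y \<in> cball 0 (R/2)" if "y \<in> cball 0 R" for y
  proof -
    have "?T y = (w - q) - (P 0 - q) - ((P y - y) - (P 0 - 0))" by simp
    also have "norm \<dots> \<le> norm (w - q) + norm (P 0 - q) + norm ((P y - y) - (P 0 - 0))"
      by (meson add_right_mono norm_triangle_ineq4 order_trans)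
    also have "norm ((P y - y) - (P 0 - 0)) \<le> 1/4 * R"
      using lip[OF that, of 0] R that \<epsilon> mult_mono[of \<epsilon> "1/4" "norm y" R] by simp
    finally show ?thesis using q w by (simp add: dist_norm norm_minus_commute)
  qed
  have "\<exists>!y. y \<in> cball 0 R \<and> ?T y = y"
  proof (rule Banach_fix[of _ "1/4"])
    show "complete (cball (0::'b) R)" by (simp add: compact_imp_complete)
    show "cball (0::'b) R \<noteq> {}" using R by auto
    show "?T ` cball 0 R \<subseteq> cball 0 R" using T R by fastforce
    show "dist (?T x) (?T y) \<le> 1/4 * dist x y" if "x \<in> cball 0 R" "y \<in> cball 0 R" for x y
    proof -
      have "dist (?T x) (?T y) = norm ((P x - x) - (P y - y))"
        by (simp add: dist_norm norm_minus_commute algebra_simps)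
      also have "\<dots> \<le> \<epsilon> * norm (x - y)" by (rule lip[OF that])
      also have "\<dots> \<le> 1/4 * norm (x - y)" using \<epsilon> by (intro mult_right_mono) auto
      finally show ?thesis by (simp add: dist_norm)
    qed
  qed auto
  then obtain y where y: "y \<in> cball 0 R" "?T y = y" by blast
  then have "norm y \<le> R/2" using T[OF y(1)] by simp
  then show ?thesis using R y(2) by (intro bexI[of _ y]) (auto simp: algebra_simps)
qed

locale surface_homotopy =
  fixes M :: "'a::t2_space set" and \<A> :: "'a atlas" and a b :: real and H :: "real \<Rightarrow> 'a \<Rightarrow> real^3"
  assumes surface: "closed_oriented_surface M \<A>" and homotopy: "regular_homotopy \<A> a b H"
begin

abbreviation normal :: "real \<Rightarrow> 'a \<Rightarrow> real^3" where
  "normal t \<equiv> coorientation \<A> (H t)"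

definition in_chart :: "'a set \<Rightarrow> ('a \<Rightarrow> real^2) \<Rightarrow> real \<times> (real^2) \<Rightarrow> real^3" where
  "in_chart U \<phi> = (\<lambda>(t, z). H t (inv_into U \<phi> z))"

text \<open>The joint derivative in time and space is used, because smoothness of the homotopy makes it
  continuous in both.\<close>
definition tangent :: "'a set \<Rightarrow> ('a \<Rightarrow> real^2) \<Rightarrow> real \<times> (real^2) \<Rightarrow> real^2 \<Rightarrow> real^3" where
  "tangent U \<phi> u v = frechet_derivative (in_chart U \<phi>) (at u) (0, v)"

lemma compact_M: "compact M"
  using surface unfolding closed_oriented_surface_def by blast

lemma atlas: "oriented_atlas M \<A>"
  using surface unfolding closed_oriented_surface_def by blast

lemma chart_cover: "x \<in> M \<Longrightarrow> \<exists>U \<phi>. (U, \<phi>) \<in> \<A> \<and> x \<in> U"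
  using atlas unfolding oriented_atlas_def by blast

lemma chart:
  assumes "(U, \<phi>) \<in> \<A>"
  shows "openin (top_of_set M) U" "open (\<phi> ` U)" "homeomorphism U (\<phi> ` U) \<phi> (inv_into U \<phi>)"
    "U \<subseteq> M" "\<And>x. x \<in> U \<Longrightarrow> inv_into U \<phi> (\<phi> x) = x"
    "\<And>z. z \<in> \<phi> ` U \<Longrightarrow> \<phi> (inv_into U \<phi> z) = z" "\<And>z. z \<in> \<phi> ` U \<Longrightarrow> inv_into U \<phi> z \<in> U"
proof -
  show "openin (top_of_set M) U" "open (\<phi> ` U)" and h: "homeomorphism U (\<phi> ` U) \<phi> (inv_into U \<phi>)"
    using atlas assms unfolding oriented_atlas_def by blast+
  show "U \<subseteq> M" using \<open>openin (top_of_set M) U\<close> openin_imp_subset by blast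
  show "inv_into U \<phi> (\<phi> x) = x" if "x \<in> U" for x using h that by (auto simp: homeomorphism_def)
  show "\<phi> (inv_into U \<phi> z) = z" if "z \<in> \<phi> ` U" for z using that by (rule f_inv_into_f)
  show "inv_into U \<phi> z \<in> U" if "z \<in> \<phi> ` U" for z using that by (rule inv_into_into)
qed

lemma chart_open_image:
  assumes "(U, \<phi>) \<in> \<A>" "openin (top_of_set M) V"
  shows "open (\<phi> ` (U \<inter> V))"
proof -
  have "openin (top_of_set U) (U \<inter> V)"
    using assms(2) chart(4)[OF assms(1)] by (auto simp: openin_open)
  then have "openin (top_of_set (\<phi> ` U)) (\<phi> ` (U \<inter> V))"
    by (rule homeomorphism_imp_open_map[OF chart(3)[OF assms(1)]])
  then show ?thesis using chart(2)[OF assms(1)] openin_open_trans by blast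
qed

lemma in_chart_smooth:
  assumes "(U, \<phi>) \<in> \<A>"
  shows "smooth_on ({a<..<b} \<times> \<phi> ` U) (in_chart U \<phi>)" "open ({a<..<b} \<times> \<phi> ` U)"
  using homotopy assms chart(2)[OF assms] unfolding regular_homotopy_def in_chart_def
  by (auto intro: open_Times)

lemma in_chart_has_derivative:
  assumes "(U, \<phi>) \<in> \<A>" "t \<in> {a<..<b}" "z \<in> \<phi> ` U"
  shows "(H t \<circ> inv_into U \<phi> has_derivative tangent U \<phi> (t, z)) (at z)"
proof -
  have "(in_chart U \<phi> has_derivative frechet_derivative (in_chart U \<phi>) (at (t, z))) (at (t, z))"
    by (rule smooth_on_has_derivative[OF in_chart_smooth[OF assms(1)]]) (use assms in auto)
  moreover have "((\<lambda>z. (t, z)) has_derivative (\<lambda>v. (0, v))) (at z)"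
    by (rule has_derivative_Pair[OF has_derivative_const has_derivative_ident])
  ultimately have "((\<lambda>z. in_chart U \<phi> (t, z)) has_derivative tangent U \<phi> (t, z)) (at z)"
    unfolding tangent_def using has_derivative_compose by fast
  then show ?thesis unfolding in_chart_def o_def by simp
qed

lemma
  assumes "(U, \<phi>) \<in> \<A>" "t \<in> {a<..<b}" "z \<in> \<phi> ` U"
  shows frechet_in_chart: "frechet_derivative (H t \<circ> inv_into U \<phi>) (at z) = tangent U \<phi> (t, z)"
    and tangent_linear: "linear (tangent U \<phi> (t, z))"
    and tangent_inj: "inj (tangent U \<phi> (t, z))"
proof -
  show f: "frechet_derivative (H t \<circ> inv_into U \<phi>) (at z) = tangent U \<phi> (t, z)"
    using frechet_derivative_at[OF in_chart_has_derivative[OF assms]] by simp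
  show "linear (tangent U \<phi> (t, z))"
    using in_chart_has_derivative[OF assms] has_derivative_linear by blast
  have "immersion \<A> (H t)" using homotopy assms(2) unfolding regular_homotopy_def by blast
  then have "inj (frechet_derivative (H t \<circ> inv_into U \<phi>) (at z))"
    using assms(1,3) unfolding immersion_def by blast
  then show "inj (tangent U \<phi> (t, z))" unfolding f .
qed

lemma tangent_continuous:
  assumes "(U, \<phi>) \<in> \<A>"
  shows "continuous_on ({a<..<b} \<times> \<phi> ` U) (\<lambda>u. tangent U \<phi> u (axis i 1))"
  unfolding tangent_def
  by (rule smooth_on_continuous_partial[OF in_chart_smooth(1)[OF assms]])
    (auto simp: Basis_prod_def axis_in_Basis_iff)

lemma in_chart_continuous:
  "(U, \<phi>) \<in> \<A> \<Longrightarrow> continuous_on ({a<..<b} \<times> \<phi> ` U) (in_chart U \<phi>)"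
  using in_chart_smooth smooth_on_continuous_on by blast

lemma tangent_change_of_chart:
  assumes U: "(U, \<phi>) \<in> \<A>" and V: "(V, \<psi>) \<in> \<A>" and t: "t \<in> {a<..<b}" and x: "x \<in> U" "x \<in> V"
  obtains J where "det (matrix J) > 0" "tangent U \<phi> (t, \<phi> x) = tangent V \<psi> (t, \<psi> x) \<circ> J"
proof -
  let ?T = "\<psi> \<circ> inv_into U \<phi>"
  let ?J = "frechet_derivative ?T (at (\<phi> x))"
  let ?W = "\<phi> ` (U \<inter> V)"
  have W: "open ?W" "\<phi> x \<in> ?W"
    using chart_open_image[OF U chart(1)[OF V]] x by auto
  have T: "smooth_on ?W ?T" "det (matrix ?J) > 0"
    using atlas U V W(2) unfolding oriented_atlas_def by blast+
  have dT: "(?T has_derivative ?J) (at (\<phi> x))" by (rule smooth_on_has_derivative[OF T(1) W])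
  have Tx: "?T (\<phi> x) = \<psi> x" using chart(5)[OF U] x by simp
  have "(H t \<circ> inv_into V \<psi> has_derivative tangent V \<psi> (t, \<psi> x)) (at (?T (\<phi> x)))"
    unfolding Tx by (rule in_chart_has_derivative[OF V t]) (use x in auto)
  from diff_chain_at[OF dT this]
  have "((H t \<circ> inv_into V \<psi>) \<circ> ?T has_derivative tangent V \<psi> (t, \<psi> x) \<circ> ?J) (at (\<phi> x))" .
  then have "(H t \<circ> inv_into U \<phi> has_derivative tangent V \<psi> (t, \<psi> x) \<circ> ?J) (at (\<phi> x))"
  proof (rule has_derivative_transform_within_open[OF _ W])
    fix z assume "z \<in> ?W"
    then show "((H t \<circ> inv_into V \<psi>) \<circ> ?T) z = (H t \<circ> inv_into U \<phi>) z"
      using chart(5)[OF U] chart(5)[OF V] by auto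
  qed
  moreover have "(H t \<circ> inv_into U \<phi> has_derivative tangent U \<phi> (t, \<phi> x)) (at (\<phi> x))"
    by (rule in_chart_has_derivative[OF U t]) (use x in auto)
  ultimately show thesis using that[OF T(2)] has_derivative_unique by blast
qed

text \<open>The coorientation is defined by means of a chart that is chosen once for each point. Continuity needs
  a formula in one chart for all points near a given one.\<close>
lemma normal_in_chart:
  assumes "(U, \<phi>) \<in> \<A>" and "t \<in> {a<..<b}" and "x \<in> U"
  shows "normal t x = sgn (cross3 (tangent U \<phi> (t, \<phi> x) (axis 1 1)) (tangent U \<phi> (t, \<phi> x) (axis 2 1)))"
proof -
  obtain V \<psi> where V: "(SOME c. c \<in> \<A> \<and> x \<in> fst c) = (V, \<psi>)" by fastforce
  have "(V, \<psi>) \<in> \<A> \<and> x \<in> fst (V, \<psi>)"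
    unfolding V[symmetric] by (rule someI[of _ "(U, \<phi>)"]) (use assms in auto)
  then have V': "(V, \<psi>) \<in> \<A>" "x \<in> V" by auto
  obtain J where J: "det (matrix J) > 0" "tangent V \<psi> (t, \<psi> x) = tangent U \<phi> (t, \<phi> x) \<circ> J"
    using tangent_change_of_chart[OF V'(1) assms(1,2) V'(2) assms(3)] by blast
  have "normal t x = sgn (cross3 (tangent V \<psi> (t, \<psi> x) (axis 1 1)) (tangent V \<psi> (t, \<psi> x) (axis 2 1)))"
    unfolding coorientation_def V using frechet_in_chart[OF V'(1) assms(2), of "\<psi> x"] V'(2)
    by (simp add: Let_def)
  also have "\<dots> = sgn (det (matrix J) *\<^sub>R cross3 (tangent U \<phi> (t, \<phi> x) (axis 1 1)) (tangent U \<phi> (t, \<phi> x) (axis 2 1)))"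
    unfolding J(2) o_def
    by (subst cross3_linear_compose) (use tangent_linear[OF assms(1,2)] assms(3) in auto)
  finally show ?thesis using J(1) by (simp add: sgn_scaleR)
qed

lemma
  assumes "(U, \<phi>) \<in> \<A>" and "t \<in> {a<..<b}" and "x \<in> U"
  shows norm_normal_in_chart: "norm (normal t x) = 1"
    and normal_orthogonal_tangent: "normal t x \<bullet> tangent U \<phi> (t, \<phi> x) v = 0"
proof -
  let ?L = "tangent U \<phi> (t, \<phi> x)"
  have L: "linear ?L" "inj ?L" using tangent_linear[OF assms(1,2)] tangent_inj[OF assms(1,2)] assms(3) by auto
  show "norm (normal t x) = 1"
    unfolding normal_in_chart[OF assms] using cross3_ne_zero[OF L] by (simp add: norm_sgn)
  show "normal t x \<bullet> ?L v = 0"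
    unfolding normal_in_chart[OF assms] linear_real2_expand[OF L(1), of v]
    by (simp add: sgn_div_norm inner_add_right dot_cross_self)
qed

lemma norm_normal: "t \<in> {a<..<b} \<Longrightarrow> x \<in> M \<Longrightarrow> norm (normal t x) = 1"
  using chart_cover norm_normal_in_chart by blast


text \<open>The sheet \<open>N\<close> through \<open>x0\<close> is the zero set of \<open>g t\<close> in a ball, for all times \<open>t\<close> near \<open>t0\<close>. On the
  sheet the gradient of \<open>g t\<close> is a positive multiple of the actual coorientation, hence the sign of
  \<open>g t\<close> tells the side; almost linearity refers to the fixed coorientation at \<open>x0\<close> and \<open>t0\<close>.\<close>
definition sheet_function ::
  "real \<Rightarrow> 'a \<Rightarrow> real \<Rightarrow> real \<Rightarrow> real \<Rightarrow> 'a set \<Rightarrow> (real \<Rightarrow> real^3 \<Rightarrow> real) \<Rightarrow> bool" where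
  "sheet_function t0 x0 \<epsilon> \<delta> \<rho> N g \<longleftrightarrow>
     x0 \<in> N \<and> openin (top_of_set M) N \<and> {t0 - \<delta><..<t0 + \<delta>} \<subseteq> {a<..<b} \<and>
     (\<forall>t\<in>{t0 - \<delta><..<t0 + \<delta>}. inj_on (H t) N \<and>
        almost_linear_on (ball (H t0 x0) \<rho>) \<epsilon> (g t) (normal t0 x0) \<and>
        (\<forall>w\<in>ball (H t0 x0) \<rho>. g t w = 0 \<longleftrightarrow> w \<in> H t ` N) \<and>
        (\<forall>x\<in>N. normal t0 x0 \<bullet> normal t x \<ge> 1/2 \<and>
           (H t x \<in> ball (H t0 x0) \<rho> \<longrightarrow>
             (\<exists>\<kappa>>0. (g t has_derivative (\<lambda>v. \<kappa> * (normal t x \<bullet> v))) (at (H t x)))))) \<and>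
     (\<forall>w\<in>ball (H t0 x0) \<rho>. ((\<lambda>t. g t w) \<longlongrightarrow> g t0 w) (at t0))"

text \<open>\<open>B\<close> is the orthogonal projection to the tangent plane, followed by the inverse of the tangent map.\<close>
lemma tangent_plane_projection:
  assumes "(U, \<phi>) \<in> \<A>" and "t \<in> {a<..<b}" and "x \<in> U"
  obtains B where "linear B" "\<And>v. B (tangent U \<phi> (t, \<phi> x) v) = v"
    "\<And>y. tangent U \<phi> (t, \<phi> x) (B y) = y - (normal t x \<bullet> y) *\<^sub>R normal t x"
proof -
  let ?L = "tangent U \<phi> (t, \<phi> x)" and ?n = "normal t x"
  have L: "linear ?L" "inj ?L" using tangent_linear[OF assms(1,2)] tangent_inj[OF assms(1,2)] assms(3) by auto
  have n: "norm ?n = 1" "\<And>v. ?n \<bullet> ?L v = 0"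
    using norm_normal_in_chart[OF assms] normal_orthogonal_tangent[OF assms] by auto
  obtain B0 where B0: "linear B0" "B0 \<circ> ?L = id" using linear_injective_left_inverse[OF L] by blast
  have range: "range ?L = {y. ?n \<bullet> y = 0}"
  proof (rule subspace_dim_equal)
    show "subspace (range ?L)" using L(1) linear_subspace_image subspace_UNIV by blast
    show "subspace {y. ?n \<bullet> y = 0}" by (rule subspace_hyperplane)
    show "range ?L \<subseteq> {y. ?n \<bullet> y = 0}" using n(2) by auto
    have "dim (range ?L) = dim (UNIV :: (real^2) set)"
      by (rule dim_image_eq[OF L(1)]) (use L(2) in simp)
    moreover have "?n \<noteq> 0" using n(1) by auto
    ultimately show "dim {y. ?n \<bullet> y = 0} \<le> dim (range ?L)" by (simp add: dim_hyperplane)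
  qed
  define B where "B = (\<lambda>y. B0 (y - (?n \<bullet> y) *\<^sub>R ?n))"
  show thesis
  proof
    show "linear B" unfolding B_def
      by (rule linear_compose[OF _ B0(1), unfolded o_def])
        (auto intro!: linearI simp: algebra_simps inner_simps)
    show "B (?L v) = v" for v
      using n(2)[of v] B0(2) by (simp add: B_def o_def fun_eq_iff)
    show "?L (B y) = y - (?n \<bullet> y) *\<^sub>R ?n" for y
    proof -
      have "y - (?n \<bullet> y) *\<^sub>R ?n \<in> range ?L"
        unfolding range using n(1) by (simp add: inner_simps dot_square_norm)
      then obtain v where "y - (?n \<bullet> y) *\<^sub>R ?n = ?L v" by auto
      then show ?thesis using B0(2) by (simp add: B_def o_def fun_eq_iff)
    qed
  qed
qed

lemma tangent_nearby:
  assumes U: "(U, \<phi>) \<in> \<A>" and t0: "t0 \<in> {a<..<b}" and x0: "x0 \<in> U"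
    and W: "open W" "\<phi> x0 \<in> W" "W \<subseteq> \<phi> ` U" and \<kappa>: "\<kappa> > 0"
  obtains \<eta> where "\<eta> > 0"
    "\<And>t z. \<bar>t - t0\<bar> < \<eta> \<Longrightarrow> norm (z - \<phi> x0) < \<eta> \<Longrightarrow> t \<in> {a<..<b} \<and> z \<in> W \<and>
       (\<forall>v. norm (tangent U \<phi> (t, z) v - tangent U \<phi> (t0, \<phi> x0) v) \<le> 2 * \<kappa> * norm v) \<and>
       normal t0 x0 \<bullet> normal t (inv_into U \<phi> z) > 1/2"
proof -
  let ?u0 = "(t0, \<phi> x0)" and ?D = "{a<..<b} \<times> \<phi> ` U"
  let ?X = "\<lambda>u. cross3 (tangent U \<phi> u (axis 1 1)) (tangent U \<phi> u (axis 2 1))"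
  have u0: "?u0 \<in> ?D" using t0 x0 by auto
  have D: "open ?D" by (rule in_chart_smooth(2)[OF U])
  have ct: "isCont (\<lambda>u. tangent U \<phi> u (axis i 1)) ?u0" for i
    using tangent_continuous[OF U] continuous_on_eq_continuous_at[OF D] u0 by blast
  have L: "linear (tangent U \<phi> ?u0)" "inj (tangent U \<phi> ?u0)"
    using tangent_linear[OF U t0] tangent_inj[OF U t0] x0 by auto
  have X0: "?X ?u0 \<noteq> 0" by (rule cross3_ne_zero[OF L])
  have n0: "normal t0 x0 = sgn (?X ?u0)" by (rule normal_in_chart[OF U t0 x0])
  have "isCont ?X ?u0" using ct by (intro continuous_cross)
  then have "((\<lambda>u. normal t0 x0 \<bullet> sgn (?X u)) \<longlongrightarrow> normal t0 x0 \<bullet> sgn (?X ?u0)) (nhds ?u0)"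
    unfolding isCont_def using X0 by (subst tendsto_at_iff_tendsto_nhds[symmetric]) (intro tendsto_intros)
  moreover have "normal t0 x0 \<bullet> sgn (?X ?u0) > 1/2"
    using norm_normal_in_chart[OF U t0 x0] unfolding n0[symmetric] by (simp add: dot_square_norm)
  ultimately have e3: "\<forall>\<^sub>F u in nhds ?u0. normal t0 x0 \<bullet> sgn (?X u) > 1/2"
    by (rule order_tendstoD(1))
  have e2: "\<forall>\<^sub>F u in nhds ?u0. dist (tangent U \<phi> u (axis i 1)) (tangent U \<phi> ?u0 (axis i 1)) < \<kappa>" for i
  proof -
    have "((\<lambda>u. tangent U \<phi> u (axis i 1)) \<longlongrightarrow> tangent U \<phi> ?u0 (axis i 1)) (nhds ?u0)"
      using ct[of i] unfolding isCont_def by (subst tendsto_at_iff_tendsto_nhds[symmetric])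
    then show ?thesis using \<kappa> by (rule tendstoD)
  qed
  have "open ({a<..<b} \<times> W)" "?u0 \<in> {a<..<b} \<times> W" using W t0 by (auto intro: open_Times)
  then have e1: "\<forall>\<^sub>F u in nhds ?u0. u \<in> {a<..<b} \<times> W" by (rule eventually_nhds_in_open)
  from eventually_conj[OF e1 eventually_conj[OF e2[of 1] eventually_conj[OF e2[of 2] e3]]]
  obtain \<eta> where \<eta>: "\<eta> > 0" "\<And>u. dist u ?u0 < \<eta> \<Longrightarrow> u \<in> {a<..<b} \<times> W \<and>
      dist (tangent U \<phi> u (axis 1 1)) (tangent U \<phi> ?u0 (axis 1 1)) < \<kappa> \<and>
      dist (tangent U \<phi> u (axis 2 1)) (tangent U \<phi> ?u0 (axis 2 1)) < \<kappa> \<and>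
      normal t0 x0 \<bullet> sgn (?X u) > 1/2"
    unfolding eventually_nhds_metric by blast
  show thesis
  proof
    show "\<eta>/2 > 0" using \<eta>(1) by simp
    fix t z assume tz: "\<bar>t - t0\<bar> < \<eta>/2" "norm (z - \<phi> x0) < \<eta>/2"
    have "dist (t, z) ?u0 \<le> dist t t0 + dist z (\<phi> x0)"
      unfolding dist_Pair_Pair by (rule sqrt_sum_squares_le_sum) auto
    then have "dist (t, z) ?u0 < \<eta>" using tz by (simp add: dist_norm)
    note h = \<eta>(2)[OF this]
    have t: "t \<in> {a<..<b}" and z: "z \<in> W" using h by auto
    have zU: "z \<in> \<phi> ` U" using z W by blast
    have Lt: "linear (tangent U \<phi> (t, z))" by (rule tangent_linear[OF U t zU])
    have "norm (tangent U \<phi> (t, z) v - tangent U \<phi> ?u0 v) \<le> 2 * \<kappa> * norm v" for v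
    proof -
      have "tangent U \<phi> (t, z) v - tangent U \<phi> ?u0 v =
          v $ 1 *\<^sub>R (tangent U \<phi> (t, z) (axis 1 1) - tangent U \<phi> ?u0 (axis 1 1)) +
          v $ 2 *\<^sub>R (tangent U \<phi> (t, z) (axis 2 1) - tangent U \<phi> ?u0 (axis 2 1))"
        by (subst (1 2) linear_real2_expand) (use Lt L(1) in \<open>auto simp: algebra_simps\<close>)
      also have "norm \<dots> \<le> \<bar>v $ 1\<bar> * \<kappa> + \<bar>v $ 2\<bar> * \<kappa>"
        by (rule norm_triangle_le) (use h in \<open>auto simp: dist_norm intro!: add_mono mult_left_mono\<close>)
      also have "\<dots> \<le> norm v * \<kappa> + norm v * \<kappa>"
        using \<kappa> by (intro add_mono mult_right_mono component_le_norm_cart) auto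
      finally show ?thesis by (simp add: algebra_simps)
    qed
    moreover have "normal t (inv_into U \<phi> z) = sgn (?X (t, z))"
      using normal_in_chart[OF U t chart(7)[OF U zU]] chart(6)[OF U zU] by simp
    ultimately show "t \<in> {a<..<b} \<and> z \<in> W \<and>
       (\<forall>v. norm (tangent U \<phi> (t, z) v - tangent U \<phi> ?u0 v) \<le> 2 * \<kappa> * norm v) \<and>
       normal t0 x0 \<bullet> normal t (inv_into U \<phi> z) > 1/2"
      using h t z by simp
  qed
qed


text \<open>Let \<open>n\<close> be the coorientation at \<open>x0\<close>. The tangential part of a vector \<open>y\<close> determines a point of the
  sheet by its parameter \<open>z0 + B y\<close>, and \<open>P t y\<close> is this point, shifted by \<open>n \<bullet> y\<close> along \<open>n\<close>. The difference
  of \<open>P t\<close> and the identity has a small Lipschitz constant. So \<open>P t\<close> has an inverse \<open>G t\<close> near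
  \<open>H t0 x0\<close>, and \<open>g t w = n \<bullet> G t w\<close> vanishes exactly if \<open>w\<close> lies on the sheet.\<close>
lemma sheet_function_exists:
  assumes t0: "t0 \<in> {a<..<b}" and x0: "x0 \<in> M" and \<epsilon>: "\<epsilon> > 0"
    and V: "openin (top_of_set M) V" "x0 \<in> V"
  obtains \<delta> \<rho> N g where "\<delta> > 0" "\<rho> > 0" "N \<subseteq> V" "sheet_function t0 x0 \<epsilon> \<delta> \<rho> N g"
proof -
  obtain U \<phi> where U: "(U, \<phi>) \<in> \<A>" and x0U: "x0 \<in> U" using chart_cover[OF x0] by blast
  define n where "n = normal t0 x0"
  define z0 where "z0 = \<phi> x0"
  define q0 where "q0 = H t0 x0"
  let ?L0 = "tangent U \<phi> (t0, z0)" and ?f = "in_chart U \<phi>"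
  have n1: "norm n = 1" unfolding n_def by (rule norm_normal_in_chart[OF U t0 x0U])
  have nL0: "n \<bullet> ?L0 v = 0" for v
    unfolding n_def z0_def by (rule normal_orthogonal_tangent[OF U t0 x0U])
  have L0: "linear ?L0" unfolding z0_def by (rule tangent_linear[OF U t0]) (use x0U in auto)
  obtain B where B: "linear B" "\<And>v. B (?L0 v) = v" "\<And>y. ?L0 (B y) = y - (n \<bullet> y) *\<^sub>R n"
    using tangent_plane_projection[OF U t0 x0U] unfolding n_def z0_def by metis
  obtain K where K: "K > 0" "\<And>y. norm (B y) \<le> K * norm y"
    using linear_bounded_pos[OF B(1)] by blast
  define W where "W = \<phi> ` (U \<inter> V)"
  have W: "open W" "z0 \<in> W" "W \<subseteq> \<phi> ` U"
    unfolding W_def z0_def using chart_open_image[OF U V(1)] x0U V(2) by auto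
  (* The inverses G t at most double distances, so 2 * \<epsilon>' bounds the error of g t. *)
  define \<epsilon>' where "\<epsilon>' = min (1/4) (\<epsilon>/2)"
  have \<epsilon>': "0 < \<epsilon>'" "\<epsilon>' \<le> 1/4" "2 * \<epsilon>' \<le> \<epsilon>" unfolding \<epsilon>'_def using \<epsilon> by auto
  define \<kappa> where "\<kappa> = \<epsilon>' / (2 * K)"
  have \<kappa>: "\<kappa> > 0" "2 * \<kappa> * K = \<epsilon>'" unfolding \<kappa>_def using \<epsilon>' K by auto
  obtain \<eta> where \<eta>: "\<eta> > 0"
    "\<And>t z. \<bar>t - t0\<bar> < \<eta> \<Longrightarrow> norm (z - z0) < \<eta> \<Longrightarrow> t \<in> {a<..<b} \<and> z \<in> W \<and>
       (\<forall>v. norm (tangent U \<phi> (t, z) v - ?L0 v) \<le> 2 * \<kappa> * norm v) \<and>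
       n \<bullet> normal t (inv_into U \<phi> z) > 1/2"
    using tangent_nearby[OF U t0 x0U W(1) _ W(3) \<kappa>(1)] W(2) unfolding z0_def n_def by metis
  (* On cball 0 R the parameter z0 + B y stays where the tangent map is under control. *)
  define R where "R = \<eta> / (2 * (K + 1))"
  have R: "R > 0" unfolding R_def using \<eta> K by simp
  have KR: "K * R < \<eta>"
  proof -
    have "K * R = \<eta> * (K / (2 * (K + 1)))" unfolding R_def by simp
    also have "\<dots> < \<eta> * 1" using \<eta>(1) K(1) by (intro mult_strict_left_mono) (auto simp: field_simps)
    finally show ?thesis by simp
  qed
  have small: "norm (B y) < \<eta>" if "y \<in> cball 0 R" for y
  proof -
    have "norm (B y) \<le> K * norm y" by (rule K(2))
    also have "\<dots> \<le> K * R" using that K(1) by simp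
    finally show ?thesis using KR by simp
  qed
  have D: "open ({a<..<b} \<times> \<phi> ` U)" by (rule in_chart_smooth(2)[OF U])
  have cf: "((\<lambda>t. ?f (t, z)) \<longlongrightarrow> ?f (t0, z)) (at t0)" if "z \<in> \<phi> ` U" for z
  proof -
    have "isCont ?f (t0, z)"
      using in_chart_continuous[OF U] continuous_on_eq_continuous_at[OF D] t0 that by blast
    then show ?thesis by (rule isCont_tendsto_compose) (auto intro!: tendsto_eq_intros)
  qed
  have f0: "?f (t0, z0) = q0" using chart(5)[OF U x0U] by (simp add: in_chart_def z0_def q0_def)
  have "\<forall>\<^sub>F t in at t0. dist (?f (t, z0)) q0 < R/8"
    using tendstoD[OF cf, of z0 "R/8"] W R unfolding f0 by auto
  then obtain \<delta>0 where \<delta>0: "\<delta>0 > 0" "\<And>t. t \<noteq> t0 \<Longrightarrow> dist t t0 < \<delta>0 \<Longrightarrow> dist (?f (t, z0)) q0 < R/8"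
    unfolding eventually_at by blast
  define \<delta> where "\<delta> = min \<eta> \<delta>0"
  have \<delta>: "\<delta> > 0" unfolding \<delta>_def using \<eta> \<delta>0 by simp
  define T where "T = {t0 - \<delta><..<t0 + \<delta>}"
  have T: "\<bar>t - t0\<bar> < \<eta>" "norm (?f (t, z0) - q0) \<le> R/8" if "t \<in> T" for t
  proof -
    have d: "\<bar>t - t0\<bar> < \<delta>" using that unfolding T_def by auto
    then show "\<bar>t - t0\<bar> < \<eta>" unfolding \<delta>_def by simp
    show "norm (?f (t, z0) - q0) \<le> R/8"
      using \<delta>0(2)[of t] d f0 R by (cases "t = t0") (auto simp: \<delta>_def dist_norm)
  qed
  have near: "t \<in> {a<..<b}" "z0 + B y \<in> W"
      "\<And>v. norm (tangent U \<phi> (t, z0 + B y) v - ?L0 v) \<le> 2 * \<kappa> * norm v"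
      "n \<bullet> normal t (inv_into U \<phi> (z0 + B y)) > 1/2" if "t \<in> T" "y \<in> cball 0 R" for t y
    using \<eta>(2)[OF T(1)[OF that(1)], of "z0 + B y"] small[OF that(2)] by auto
  define P where "P = (\<lambda>t y. ?f (t, z0 + B y) + (n \<bullet> y) *\<^sub>R n)"
  define dP where "dP = (\<lambda>t y v. tangent U \<phi> (t, z0 + B y) (B v) + (n \<bullet> v) *\<^sub>R n)"
  have derP: "(P t has_derivative dP t y) (at y)" if ty: "t \<in> T" "y \<in> cball 0 R" for t y
  proof -
    have "(H t \<circ> inv_into U \<phi> has_derivative tangent U \<phi> (t, z0 + B y)) (at (z0 + B y))"
      by (rule in_chart_has_derivative[OF U near(1)[OF ty]]) (use near(2)[OF ty] W in auto)
    moreover have "((\<lambda>y. z0 + B y) has_derivative B) (at y)"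
      using linear_imp_has_derivative[OF B(1)] by (auto intro!: derivative_eq_intros)
    ultimately have "((\<lambda>y. (H t \<circ> inv_into U \<phi>) (z0 + B y)) has_derivative
        (\<lambda>v. tangent U \<phi> (t, z0 + B y) (B v))) (at y)"
      using has_derivative_compose by fast
    then have "((\<lambda>y. (H t \<circ> inv_into U \<phi>) (z0 + B y) + (n \<bullet> y) *\<^sub>R n) has_derivative dP t y) (at y)"
      unfolding dP_def by (auto intro!: derivative_eq_intros)
    then show ?thesis unfolding P_def in_chart_def by (simp add: o_def)
  qed
  have dP: "norm (dP t y v - v) \<le> \<epsilon>' * norm v" if ty: "t \<in> T" "y \<in> cball 0 R" for t y v
  proof -
    have "dP t y v - v = tangent U \<phi> (t, z0 + B y) (B v) - ?L0 (B v)"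
      unfolding dP_def B(3) by simp
    then have "norm (dP t y v - v) \<le> 2 * \<kappa> * norm (B v)" using near(3)[OF ty] by simp
    also have "\<dots> \<le> 2 * \<kappa> * (K * norm v)" using \<kappa>(1) K(2) by (intro mult_left_mono) auto
    also have "\<dots> = (2 * \<kappa> * K) * norm v" by simp
    finally show ?thesis unfolding \<kappa>(2) .
  qed
  have lip: "norm ((P t y - y) - (P t y' - y')) \<le> \<epsilon>' * norm (y - y')"
    if t: "t \<in> T" and y: "y \<in> cball 0 R" "y' \<in> cball 0 R" for t y y'
  proof (rule differentiable_bound[OF convex_cball[of 0 R], of "\<lambda>y. P t y - y" "\<lambda>y v. dP t y v - v"])
    fix x :: "real^3" assume x: "x \<in> cball 0 R"
    show "((\<lambda>y. P t y - y) has_derivative (\<lambda>v. dP t x v - v)) (at x within cball 0 R)"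
      by (rule has_derivative_at_withinI) (rule has_derivative_diff[OF derP[OF t x] has_derivative_ident])
    show "onorm (\<lambda>v. dP t x v - v) \<le> \<epsilon>'" by (rule onorm_le) (rule dP[OF t x])
  qed (use y in auto)
  have expand: "norm (y - y') \<le> 2 * norm (P t y - P t y')"
    if t: "t \<in> T" and y: "y \<in> cball 0 R" "y' \<in> cball 0 R" for t y y'
  proof -
    have "norm (y - y') \<le> norm (P t y - P t y') + norm ((P t y - y) - (P t y' - y'))"
      using norm_triangle_ineq4[of "P t y - P t y'" "(P t y - y) - (P t y' - y')"]
      by (simp add: algebra_simps)
    also have "\<dots> \<le> norm (P t y - P t y') + 1/4 * norm (y - y')"
      using lip[OF that] mult_right_mono[OF \<epsilon>'(2) norm_ge_zero, of "y - y'"] by linarith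
    finally show ?thesis using norm_ge_zero[of "y - y'"] by linarith
  qed
  have P0: "norm (P t 0 - q0) \<le> R/8" if "t \<in> T" for t
    using T(2)[OF that] by (simp add: P_def linear_0[OF B(1)])
  define G where "G = (\<lambda>t w. SOME y. y \<in> ball 0 R \<and> P t y = w)"
  have G: "G t w \<in> ball 0 R" "P t (G t w) = w" if "t \<in> T" "w \<in> ball q0 (R/8)" for t w
  proof -
    have "\<exists>y. y \<in> ball 0 R \<and> P t y = w"
      using perturbed_identity_surjective[of R "P t", OF lip[OF that(1)] _ \<epsilon>'(2) R P0[OF that(1)] that(2)]
        \<epsilon>' by auto
    from someI_ex[OF this] show "G t w \<in> ball 0 R" "P t (G t w) = w" unfolding G_def by auto
  qed
  have Gc: "G t w \<in> cball 0 R" if "t \<in> T" "w \<in> ball q0 (R/8)" for t w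
    using G(1)[OF that] by auto
  have G_unique: "G t w = y" if "t \<in> T" "y \<in> cball 0 R" "P t y = w" "w \<in> ball q0 (R/8)" for t w y
    using expand[OF that(1) Gc[OF that(1,4)] that(2)] G(2)[OF that(1,4)] that(3) by simp
  define g where "g = (\<lambda>t w. n \<bullet> G t w)"
  (* N is the set of points whose coordinate y = Y x in the tangent plane has length less than R. *)
  define N where "N = {x \<in> U \<inter> V. norm (?L0 (\<phi> x - z0)) < R}"
  define Y where "Y = (\<lambda>x. ?L0 (\<phi> x - z0))"
  have Y: "Y x \<in> ball 0 R" "Y x \<in> cball 0 R" "n \<bullet> Y x = 0" "z0 + B (Y x) = \<phi> x" "x \<in> U" "x \<in> V" "P t (Y x) = H t x"
    if "x \<in> N" for x t
  proof -
    show "Y x \<in> ball 0 R" "Y x \<in> cball 0 R" "x \<in> U" "x \<in> V" using that unfolding N_def Y_def by auto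
    show nY: "n \<bullet> Y x = 0" unfolding Y_def by (rule nL0)
    show BY: "z0 + B (Y x) = \<phi> x" unfolding Y_def B(2) by simp
    show "P t (Y x) = H t x"
      unfolding P_def nY BY in_chart_def using chart(5)[OF U \<open>x \<in> U\<close>] by simp
  qed
  have "sheet_function t0 x0 \<epsilon> \<delta> (R/8) N g"
    unfolding sheet_function_def T_def[symmetric] n_def[symmetric] q0_def[symmetric]
  proof (intro conjI ballI impI)
    show "x0 \<in> N" using x0U V(2) R by (simp add: N_def z0_def linear_0[OF L0[unfolded z0_def]])
    show "T \<subseteq> {a<..<b}" using near(1)[of _ 0] R by auto
    show "openin (top_of_set M) N"
    proof -
      have "continuous_on UNIV (\<lambda>z. norm (?L0 (z - z0)))"
        by (intro continuous_on_norm linear_continuous_on_compose[OF _ L0] continuous_intros)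
      then have "open {z. norm (?L0 (z - z0)) < R}"
        by (intro open_Collect_less continuous_on_const)
      then have "openin (top_of_set U) (U \<inter> \<phi> -` {z. norm (?L0 (z - z0)) < R})"
        using chart(3)[OF U] by (intro continuous_openin_preimage_gen) (auto simp: homeomorphism_def)
      then have "openin (top_of_set M) (U \<inter> \<phi> -` {z. norm (?L0 (z - z0)) < R})"
        using chart(1)[OF U] openin_trans by blast
      then have "openin (top_of_set M) ((U \<inter> \<phi> -` {z. norm (?L0 (z - z0)) < R}) \<inter> V)"
        using V(1) by (rule openin_Int)
      moreover have "N = (U \<inter> \<phi> -` {z. norm (?L0 (z - z0)) < R}) \<inter> V" unfolding N_def by auto
      ultimately show ?thesis by simp
    qed
    show "((\<lambda>t. g t w) \<longlongrightarrow> g t0 w) (at t0)" if w: "w \<in> ball q0 (R/8)" for w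
    proof -
      have t0T: "t0 \<in> T" unfolding T_def using \<delta> by simp
      let ?y = "G t0 w"
      have "((\<lambda>t. P t ?y) \<longlongrightarrow> P t0 ?y) (at t0)" unfolding P_def
        by (intro tendsto_intros cf) (use near(2)[OF t0T Gc[OF t0T w]] W in auto)
      then have "((\<lambda>t. 2 * norm (w - P t ?y)) \<longlongrightarrow> 2 * norm (w - P t0 ?y)) (at t0)"
        by (intro tendsto_intros)
      then have lim: "((\<lambda>t. 2 * norm (w - P t ?y)) \<longlongrightarrow> 0) (at t0)" using G(2)[OF t0T w] by simp
      have "\<forall>\<^sub>F t in at t0. t \<in> T"
        unfolding T_def using \<delta> by (intro eventually_at_in_open') auto
      then have "\<forall>\<^sub>F t in at t0. norm (G t w - ?y) \<le> 2 * norm (w - P t ?y)"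
      proof eventually_elim
        case (elim t)
        show ?case using expand[OF elim Gc[OF elim w] Gc[OF t0T w]] G(2)[OF elim w] by simp
      qed
      then have "((\<lambda>t. G t w - ?y) \<longlongrightarrow> 0) (at t0)" by (rule Lim_null_comparison[OF _ lim])
      then have "((\<lambda>t. G t w) \<longlongrightarrow> ?y) (at t0)" by (simp add: LIM_zero_iff)
      then show ?thesis unfolding g_def by (intro tendsto_intros)
    qed
    fix t assume t: "t \<in> T"
    have tab: "t \<in> {a<..<b}" using near(1)[OF t, of 0] R by simp
    show "inj_on (H t) N"
    proof (rule inj_onI)
      fix x x' assume x: "x \<in> N" "x' \<in> N" "H t x = H t x'"
      then have "Y x = Y x'" using expand[OF t Y(2)[OF x(1)] Y(2)[OF x(2)]] Y(7) by simp
      then have "\<phi> x = \<phi> x'" using Y(4) x by metis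
      then show "x = x'" using chart(5)[OF U] Y(5) x by metis
    qed
    show "almost_linear_on (ball q0 (R/8)) \<epsilon> (g t) n"
      unfolding almost_linear_on_def
    proof (intro ballI)
      fix w w' assume w: "w \<in> ball q0 (R/8)" "w' \<in> ball q0 (R/8)"
      let ?y = "G t w" and ?y' = "G t w'"
      have "g t w - g t w' - n \<bullet> (w - w') = - (n \<bullet> ((P t ?y - ?y) - (P t ?y' - ?y')))"
        unfolding g_def G(2)[OF t w(1)] G(2)[OF t w(2)] by (simp add: inner_diff_right)
      then have "\<bar>g t w - g t w' - n \<bullet> (w - w')\<bar> \<le> norm ((P t ?y - ?y) - (P t ?y' - ?y'))"
        using Cauchy_Schwarz_ineq2[of n "(P t ?y - ?y) - (P t ?y' - ?y')"] n1 by simp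
      also have "\<dots> \<le> \<epsilon>' * norm (?y - ?y')" by (rule lip[OF t Gc[OF t w(1)] Gc[OF t w(2)]])
      also have "\<dots> \<le> \<epsilon>' * (2 * norm (w - w'))"
        using expand[OF t Gc[OF t w(1)] Gc[OF t w(2)]] G(2)[OF t w(1)] G(2)[OF t w(2)] \<epsilon>'
        by (intro mult_left_mono) auto
      also have "\<dots> \<le> \<epsilon> * norm (w - w')"
        using mult_right_mono[OF \<epsilon>'(3) norm_ge_zero, of "w - w'"] by simp
      finally show "\<bar>g t w - g t w' - n \<bullet> (w - w')\<bar> \<le> \<epsilon> * norm (w - w')" .
    qed
    show "g t w = 0 \<longleftrightarrow> w \<in> H t ` N" if w: "w \<in> ball q0 (R/8)" for w
    proof
      assume "g t w = 0"
      let ?y = "G t w"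
      have y: "n \<bullet> ?y = 0" "?y \<in> ball 0 R" using \<open>g t w = 0\<close> G(1)[OF t w] unfolding g_def by auto
      have "z0 + B ?y \<in> W" by (rule near(2)[OF t Gc[OF t w]])
      then obtain x where x: "x \<in> U" "x \<in> V" "\<phi> x = z0 + B ?y" unfolding W_def by auto
      have Yx: "Y x = ?y" unfolding Y_def x(3) using B(3)[of ?y] y(1) by simp
      then have "x \<in> N" using x y(2) unfolding N_def Y_def by simp
      moreover have "H t x = w" using Y(7)[OF \<open>x \<in> N\<close>, of t] Yx G(2)[OF t w] by simp
      ultimately show "w \<in> H t ` N" by blast
    next
      assume "w \<in> H t ` N"
      then obtain x where x: "x \<in> N" "w = H t x" by blast
      have "G t w = Y x" by (rule G_unique[OF t Y(2)[OF x(1)] _ w]) (use Y(7)[OF x(1)] x in simp)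
      then show "g t w = 0" unfolding g_def using Y(3)[OF x(1)] by simp
    qed
    fix x assume x: "x \<in> N"
    note nt = near[OF t Y(2)[OF x], unfolded Y(4)[OF x]]
    have nn: "n \<bullet> normal t x > 1/2" using nt(4) chart(5)[OF U Y(5)[OF x]] by simp
    then show "1/2 \<le> n \<bullet> normal t x" by simp
    assume w: "H t x \<in> ball q0 (R/8)"
    let ?w = "H t x" and ?D = "dP t (Y x)"
    have Gw: "G t ?w = Y x" by (rule G_unique[OF t Y(2)[OF x] Y(7)[OF x] w])
    have der: "(P t has_derivative ?D) (at (G t ?w))" unfolding Gw by (rule derP[OF t Y(2)[OF x]])
    have linD: "linear ?D" using der has_derivative_linear by blast
    have "inj ?D"
    proof (subst linear_injective_0[OF linD], intro allI impI)
      fix v assume "?D v = 0"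
      then have "norm v \<le> \<epsilon>' * norm v" using dP[OF t Y(2)[OF x], of v] by simp
      also have "\<dots> \<le> 1/4 * norm v" by (rule mult_right_mono[OF \<epsilon>'(2) norm_ge_zero])
      finally show "v = 0" by simp
    qed
    then obtain D' where D': "linear D'" "\<forall>v. D' (?D v) = v" "\<forall>v. ?D (D' v) = v"
      using linear_injective_isomorphism[OF linD] by blast
    have contG: "continuous (at ?w) (G t)"
    proof -
      have "2-lipschitz_on (ball q0 (R/8)) (G t)"
        by (rule lipschitz_onI)
          (use expand[OF t Gc[OF t] Gc[OF t]] G(2)[OF t] in \<open>auto simp: dist_norm\<close>)
      then have "continuous_on (ball q0 (R/8)) (G t)" by (rule lipschitz_on_continuous_on)
      then show ?thesis using w continuous_on_eq_continuous_at[OF open_ball] by blast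
    qed
    have "(G t has_derivative D') (at ?w)"
      by (rule has_derivative_inverse_basic[OF der _ _ contG open_ball w])
        (use D' G(2)[OF t] in \<open>auto simp: linear_linear fun_eq_iff\<close>)
    then have "(g t has_derivative (\<lambda>v. n \<bullet> D' v)) (at ?w)"
      unfolding g_def by (rule has_derivative_inner_right)
    moreover have "n \<bullet> D' v = 1 / (n \<bullet> normal t x) * (normal t x \<bullet> v)" for v
    proof -
      have "v = ?D (D' v)" using D'(3) by simp
      also have "\<dots> = tangent U \<phi> (t, \<phi> x) (B (D' v)) + (n \<bullet> D' v) *\<^sub>R n"
        unfolding dP_def Y(4)[OF x] ..
      finally have "normal t x \<bullet> v = (n \<bullet> D' v) * (normal t x \<bullet> n)"
        using normal_orthogonal_tangent[OF U tab Y(5)[OF x]]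
        by (metis inner_add_right inner_scaleR_right add_0)
      then show ?thesis using nn by (simp add: inner_commute)
    qed
    ultimately have "(g t has_derivative (\<lambda>v. 1 / (n \<bullet> normal t x) * (normal t x \<bullet> v))) (at ?w)"
      by simp
    moreover have "1 / (n \<bullet> normal t x) > 0" using nn by simp
    ultimately show "\<exists>\<kappa>>0. (g t has_derivative (\<lambda>v. \<kappa> * (normal t x \<bullet> v))) (at ?w)" by blast
  qed
  moreover have "N \<subseteq> V" unfolding N_def by blast
  ultimately show thesis using that[of \<delta> "R/8" N g] \<delta> R by simp
qed

end

section \<open>All sheets near a point of space\<close>

lemma finite_set_separated:
  fixes F :: "'a::t2_space set"
  assumes "finite F"
  obtains G where "\<forall>x\<in>F. open (G x) \<and> x \<in> G x" "disjoint_family_on G F"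
proof -
  define sep :: "'a \<Rightarrow> 'a \<Rightarrow> 'a set \<Rightarrow> 'a set \<Rightarrow> bool" where
    "sep x y V W \<longleftrightarrow> open V \<and> open W \<and> x \<in> V \<and> y \<in> W \<and> V \<inter> W = {}" for x y V W
  have "\<exists>V W. sep x y V W" if "x \<noteq> y" for x y
    using hausdorff[OF that] unfolding sep_def .
  then obtain V W where "\<And>x y. x \<noteq> y \<Longrightarrow> sep x y (V x y) (W x y)" by metis
  then have VW: "open (V x y) \<and> open (W x y) \<and> x \<in> V x y \<and> y \<in> W x y \<and> V x y \<inter> W x y = {}"
    if "x \<noteq> y" for x y using that unfolding sep_def by simp
  let ?G = "\<lambda>x. \<Inter>y\<in>F - {x}. V x y \<inter> W y x"
  show thesis
  proof
    show "\<forall>x\<in>F. open (?G x) \<and> x \<in> ?G x"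
    proof
      fix x assume "x \<in> F"
      have "open (V x y \<inter> W y x) \<and> x \<in> V x y \<inter> W y x" if "y \<in> F - {x}" for y
        using VW[of x y] VW[of y x] that by auto
      then show "open (?G x) \<and> x \<in> ?G x" using assms by (auto intro!: open_INT)
    qed
  next
    show "disjoint_family_on ?G F"
      unfolding disjoint_family_on_def
    proof (intro ballI impI)
      fix x y assume xy: "x \<in> F" "y \<in> F" "x \<noteq> y"
      then have "?G x \<subseteq> V x y" "?G y \<subseteq> W x y" by auto
      then show "?G x \<inter> ?G y = {}" using VW[OF xy(3)] by blast
    qed
  qed
qed

context surface_homotopy
begin

lemma homotopy_jointly_continuous:
  assumes t0: "t0 \<in> {a<..<b}" and x0: "x0 \<in> M" and e: "e > 0"
  obtains \<delta> V where "\<delta> > 0" "{t0 - \<delta><..<t0 + \<delta>} \<subseteq> {a<..<b}" "openin (top_of_set M) V" "x0 \<in> V"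
    "\<forall>t\<in>{t0 - \<delta><..<t0 + \<delta>}. \<forall>x\<in>V. dist (H t x) (H t0 x0) < e"
proof -
  obtain U \<phi> where U: "(U, \<phi>) \<in> \<A>" and x0U: "x0 \<in> U" using chart_cover[OF x0] by blast
  let ?f = "in_chart U \<phi>" and ?D = "{a<..<b} \<times> \<phi> ` U" and ?u0 = "(t0, \<phi> x0)"
  have D: "open ?D" by (rule in_chart_smooth(2)[OF U])
  have u0: "?u0 \<in> ?D" using t0 x0U by auto
  have "isCont ?f ?u0"
    using in_chart_continuous[OF U] continuous_on_eq_continuous_at[OF D] u0 by blast
  then have "(?f \<longlongrightarrow> ?f ?u0) (nhds ?u0)"
    unfolding isCont_def by (subst tendsto_at_iff_tendsto_nhds[symmetric])
  then have "\<forall>\<^sub>F u in nhds ?u0. dist (?f u) (?f ?u0) < e" using e by (rule tendstoD)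
  from eventually_conj[OF eventually_nhds_in_open[OF D u0] this]
  obtain \<eta> where \<eta>: "\<eta> > 0" "\<And>u. dist u ?u0 < \<eta> \<Longrightarrow> u \<in> ?D \<and> dist (?f u) (?f ?u0) < e"
    unfolding eventually_nhds_metric by blast
  let ?V = "U \<inter> \<phi> -` ball (\<phi> x0) (\<eta>/2)"
  have near: "t \<in> {a<..<b} \<and> dist (H t x) (H t0 x0) < e"
    if "t \<in> {t0 - \<eta>/2<..<t0 + \<eta>/2}" "x \<in> ?V" for t x
  proof -
    have "dist (t, \<phi> x) ?u0 \<le> dist t t0 + dist (\<phi> x) (\<phi> x0)"
      unfolding dist_Pair_Pair by (rule sqrt_sum_squares_le_sum) auto
    also have "\<dots> < \<eta>/2 + \<eta>/2"
    proof (rule add_strict_mono)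
      show "dist t t0 < \<eta>/2"
        using that(1) unfolding dist_real_def greaterThanLessThan_iff abs_less_iff by linarith
      show "dist (\<phi> x) (\<phi> x0) < \<eta>/2" using that(2) by (simp add: dist_commute)
    qed
    finally have "dist (t, \<phi> x) ?u0 < \<eta>" by simp
    from \<eta>(2)[OF this] show ?thesis
      using chart(5)[OF U] that(2) x0U by (auto simp: in_chart_def)
  qed
  show thesis
  proof (rule that[of "\<eta>/2" ?V])
    have "openin (top_of_set U) ?V"
      using chart(3)[OF U] by (intro continuous_openin_preimage_gen) (auto simp: homeomorphism_def)
    then show "openin (top_of_set M) ?V" using chart(1)[OF U] openin_trans by blast
    show "x0 \<in> ?V" using x0U \<eta>(1) by simp
    then show "{t0 - \<eta>/2<..<t0 + \<eta>/2} \<subseteq> {a<..<b}" using near by blast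
    show "\<forall>t\<in>{t0 - \<eta>/2<..<t0 + \<eta>/2}. \<forall>x\<in>?V. dist (H t x) (H t0 x0) < e"
      using near by blast
  qed (use \<eta>(1) in simp)
qed

lemma continuous_on_homotopy:
  assumes t: "t \<in> {a<..<b}"
  shows "continuous_on M (H t)"
  unfolding continuous_on_topological
proof (intro ballI allI impI)
  fix x B assume x: "x \<in> M" and B: "open B" "H t x \<in> B"
  obtain e where e: "e > 0" "\<And>w. dist w (H t x) < e \<Longrightarrow> w \<in> B"
    using B unfolding open_dist by blast
  obtain \<delta> V where V: "\<delta> > 0" "openin (top_of_set M) V" "x \<in> V"
    "\<forall>s\<in>{t - \<delta><..<t + \<delta>}. \<forall>y\<in>V. dist (H s y) (H t x) < e"
    by (rule homotopy_jointly_continuous[OF t x e(1)])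
  obtain G where G: "open G" "V = M \<inter> G" using V(2) unfolding openin_open by blast
  show "\<exists>A. open A \<and> x \<in> A \<and> (\<forall>y\<in>M. y \<in> A \<longrightarrow> H t y \<in> B)"
    using G V e(2) by (intro exI[of _ G]) auto
qed

text \<open>By compactness of \<open>M - W\<close> one distance and one interval of times serve all its points.\<close>
lemma image_avoids_nearby:
  assumes t0: "t0 \<in> {a<..<b}" and W: "openin (top_of_set M) W"
    and q0: "\<And>x. x \<in> M - W \<Longrightarrow> H t0 x \<noteq> q0"
  obtains \<delta> \<rho> where "\<delta> > 0" "\<rho> > 0" "{t0 - \<delta><..<t0 + \<delta>} \<subseteq> {a<..<b}"
    "\<forall>t\<in>{t0 - \<delta><..<t0 + \<delta>}. \<forall>x\<in>M - W. H t x \<notin> ball q0 \<rho>"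
proof -
  have "\<exists>\<delta> V. \<delta> > 0 \<and> open V \<and> x \<in> V \<and>
      (\<forall>t\<in>{t0 - \<delta><..<t0 + \<delta>}. \<forall>y\<in>M \<inter> V. H t y \<notin> ball q0 (dist (H t0 x) q0 / 2))"
    if x: "x \<in> M - W" for x
  proof -
    let ?e = "dist (H t0 x) q0 / 2"
    have e: "?e > 0" using q0[OF x] by simp
    obtain \<delta> V where V: "\<delta> > 0" "openin (top_of_set M) V" "x \<in> V"
      "\<forall>s\<in>{t0 - \<delta><..<t0 + \<delta>}. \<forall>y\<in>V. dist (H s y) (H t0 x) < ?e"
      by (rule homotopy_jointly_continuous[OF t0 DiffD1[OF x] e])
    obtain G where G: "open G" "V = M \<inter> G" using V(2) unfolding openin_open by blast
    have "H t y \<notin> ball q0 ?e" if "t \<in> {t0 - \<delta><..<t0 + \<delta>}" "y \<in> M \<inter> G" for t y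
    proof -
      have "dist (H t y) (H t0 x) < ?e" using V(4) that G(2) by blast
      then show ?thesis
        using dist_triangle2[of "H t0 x" q0 "H t y"] by (auto simp: dist_commute)
    qed
    then show ?thesis using V G by blast
  qed
  then obtain d V where dV: "\<And>x. x \<in> M - W \<Longrightarrow> d x > 0 \<and> open (V x) \<and> x \<in> V x \<and>
      (\<forall>t\<in>{t0 - d x<..<t0 + d x}. \<forall>y\<in>M \<inter> V x. H t y \<notin> ball q0 (dist (H t0 x) q0 / 2))"
    by metis
  obtain W' where W': "open W'" "W = M \<inter> W'" using W unfolding openin_open by blast
  have "M - W = M - W'" using W'(2) by blast
  then have "compact (M - W)" using compact_diff[OF compact_M W'(1)] by simp
  then obtain F where F: "F \<subseteq> M - W" "finite F" "M - W \<subseteq> (\<Union>x\<in>F. V x)"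
    by (rule compactE_image[of "M - W" "M - W" V]) (use dV in auto)
  have t0': "t0 - a > 0" "b - t0 > 0" using t0 by auto
  let ?\<delta> = "Min ({t0 - a, b - t0} \<union> d ` F)"
  let ?\<rho> = "Min (insert 1 ((\<lambda>x. dist (H t0 x) q0 / 2) ` F))"
  have fin: "finite ({t0 - a, b - t0} \<union> d ` F)" "finite (insert 1 ((\<lambda>x. dist (H t0 x) q0 / 2) ` F))"
    using F(2) by auto
  show thesis
  proof (rule that[of ?\<delta> ?\<rho>])
    show "?\<delta> > 0" using fin(1) t0' dV F(1) by (subst Min_gr_iff) auto
    show "?\<rho> > 0" using fin(2) q0 F(1) by (subst Min_gr_iff) auto
    have "?\<delta> \<le> t0 - a" "?\<delta> \<le> b - t0" by (rule Min_le[OF fin(1)], blast)+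
    then show "{t0 - ?\<delta><..<t0 + ?\<delta>} \<subseteq> {a<..<b}" by auto
    show "\<forall>t\<in>{t0 - ?\<delta><..<t0 + ?\<delta>}. \<forall>y\<in>M - W. H t y \<notin> ball q0 ?\<rho>"
    proof (intro ballI)
      fix t y assume t: "t \<in> {t0 - ?\<delta><..<t0 + ?\<delta>}" and y: "y \<in> M - W"
      obtain x where x: "x \<in> F" "y \<in> V x" using F(3) y by blast
      have "?\<delta> \<le> d x" using fin(1) x(1) by (intro Min_le) auto
      then have tx: "t \<in> {t0 - d x<..<t0 + d x}" using t by auto
      have xW: "x \<in> M - W" using x(1) F(1) by blast
      have "H t y \<notin> ball q0 (dist (H t0 x) q0 / 2)" using dV[OF xW] tx x(2) y by blast
      moreover have "?\<rho> \<le> dist (H t0 x) q0 / 2" using fin(2) x(1) by (intro Min_le) auto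
      ultimately show "H t y \<notin> ball q0 ?\<rho>" by auto
    qed
  qed
qed

lemma sheet_function_shrink:
  assumes "sheet_function t0 x0 \<epsilon> \<delta> \<rho> N g" and "0 < \<delta>'" "\<delta>' \<le> \<delta>" and "\<rho>' \<le> \<rho>"
  shows "sheet_function t0 x0 \<epsilon> \<delta>' \<rho>' N g"
proof -
  have T: "{t0 - \<delta>'<..<t0 + \<delta>'} \<subseteq> {t0 - \<delta><..<t0 + \<delta>}" using assms by auto
  have B: "ball (H t0 x0) \<rho>' \<subseteq> ball (H t0 x0) \<rho>" using assms by auto
  have al: "almost_linear_on (ball (H t0 x0) \<rho>') \<epsilon> (g t) (normal t0 x0)"
    if "almost_linear_on (ball (H t0 x0) \<rho>) \<epsilon> (g t) (normal t0 x0)" for t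
    by (rule almost_linear_on_subset[OF that B])
  note h = assms(1)[unfolded sheet_function_def]
  show ?thesis
    unfolding sheet_function_def
  proof (intro conjI)
    have "{t0 - \<delta><..<t0 + \<delta>} \<subseteq> {a<..<b}" using h by (elim conjE)
    then show "{t0 - \<delta>'<..<t0 + \<delta>'} \<subseteq> {a<..<b}" using T by (rule order_trans[rotated])
    show "\<forall>w\<in>ball (H t0 x0) \<rho>'. ((\<lambda>t. g t w) \<longlongrightarrow> g t0 w) (at t0)"
      by (rule ballI, rule bspec[OF h[THEN conjunct2, THEN conjunct2, THEN conjunct2, THEN conjunct2]],
          rule subsetD[OF B])
    show "\<forall>t\<in>{t0 - \<delta>'<..<t0 + \<delta>'}. inj_on (H t) N \<and>
        almost_linear_on (ball (H t0 x0) \<rho>') \<epsilon> (g t) (normal t0 x0) \<and>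
        (\<forall>w\<in>ball (H t0 x0) \<rho>'. g t w = 0 \<longleftrightarrow> w \<in> H t ` N) \<and>
        (\<forall>x\<in>N. normal t0 x0 \<bullet> normal t x \<ge> 1/2 \<and>
           (H t x \<in> ball (H t0 x0) \<rho>' \<longrightarrow>
             (\<exists>\<kappa>>0. (g t has_derivative (\<lambda>v. \<kappa> * (normal t x \<bullet> v))) (at (H t x)))))"
    proof
      fix t assume "t \<in> {t0 - \<delta>'<..<t0 + \<delta>'}"
      then have "t \<in> {t0 - \<delta><..<t0 + \<delta>}" using T by blast
      note ht = bspec[OF h[THEN conjunct2, THEN conjunct2, THEN conjunct2, THEN conjunct1] this]
      show "inj_on (H t) N \<and>
        almost_linear_on (ball (H t0 x0) \<rho>') \<epsilon> (g t) (normal t0 x0) \<and>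
        (\<forall>w\<in>ball (H t0 x0) \<rho>'. g t w = 0 \<longleftrightarrow> w \<in> H t ` N) \<and>
        (\<forall>x\<in>N. normal t0 x0 \<bullet> normal t x \<ge> 1/2 \<and>
           (H t x \<in> ball (H t0 x0) \<rho>' \<longrightarrow>
             (\<exists>\<kappa>>0. (g t has_derivative (\<lambda>v. \<kappa> * (normal t x \<bullet> v))) (at (H t x)))))"
      proof (intro conjI ballI impI)
        show "inj_on (H t) N" using ht by (elim conjE)
        show "almost_linear_on (ball (H t0 x0) \<rho>') \<epsilon> (g t) (normal t0 x0)"
          using ht by (elim conjE) (rule al)
        show "g t w = 0 \<longleftrightarrow> w \<in> H t ` N" if "w \<in> ball (H t0 x0) \<rho>'" for w
          by (rule bspec[OF ht[THEN conjunct2, THEN conjunct2, THEN conjunct1] subsetD[OF B that]])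
        fix x assume "x \<in> N"
        note hx = bspec[OF ht[THEN conjunct2, THEN conjunct2, THEN conjunct2] this]
        show "normal t0 x0 \<bullet> normal t x \<ge> 1/2" using hx by (rule conjunct1)
        show "\<exists>\<kappa>>0. (g t has_derivative (\<lambda>v. \<kappa> * (normal t x \<bullet> v))) (at (H t x))"
          if "H t x \<in> ball (H t0 x0) \<rho>'"
          by (rule mp[OF hx[THEN conjunct2] subsetD[OF B that]])
      qed
    qed
    show "x0 \<in> N" by (rule h[THEN conjunct1])
    show "openin (top_of_set M) N" by (rule h[THEN conjunct2, THEN conjunct1])
  qed
qed

end

text \<open>Sheets are labelled by the preimages of \<open>q0\<close> at the time \<open>t0\<close>. At nearby times a sheet may miss
  \<open>q0\<close>, but every part of the surface that meets the ball lies on one of these sheets.\<close>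
locale local_sheets = surface_homotopy M \<A> a b H
  for M :: "'a::t2_space set" and \<A> :: "'a atlas" and a b :: real and H :: "real \<Rightarrow> 'a \<Rightarrow> real^3" +
  fixes t0 :: real and q0 :: "real^3" and \<epsilon> \<delta> \<rho> :: real and N :: "'a \<Rightarrow> 'a set"
    and g :: "'a \<Rightarrow> real \<Rightarrow> real^3 \<Rightarrow> real"
  assumes finite_I: "finite (fibre M (H t0) q0)" and \<delta>_pos: "0 < \<delta>" and \<rho>_pos: "0 < \<rho>"
    and times: "{t0 - \<delta><..<t0 + \<delta>} \<subseteq> {a<..<b}"
    and sheets: "\<And>x. x \<in> fibre M (H t0) q0 \<Longrightarrow> sheet_function t0 x \<epsilon> \<delta> \<rho> (N x) (g x)"
    and disjoint_sheets: "disjoint_family_on N (fibre M (H t0) q0)"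
    and covered: "\<And>t y. t \<in> {t0 - \<delta><..<t0 + \<delta>} \<Longrightarrow> y \<in> M \<Longrightarrow> H t y \<in> ball q0 \<rho> \<Longrightarrow>
      \<exists>x\<in>fibre M (H t0) q0. y \<in> N x"

context surface_homotopy
begin

lemma local_sheets_exist:
  assumes t0: "t0 \<in> {a<..<b}" and fin: "finite (fibre M (H t0) q0)" and \<epsilon>: "\<epsilon> > 0"
    and V: "\<And>x. x \<in> fibre M (H t0) q0 \<Longrightarrow> openin (top_of_set M) (V x) \<and> x \<in> V x"
  obtains \<delta> \<rho> N g where "local_sheets M \<A> a b H t0 q0 \<epsilon> \<delta> \<rho> N g"
    "\<forall>x\<in>fibre M (H t0) q0. N x \<subseteq> V x"
proof -
  let ?I = "fibre M (H t0) q0"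
  have I: "x \<in> M" "H t0 x = q0" if "x \<in> ?I" for x using that by (auto simp: fibre_def)
  obtain G where G: "\<forall>x\<in>?I. open (G x) \<and> x \<in> G x" "disjoint_family_on G ?I"
    by (rule finite_set_separated[OF fin])
  define good where "good x \<delta> \<rho> N g \<longleftrightarrow>
    \<delta> > 0 \<and> \<rho> > 0 \<and> N \<subseteq> V x \<inter> G x \<and> sheet_function t0 x \<epsilon> \<delta> \<rho> N g" for x \<delta> \<rho> N g
  have "\<exists>\<delta> \<rho> N g. good x \<delta> \<rho> N g" if x: "x \<in> ?I" for x
  proof -
    have Gx: "open (G x)" "x \<in> G x" using G(1) x by auto
    have VG: "openin (top_of_set M) (V x \<inter> (M \<inter> G x))"
      by (rule openin_Int[OF conjunct1[OF V[OF x]] openin_open_Int[OF Gx(1)]])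
    have VG': "x \<in> V x \<inter> (M \<inter> G x)" using V[OF x] Gx I[OF x] by simp
    obtain \<delta> \<rho> N g where "\<delta> > 0" "\<rho> > 0" "N \<subseteq> V x \<inter> (M \<inter> G x)" "sheet_function t0 x \<epsilon> \<delta> \<rho> N g"
      by (rule sheet_function_exists[OF t0 I(1)[OF x] \<epsilon> VG VG'])
    then show ?thesis unfolding good_def by blast
  qed
  then obtain d r N g where "\<And>x. x \<in> ?I \<Longrightarrow> good x (d x) (r x) (N x) (g x)" by metis
  then have h: "d x > 0" "r x > 0" "N x \<subseteq> V x \<inter> G x" "sheet_function t0 x \<epsilon> (d x) (r x) (N x) (g x)"
    if "x \<in> ?I" for x using that unfolding good_def by simp_all
  have N: "openin (top_of_set M) (N x)" "x \<in> N x" if "x \<in> ?I" for x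
    using h(4)[OF that, unfolded sheet_function_def] by simp_all
  have "openin (top_of_set M) (\<Union>x\<in>?I. N x)" using N(1) by (intro openin_Union) auto
  moreover have "H t0 x \<noteq> q0" if "x \<in> M - (\<Union>x\<in>?I. N x)" for x
    using that N(2)[of x] by (auto simp: fibre_def)
  ultimately obtain d0 r0 where dr0: "d0 > 0" "r0 > 0" "{t0 - d0<..<t0 + d0} \<subseteq> {a<..<b}"
    "\<forall>t\<in>{t0 - d0<..<t0 + d0}. \<forall>x\<in>M - (\<Union>x\<in>?I. N x). H t x \<notin> ball q0 r0"
    by (rule image_avoids_nearby[OF t0])
  let ?\<delta> = "Min (insert d0 (d ` ?I))" and ?\<rho> = "Min (insert r0 (r ` ?I))"
  have fin': "finite (insert d0 (d ` ?I))" "finite (insert r0 (r ` ?I))" using fin by auto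
  have \<delta>: "?\<delta> > 0" and \<rho>: "?\<rho> > 0"
    using h(1,2) dr0(1,2) Min_gr_iff[OF fin'(1)] Min_gr_iff[OF fin'(2)] by simp_all
  have \<delta>': "?\<delta> \<le> d0" "\<And>x. x \<in> ?I \<Longrightarrow> ?\<delta> \<le> d x" and \<rho>': "?\<rho> \<le> r0" "\<And>x. x \<in> ?I \<Longrightarrow> ?\<rho> \<le> r x"
    using Min_le[OF fin'(1)] Min_le[OF fin'(2)] by blast+
  show thesis
  proof (rule that[of ?\<delta> ?\<rho> N g])
    show "\<forall>x\<in>?I. N x \<subseteq> V x" using h(3) by blast
    show "local_sheets M \<A> a b H t0 q0 \<epsilon> ?\<delta> ?\<rho> N g"
    proof (intro local_sheets.intro local_sheets_axioms.intro)
      show "surface_homotopy M \<A> a b H" by (rule surface_homotopy_axioms)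
      show "finite ?I" by (rule fin)
      show "?\<delta> > 0" by (rule \<delta>)
      show "?\<rho> > 0" by (rule \<rho>)
      show "{t0 - ?\<delta><..<t0 + ?\<delta>} \<subseteq> {a<..<b}"
      proof (rule order_trans[OF _ dr0(3)])
        show "{t0 - ?\<delta><..<t0 + ?\<delta>} \<subseteq> {t0 - d0<..<t0 + d0}"
          unfolding greaterThanLessThan_subseteq_greaterThanLessThan using \<delta>'(1) by linarith
      qed
      show "sheet_function t0 x \<epsilon> ?\<delta> ?\<rho> (N x) (g x)" if x: "x \<in> ?I" for x
        by (rule sheet_function_shrink[OF h(4)[OF x] \<delta> \<delta>'(2)[OF x] \<rho>'(2)[OF x]])
      show "disjoint_family_on N ?I"
        unfolding disjoint_family_on_def
      proof (intro ballI impI)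
        fix x y assume xy: "x \<in> ?I" "y \<in> ?I" "x \<noteq> y"
        then have "G x \<inter> G y = {}" using G(2) unfolding disjoint_family_on_def by simp
        then show "N x \<inter> N y = {}" using h(3)[OF xy(1)] h(3)[OF xy(2)] by blast
      qed
      fix t y assume ty: "t \<in> {t0 - ?\<delta><..<t0 + ?\<delta>}" "y \<in> M" "H t y \<in> ball q0 ?\<rho>"
      have "t \<in> {t0 - d0<..<t0 + d0}"
        using ty(1) \<delta>'(1) unfolding greaterThanLessThan_iff by linarith
      moreover have "H t y \<in> ball q0 r0" using ty(3) \<rho>'(1) unfolding mem_ball by linarith
      ultimately have "\<not> y \<in> M - (\<Union>x\<in>?I. N x)" using dr0(4) by blast
      then show "\<exists>x\<in>?I. y \<in> N x" using ty(2) by blast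
    qed
  qed
qed

end

section \<open>Counting the sheets that have a point on their positive side\<close>

lemma connected_nonzero_same_sign:
  fixes f :: "'b::topological_space \<Rightarrow> real"
  assumes "connected S" and "continuous_on S f" and nz: "\<And>x. x \<in> S \<Longrightarrow> f x \<noteq> 0" and "x \<in> S" "y \<in> S"
  shows "f x > 0 \<longleftrightarrow> f y > 0"
proof -
  have "is_interval (f ` S)"
    using connected_continuous_image[OF assms(2,1)] by (simp add: is_interval_connected_1)
  then have *: "0 \<in> f ` S" if "u \<in> S" "v \<in> S" "f u \<le> 0" "0 \<le> f v" for u v
    using that mem_is_interval_1_I[of "f ` S" "f u" "f v" 0] by blast
  show ?thesis using *[of x y] *[of y x] nz assms(4,5) by fastforce
qed

text \<open>Changing the sign at \<open>y\<close> is an involution of the sign functions, so half of them are \<open>1\<close> at \<open>y\<close>.\<close>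
lemma sum_sign_functions_card:
  assumes "finite F"
  shows "(\<Sum>\<sigma>\<in>F \<rightarrow>\<^sub>E {-1, 1::real}. real (card {y \<in> F. \<sigma> y = 1})) = real (card F) * 2 ^ card F / 2"
proof -
  let ?P = "F \<rightarrow>\<^sub>E {-1, 1::real}"
  have fin: "finite ?P" using assms by (intro finite_PiE) auto
  have cardP: "card ?P = 2 ^ card F" using assms by (simp add: card_PiE numeral_2_eq_2)
  have zero: "(\<Sum>\<sigma>\<in>?P. \<sigma> y) = 0" if y: "y \<in> F" for y
  proof -
    have "(\<Sum>\<sigma>\<in>?P. \<sigma> y) = (\<Sum>\<sigma>\<in>?P. - \<sigma> y)"
    proof (rule sum.reindex_bij_witness[where i = "\<lambda>\<sigma>. \<sigma>(y := - \<sigma> y)" and j = "\<lambda>\<sigma>. \<sigma>(y := - \<sigma> y)"])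
      have flip: "\<sigma>(y := - \<sigma> y) \<in> ?P" if "\<sigma> \<in> ?P" for \<sigma>
      proof (rule PiE_I)
        show "(\<sigma>(y := - \<sigma> y)) z \<in> {-1, 1}" if "z \<in> F" for z
          using PiE_mem[OF \<open>\<sigma> \<in> ?P\<close> that] by (auto simp: fun_upd_apply)
        show "(\<sigma>(y := - \<sigma> y)) z = undefined" if "z \<notin> F" for z
          using PiE_arb[OF \<open>\<sigma> \<in> ?P\<close> that] y that by auto
      qed
      show "\<sigma>(y := - \<sigma> y) \<in> ?P" if "\<sigma> \<in> ?P" for \<sigma> by (rule flip[OF that])
      show "\<sigma>(y := - \<sigma> y) \<in> ?P" if "\<sigma> \<in> ?P" for \<sigma> by (rule flip[OF that])
    qed simp_all
    then show ?thesis by (simp add: sum_negf)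
  qed
  have "(\<Sum>\<sigma>\<in>?P. real (card {y \<in> F. \<sigma> y = 1})) = (\<Sum>\<sigma>\<in>?P. \<Sum>y\<in>F. (1 + \<sigma> y) / 2)"
  proof (rule sum.cong)
    fix \<sigma> assume \<sigma>: "\<sigma> \<in> ?P"
    have "(\<Sum>y\<in>F. (1 + \<sigma> y) / 2) = (\<Sum>y\<in>F. if \<sigma> y = 1 then 1 else 0)"
      by (rule sum.cong) (use \<sigma> in \<open>auto simp: PiE_iff\<close>)
    also have "\<dots> = real (card {y \<in> F. \<sigma> y = 1})"
      using assms by (simp add: sum.If_cases Int_def)
    finally show "real (card {y \<in> F. \<sigma> y = 1}) = (\<Sum>y\<in>F. (1 + \<sigma> y) / 2)" by simp
  qed simp
  also have "\<dots> = (\<Sum>y\<in>F. \<Sum>\<sigma>\<in>?P. (1 + \<sigma> y) / 2)" by (rule sum.swap)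
  also have "\<dots> = (\<Sum>y\<in>F. 2 ^ card F / 2)"
  proof (rule sum.cong)
    fix y assume "y \<in> F"
    have "(\<Sum>\<sigma>\<in>?P. (1 + \<sigma> y) / 2) = ((\<Sum>\<sigma>\<in>?P. 1) + (\<Sum>\<sigma>\<in>?P. \<sigma> y)) / 2"
      by (simp only: sum_divide_distrib[symmetric] sum.distrib)
    then show "(\<Sum>\<sigma>\<in>?P. (1 + \<sigma> y) / 2) = 2 ^ card F / 2"
      using zero[OF \<open>y \<in> F\<close>] cardP by simp
  qed simp
  finally show ?thesis by simp
qed

context local_sheets
begin

abbreviation I :: "'a set" where "I \<equiv> fibre M (H t0) q0"
abbreviation times :: "real set" where "times \<equiv> {t0 - \<delta><..<t0 + \<delta>}"
abbreviation B :: "(real^3) set" where "B \<equiv> ball q0 \<rho>"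

text \<open>Up to an additive constant this is the Alexander number.\<close>
definition positive :: "real \<Rightarrow> real^3 \<Rightarrow> nat" where
  "positive t w = card {x \<in> I. g x t w > 0}"

definition sheet_point :: "real \<Rightarrow> real^3 \<Rightarrow> 'a \<Rightarrow> 'a" where
  "sheet_point t w x = inv_into (N x) (H t) w"

lemma times_subset: "t \<in> times \<Longrightarrow> t \<in> {a<..<b}"
  by (rule subsetD[OF local_sheets.times[OF local_sheets_axioms]])

lemma base: "x \<in> I \<Longrightarrow> H t0 x = q0"
  by (simp add: fibre_def)

lemma
  assumes "x \<in> I"
  shows label_in_sheet: "x \<in> N x" and sheet_openin: "openin (top_of_set M) (N x)"
    and sheet_subset: "N x \<subseteq> M"
proof -
  show "x \<in> N x" using sheets[OF assms, unfolded sheet_function_def] by simp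
  show "openin (top_of_set M) (N x)" using sheets[OF assms, unfolded sheet_function_def] by simp
  then show "N x \<subseteq> M" by (rule openin_imp_subset)
qed

lemma
  assumes "x \<in> I" and "t \<in> times"
  shows sheet_inj: "inj_on (H t) (N x)"
    and sheet_almost_linear: "almost_linear_on B \<epsilon> (g x t) (normal t0 x)"
    and sheet_zero: "\<And>w. w \<in> B \<Longrightarrow> g x t w = 0 \<longleftrightarrow> w \<in> H t ` N x"
    and sheet_normal: "\<And>y. y \<in> N x \<Longrightarrow> normal t0 x \<bullet> normal t y \<ge> 1/2"
    and sheet_gradient: "\<And>y. y \<in> N x \<Longrightarrow> H t y \<in> B \<Longrightarrow>
        \<exists>\<kappa>>0. (g x t has_derivative (\<lambda>v. \<kappa> * (normal t y \<bullet> v))) (at (H t y))"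
proof -
  note h = sheets[OF assms(1), unfolded sheet_function_def base[OF assms(1)]]
  note ht = bspec[OF h[THEN conjunct2, THEN conjunct2, THEN conjunct2, THEN conjunct1] assms(2)]
  show "inj_on (H t) (N x)" by (rule ht[THEN conjunct1])
  show "almost_linear_on B \<epsilon> (g x t) (normal t0 x)" by (rule ht[THEN conjunct2, THEN conjunct1])
  show "g x t w = 0 \<longleftrightarrow> w \<in> H t ` N x" if "w \<in> B" for w
    by (rule bspec[OF ht[THEN conjunct2, THEN conjunct2, THEN conjunct1] that])
  fix y assume y: "y \<in> N x"
  note hy = bspec[OF ht[THEN conjunct2, THEN conjunct2, THEN conjunct2] y]
  show "normal t0 x \<bullet> normal t y \<ge> 1/2" by (rule hy[THEN conjunct1])
  show "\<exists>\<kappa>>0. (g x t has_derivative (\<lambda>v. \<kappa> * (normal t y \<bullet> v))) (at (H t y))" if "H t y \<in> B"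
    by (rule mp[OF hy[THEN conjunct2] that])
qed

lemma sheet_time_continuous:
  assumes "x \<in> I" and "w \<in> B"
  shows "((\<lambda>t. g x t w) \<longlongrightarrow> g x t0 w) (at t0)"
proof -
  note h = sheets[OF assms(1), unfolded sheet_function_def base[OF assms(1)]]
  show ?thesis
    by (rule bspec[OF h[THEN conjunct2, THEN conjunct2, THEN conjunct2, THEN conjunct2] assms(2)])
qed

lemma sheet_continuous: "x \<in> I \<Longrightarrow> t \<in> times \<Longrightarrow> continuous_on B (g x t)"
  by (rule almost_linear_on_continuous[OF sheet_almost_linear])

lemma sheet_point:
  assumes "x \<in> I" "t \<in> times" "w \<in> B" "g x t w = 0"
  shows "sheet_point t w x \<in> N x" "H t (sheet_point t w x) = w"
proof -
  have "w \<in> H t ` N x" using sheet_zero[OF assms(1-3)] assms(4) by simp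
  then show "sheet_point t w x \<in> N x" "H t (sheet_point t w x) = w"
    unfolding sheet_point_def by (simp_all add: inv_into_into f_inv_into_f)
qed

lemma sheet_unique:
  assumes "x \<in> I" "x' \<in> I" "y \<in> N x" "y \<in> N x'"
  shows "x = x'"
  using disjoint_sheets assms unfolding disjoint_family_on_def by blast

lemma sheet_point_eq:
  assumes "x \<in> I" "t \<in> times" "y \<in> N x" "H t y = w" "w \<in> B"
  shows "g x t w = 0" "sheet_point t w x = y"
proof -
  show "g x t w = 0" using sheet_zero[OF assms(1,2,5)] assms(3,4) by blast
  show "sheet_point t w x = y"
    unfolding sheet_point_def using inv_into_f_f[OF sheet_inj[OF assms(1,2)] assms(3)] assms(4) by simp
qed

lemma sheet_point_bij:
  assumes "t \<in> times" "w \<in> B"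
  shows "bij_betw (sheet_point t w) {x \<in> I. g x t w = 0} (fibre M (H t) w)"
proof (rule bij_betw_imageI)
  show "inj_on (sheet_point t w) {x \<in> I. g x t w = 0}"
  proof (rule inj_onI)
    fix x x' assume x: "x \<in> {x \<in> I. g x t w = 0}" and x': "x' \<in> {x \<in> I. g x t w = 0}"
      and eq: "sheet_point t w x = sheet_point t w x'"
    have "sheet_point t w x \<in> N x" "sheet_point t w x' \<in> N x'"
      using x x' sheet_point(1)[OF _ assms] by auto
    then show "x = x'" using eq sheet_unique[of x x'] x x' by auto
  qed
  show "sheet_point t w ` {x \<in> I. g x t w = 0} = fibre M (H t) w"
  proof
    show "sheet_point t w ` {x \<in> I. g x t w = 0} \<subseteq> fibre M (H t) w"
    proof
      fix y assume "y \<in> sheet_point t w ` {x \<in> I. g x t w = 0}"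
      then obtain x where x: "x \<in> I" "g x t w = 0" "y = sheet_point t w x" by blast
      show "y \<in> fibre M (H t) w"
        using sheet_point[OF x(1) assms x(2)] sheet_subset[OF x(1)] x(3) by (auto simp: fibre_def)
    qed
    show "fibre M (H t) w \<subseteq> sheet_point t w ` {x \<in> I. g x t w = 0}"
    proof
      fix y assume "y \<in> fibre M (H t) w"
      then have y: "y \<in> M" "H t y = w" by (auto simp: fibre_def)
      then obtain x where x: "x \<in> I" "y \<in> N x" using covered[OF assms(1), of y] assms(2) by blast
      show "y \<in> sheet_point t w ` {x \<in> I. g x t w = 0}"
        using sheet_point_eq[OF x(1) assms(1) x(2) y(2) assms(2)] x(1) by blast
    qed
  qed
qed

lemma image_iff_zero:
  assumes "t \<in> times" "w \<in> B"
  shows "w \<in> H t ` M \<longleftrightarrow> (\<exists>x\<in>I. g x t w = 0)"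
proof -
  have "w \<in> H t ` M \<longleftrightarrow> fibre M (H t) w \<noteq> {}" by (auto simp: fibre_def)
  also have "\<dots> \<longleftrightarrow> {x \<in> I. g x t w = 0} \<noteq> {}"
    unfolding bij_betw_imp_surj_on[OF sheet_point_bij[OF assms], symmetric] by simp
  finally show ?thesis by blast
qed

lemma eventually_in_ball:
  assumes "w \<in> B"
  shows "\<forall>\<^sub>F e in at_right 0. w + e *\<^sub>R v \<in> B"
proof -
  have "((\<lambda>e. w + e *\<^sub>R v) \<longlongrightarrow> w) (at_right 0)" by (auto intro!: tendsto_eq_intros)
  then show ?thesis using topological_tendstoD[OF _ open_ball assms] by blast
qed

text \<open>On the sheet the derivative of its function in the direction \<open>v\<close> decides, off the sheet its
  continuity does.\<close>
lemma eventually_side: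
  assumes x: "x \<in> I" and t: "t \<in> times" and w: "w \<in> B"
    and v: "g x t w = 0 \<Longrightarrow> normal t (sheet_point t w x) \<bullet> v \<noteq> 0"
  shows "\<forall>\<^sub>F e in at_right 0. g x t (w + e *\<^sub>R v) \<noteq> 0 \<and>
    (g x t (w + e *\<^sub>R v) > 0 \<longleftrightarrow> g x t w > 0 \<or> g x t w = 0 \<and> normal t (sheet_point t w x) \<bullet> v > 0)"
proof (cases "g x t w = 0")
  case False
  have "isCont (g x t) w"
    using sheet_continuous[OF x t] continuous_on_eq_continuous_at[OF open_ball] w by blast
  then have lim: "((\<lambda>e. g x t (w + e *\<^sub>R v)) \<longlongrightarrow> g x t w) (at_right 0)"
    by (rule isCont_tendsto_compose) (auto intro!: tendsto_eq_intros)
  show ?thesis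
  proof (cases "g x t w > 0")
    case True
    show ?thesis using order_tendstoD(1)[OF lim True] by eventually_elim (use True in auto)
  next
    case neg: False
    then have "g x t w < 0" using False by simp
    from order_tendstoD(2)[OF lim this] show ?thesis by eventually_elim (use neg False in auto)
  qed
next
  case True
  let ?y = "sheet_point t w x"
  note y = sheet_point[OF x t w True]
  obtain \<kappa> where \<kappa>: "\<kappa> > 0" "(g x t has_derivative (\<lambda>v. \<kappa> * (normal t ?y \<bullet> v))) (at w)"
    using sheet_gradient[OF x t y(1)] y(2) w by auto
  have "((\<lambda>e. w + e *\<^sub>R v) has_derivative (\<lambda>e. e *\<^sub>R v)) (at 0)"
    by (auto intro!: derivative_eq_intros)
  moreover have "(g x t has_derivative (\<lambda>v. \<kappa> * (normal t ?y \<bullet> v))) (at (w + 0 *\<^sub>R v))"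
    using \<kappa>(2) by simp
  ultimately have "((\<lambda>e. g x t (w + e *\<^sub>R v)) has_derivative (\<lambda>e. \<kappa> * (normal t ?y \<bullet> (e *\<^sub>R v)))) (at 0)"
    by (rule has_derivative_compose)
  then have D: "((\<lambda>e. g x t (w + e *\<^sub>R v)) has_real_derivative \<kappa> * (normal t ?y \<bullet> v)) (at 0)"
    unfolding has_field_derivative_def by (rule has_derivative_eq_rhs) (auto simp: fun_eq_iff)
  show ?thesis
  proof (cases "normal t ?y \<bullet> v > 0")
    case pos: True
    then obtain d where "d > 0" "\<And>h. 0 < h \<Longrightarrow> h < d \<Longrightarrow> g x t (w + 0 *\<^sub>R v) < g x t (w + (0 + h) *\<^sub>R v)"
      using DERIV_pos_inc_right[OF D] \<kappa>(1) by auto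
    then have "\<forall>\<^sub>F e in at_right 0. g x t (w + e *\<^sub>R v) > 0"
      unfolding eventually_at_right_field using True by (intro exI[of _ d]) simp
    then show ?thesis by eventually_elim (use True pos in simp)
  next
    case neg: False
    then have "normal t ?y \<bullet> v < 0" using v[OF True] by simp
    then obtain d where "d > 0" "\<And>h. 0 < h \<Longrightarrow> h < d \<Longrightarrow> g x t (w + 0 *\<^sub>R v) > g x t (w + (0 + h) *\<^sub>R v)"
      using DERIV_neg_dec_right[OF D] \<kappa>(1) by (auto simp: mult_pos_neg)
    then have "\<forall>\<^sub>F e in at_right 0. g x t (w + e *\<^sub>R v) < 0"
      unfolding eventually_at_right_field using True by (intro exI[of _ d]) simp
    then show ?thesis by eventually_elim (use True neg in simp)
  qed
qed

text \<open>A step from \<open>w\<close> in a direction transverse to all sheets through \<open>w\<close>. This covers the crossing of a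
  sheet at a simple point as well as the octants at a triple point.\<close>
lemma eventually_positive:
  assumes t: "t \<in> times" and w: "w \<in> B" and v: "\<And>y. y \<in> fibre M (H t) w \<Longrightarrow> normal t y \<bullet> v \<noteq> 0"
  shows "\<forall>\<^sub>F e in at_right 0. w + e *\<^sub>R v \<in> B - H t ` M \<and>
    positive t (w + e *\<^sub>R v) = positive t w + card {y \<in> fibre M (H t) w. normal t y \<bullet> v > 0}"
proof -
  let ?Z = "{x \<in> I. g x t w = 0}"
  note bij = sheet_point_bij[OF t w]
  have pt: "sheet_point t w x \<in> fibre M (H t) w" if "x \<in> ?Z" for x
    using bij_betwE[OF bij] that by blast
  have "\<forall>x\<in>I. \<forall>\<^sub>F e in at_right 0. g x t (w + e *\<^sub>R v) \<noteq> 0 \<and>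
    (g x t (w + e *\<^sub>R v) > 0 \<longleftrightarrow> g x t w > 0 \<or> g x t w = 0 \<and> normal t (sheet_point t w x) \<bullet> v > 0)"
  proof
    fix x assume x: "x \<in> I"
    show "\<forall>\<^sub>F e in at_right 0. g x t (w + e *\<^sub>R v) \<noteq> 0 \<and>
      (g x t (w + e *\<^sub>R v) > 0 \<longleftrightarrow> g x t w > 0 \<or> g x t w = 0 \<and> normal t (sheet_point t w x) \<bullet> v > 0)"
      by (rule eventually_side[OF x t w], rule v, rule pt) (use x in simp)
  qed
  then have "\<forall>\<^sub>F e in at_right 0. \<forall>x\<in>I. g x t (w + e *\<^sub>R v) \<noteq> 0 \<and>
    (g x t (w + e *\<^sub>R v) > 0 \<longleftrightarrow> g x t w > 0 \<or> g x t w = 0 \<and> normal t (sheet_point t w x) \<bullet> v > 0)"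
    using finite_I by (simp add: eventually_ball_finite_distrib)
  with eventually_in_ball[OF w, of v] show ?thesis
  proof eventually_elim
    case (elim e)
    let ?w = "w + e *\<^sub>R v"
    have "?w \<notin> H t ` M" using image_iff_zero[OF t elim(1)] elim(2) by blast
    moreover have "{x \<in> I. g x t ?w > 0} =
        {x \<in> I. g x t w > 0} \<union> {x \<in> ?Z. normal t (sheet_point t w x) \<bullet> v > 0}"
      using elim(2) by blast
    then have "positive t ?w = positive t w + card {x \<in> ?Z. normal t (sheet_point t w x) \<bullet> v > 0}"
      unfolding positive_def using finite_I by (subst card_Un_disjoint[symmetric]) auto
    moreover have "bij_betw (sheet_point t w) {x \<in> ?Z. normal t (sheet_point t w x) \<bullet> v > 0}
        {y \<in> fibre M (H t) w. normal t y \<bullet> v > 0}"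
      using bij by (rule bij_betw_Collect) simp
    then have "card {x \<in> ?Z. normal t (sheet_point t w x) \<bullet> v > 0} =
        card {y \<in> fibre M (H t) w. normal t y \<bullet> v > 0}"
      by (rule bij_betw_same_card)
    ultimately show ?case using elim(1) by simp
  qed
qed

lemma positive_constant_on_segment:
  assumes t: "t \<in> times" and seg: "closed_segment w1 w2 \<subseteq> B - H t ` M"
  shows "positive t w1 = positive t w2"
proof -
  have "g x t w1 > 0 \<longleftrightarrow> g x t w2 > 0" if x: "x \<in> I" for x
  proof (rule connected_nonzero_same_sign[of "closed_segment w1 w2"])
    show "continuous_on (closed_segment w1 w2) (g x t)"
      by (rule continuous_on_subset[OF sheet_continuous[OF x t]]) (use seg in blast)
    show "g x t w \<noteq> 0" if "w \<in> closed_segment w1 w2" for w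
      using seg that image_iff_zero[OF t, of w] x by blast
  qed auto
  then have "{x \<in> I. g x t w1 > 0} = {x \<in> I. g x t w2 > 0}" by blast
  then show ?thesis unfolding positive_def by simp
qed

lemma positive_time_stable:
  assumes w: "w \<in> B" and off: "w \<notin> H t0 ` M"
  shows "\<forall>\<^sub>F t in at t0. positive t w = positive t0 w"
proof -
  have t0: "t0 \<in> times" using \<delta>_pos by simp
  have "\<forall>\<^sub>F t in at t0. g x t w > 0 \<longleftrightarrow> g x t0 w > 0" if x: "x \<in> I" for x
  proof (cases "g x t0 w > 0")
    case True
    from order_tendstoD(1)[OF sheet_time_continuous[OF x w] this] show ?thesis
      by eventually_elim (use True in simp)
  next
    case False
    moreover have "g x t0 w \<noteq> 0" using image_iff_zero[OF t0 w] off x by blast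
    ultimately have "g x t0 w < 0" by simp
    from order_tendstoD(2)[OF sheet_time_continuous[OF x w] this] show ?thesis
      by eventually_elim (use False in simp)
  qed
  then have "\<forall>x\<in>I. \<forall>\<^sub>F t in at t0. g x t w > 0 \<longleftrightarrow> g x t0 w > 0" by blast
  then have "\<forall>\<^sub>F t in at t0. \<forall>x\<in>I. g x t w > 0 \<longleftrightarrow> g x t0 w > 0"
    using finite_I by (simp add: eventually_ball_finite_distrib)
  then show ?thesis
  proof eventually_elim
    case (elim t)
    then have "{x \<in> I. g x t w > 0} = {x \<in> I. g x t0 w > 0}" by blast
    then show ?case unfolding positive_def by simp
  qed
qed

end

section \<open>Alexander numberings and the index of a triple point\<close>

lemma generic_immersionD:
  assumes "generic_immersion M \<A> S"
  shows "card (fibre M S q) \<le> 3" "general_position \<A> S (fibre M S q)"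
  using assms unfolding generic_immersion_def by blast+

lemma general_positionD:
  assumes "general_position \<A> S P"
  shows "finite P" "inj_on (coorientation \<A> S) P" "independent (coorientation \<A> S ` P)"
  using assms unfolding general_position_def by simp_all

context surface_homotopy
begin

text \<open>Multiple points do not obstruct: if \<open>F\<close> does not change across simple points, then it takes one value on
  all the regions that meet at \<open>w0\<close>.\<close>
lemma locally_constant_off_image:
  assumes t: "t \<in> {a<..<b}" and gp: "general_position \<A> (H t) (fibre M (H t) w0)"
    and U: "open U" "w0 \<in> U"
    and seg: "\<And>w1 w2. closed_segment w1 w2 \<subseteq> U - H t ` M \<Longrightarrow> F w1 = F w2"
    and jump: "\<And>y. y \<in> M \<Longrightarrow> H t y \<in> U \<Longrightarrow> fibre M (H t) (H t y) = {y} \<Longrightarrow>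
      \<forall>\<^sub>F e in at_right 0. F (H t y + e *\<^sub>R normal t y) = F (H t y - e *\<^sub>R normal t y)"
  obtains r where "r > 0" "ball w0 r \<subseteq> U"
    "\<forall>w\<in>ball w0 r - H t ` M. \<forall>w'\<in>ball w0 r - H t ` M. F w = F w'"
proof -
  let ?I = "fibre M (H t) w0"
  note fin = general_positionD(1)[OF gp]
  have IM: "openin (top_of_set M) M \<and> x \<in> M" if "x \<in> ?I" for x using that by (simp add: fibre_def)
  obtain V where V: "V > 0"
    "\<And>c. \<forall>i\<in>?I. \<bar>c i\<bar> \<le> 1 \<Longrightarrow> \<exists>v. norm v \<le> V \<and> (\<forall>i\<in>?I. normal t i \<bullet> v = c i)"
    using bounded_solutions_exist[OF general_positionD[OF gp]] by blast
  define \<epsilon> where "\<epsilon> = 1 / (8 * (V + 1))"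
  have \<epsilon>: "0 < \<epsilon>" "\<epsilon> * V \<le> 1/8" "\<epsilon> \<le> 1/8" unfolding \<epsilon>_def using V(1) by (auto simp: field_simps)
  obtain \<delta> \<rho> N g where L: "local_sheets M \<A> a b H t w0 \<epsilon> \<delta> \<rho> N g" and "\<forall>x\<in>?I. N x \<subseteq> M"
    by (rule local_sheets_exist[OF t fin \<epsilon>(1) IM])
  interpret L: local_sheets M \<A> a b H t w0 \<epsilon> \<delta> \<rho> N g by (rule L)
  have tT: "t \<in> {t - \<delta><..<t + \<delta>}" using L.\<delta>_pos by simp
  obtain r0 where r0: "r0 > 0" "ball w0 r0 \<subseteq> U" using U open_contains_ball by blast
  define \<rho>' where "\<rho>' = min \<rho> r0"
  have \<rho>': "\<rho>' > 0" "ball w0 \<rho>' \<subseteq> ball w0 \<rho>" "ball w0 \<rho>' \<subseteq> U"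
    unfolding \<rho>'_def using L.\<rho>_pos r0 by auto
  have off: "w \<notin> H t ` M \<longleftrightarrow> (\<forall>x\<in>?I. g x t w \<noteq> 0)" if "w \<in> ball w0 \<rho>'" for w
    using L.image_iff_zero[OF tT, of w] that \<rho>'(2) by blast
  have unit: "norm (normal t x) = 1" if "x \<in> ?I" for x
    using norm_normal[OF t] that by (simp add: fibre_def)
  have al: "almost_linear_on (ball w0 \<rho>') \<epsilon> (g x t) (normal t x)" if "x \<in> ?I" for x
    by (rule almost_linear_on_subset[OF L.sheet_almost_linear[OF that tT] \<rho>'(2)])
  have w0: "w0 \<in> ball w0 \<rho>" using L.\<rho>_pos by simp
  have zero: "g x t w0 = 0" if "x \<in> ?I" for x
    by (rule L.sheet_point_eq(1)[OF that tT L.label_in_sheet[OF that] L.base[OF that] w0])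
  have seg': "F w1 = F w2"
    if s: "closed_segment w1 w2 \<subseteq> {w \<in> ball w0 \<rho>'. \<forall>x\<in>?I. g x t w \<noteq> 0}" for w1 w2
  proof (rule seg)
    show "closed_segment w1 w2 \<subseteq> U - H t ` M"
    proof
      fix w assume "w \<in> closed_segment w1 w2"
      then have "w \<in> ball w0 \<rho>'" "\<forall>x\<in>?I. g x t w \<noteq> 0" using s by blast+
      then show "w \<in> U - H t ` M" using off \<rho>'(3) by blast
    qed
  qed
  have jump': "\<exists>\<nu>. \<forall>\<^sub>F e in at_right 0. g x t (w + e *\<^sub>R \<nu>) > 0 \<and> g x t (w - e *\<^sub>R \<nu>) < 0 \<and>
      F (w + e *\<^sub>R \<nu>) = F (w - e *\<^sub>R \<nu>)"
    if x: "x \<in> ?I" and w: "w \<in> ball w0 \<rho>'" and z: "g x t w = 0" and nz: "\<forall>k\<in>?I - {x}. g k t w \<noteq> 0" for w x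
  proof -
    have wB: "w \<in> ball w0 \<rho>" using w \<rho>'(2) by blast
    let ?y = "L.sheet_point t w x"
    note y = L.sheet_point[OF x tT wB z]
    have yM: "?y \<in> M" using y(1) L.sheet_subset[OF x] by blast
    have "{k \<in> ?I. g k t w = 0} = {x}" using x z nz by blast
    then have fib: "fibre M (H t) w = {?y}"
      using bij_betw_imp_surj_on[OF L.sheet_point_bij[OF tT wB]] by simp
    have nn: "normal t ?y \<bullet> normal t ?y = 1" using norm_normal[OF t yM] by (simp add: dot_square_norm)
    have "\<forall>\<^sub>F e in at_right 0. F (w + e *\<^sub>R normal t ?y) = F (w - e *\<^sub>R normal t ?y)"
      using jump[OF yM] fib y(2) w \<rho>'(3) by auto
    moreover have "\<forall>\<^sub>F e in at_right 0. g x t (w + e *\<^sub>R normal t ?y) \<noteq> 0 \<and>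
        (g x t (w + e *\<^sub>R normal t ?y) > 0 \<longleftrightarrow> g x t w > 0 \<or> g x t w = 0 \<and> normal t ?y \<bullet> normal t ?y > 0)"
      by (rule L.eventually_side[OF x tT wB]) (simp add: nn)
    moreover have "\<forall>\<^sub>F e in at_right 0. g x t (w + e *\<^sub>R (- normal t ?y)) \<noteq> 0 \<and>
        (g x t (w + e *\<^sub>R (- normal t ?y)) > 0 \<longleftrightarrow> g x t w > 0 \<or> g x t w = 0 \<and> normal t ?y \<bullet> (- normal t ?y) > 0)"
      by (rule L.eventually_side[OF x tT wB]) (simp add: nn)
    ultimately have "\<forall>\<^sub>F e in at_right 0. g x t (w + e *\<^sub>R normal t ?y) > 0 \<and>
        g x t (w - e *\<^sub>R normal t ?y) < 0 \<and> F (w + e *\<^sub>R normal t ?y) = F (w - e *\<^sub>R normal t ?y)"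
      by eventually_elim (use z nn in auto)
    then show ?thesis by blast
  qed
  obtain r where r: "0 < r" "r \<le> \<rho>'" "\<forall>w\<in>ball w0 r. \<forall>w'\<in>ball w0 r.
      (\<forall>x\<in>?I. g x t w \<noteq> 0) \<longrightarrow> (\<forall>x\<in>?I. g x t w' \<noteq> 0) \<longrightarrow> F w = F w'"
    by (rule constant_near_common_zero[where I = ?I and c = "normal t" and g = "\<lambda>x. g x t" and q = w0 and F = F,
        OF fin unit V less_imp_le[OF \<epsilon>(1)] \<epsilon>(2,3) al zero \<rho>'(1) seg' jump'])
  have sub: "ball w0 r \<subseteq> ball w0 \<rho>'" using r(2) by auto
  show thesis
  proof (rule that[OF r(1)])
    show "ball w0 r \<subseteq> U" using sub \<rho>'(3) by blast
    show "\<forall>w\<in>ball w0 r - H t ` M. \<forall>w'\<in>ball w0 r - H t ` M. F w = F w'"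
    proof (intro ballI)
      fix w w' assume w: "w \<in> ball w0 r - H t ` M" and w': "w' \<in> ball w0 r - H t ` M"
      have "\<forall>x\<in>?I. g x t w \<noteq> 0" "\<forall>x\<in>?I. g x t w' \<noteq> 0" using off w w' sub by blast+
      then show "F w = F w'" using r(3) w w' by simp
    qed
  qed
qed

text \<open>One leaves the image in a direction on the positive side of all sheets through \<open>w0\<close>.\<close>
lemma complement_accumulates:
  assumes t: "t \<in> {a<..<b}" and gp: "general_position \<A> (H t) (fibre M (H t) w0)"
    and U: "open U" "w0 \<in> U"
  obtains w where "w \<in> U" "w \<notin> H t ` M"
proof -
  let ?I = "fibre M (H t) w0"
  note fin = general_positionD(1)[OF gp]
  have IM: "openin (top_of_set M) M \<and> x \<in> M" if "x \<in> ?I" for x using that by (simp add: fibre_def)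
  obtain V where V: "V > 0"
    "\<And>c. \<forall>i\<in>?I. \<bar>c i\<bar> \<le> 1 \<Longrightarrow> \<exists>v. norm v \<le> V \<and> (\<forall>i\<in>?I. normal t i \<bullet> v = c i)"
    using bounded_solutions_exist[OF general_positionD[OF gp]] by blast
  have "\<exists>v. norm v \<le> V \<and> (\<forall>i\<in>?I. normal t i \<bullet> v = 1)" by (rule V(2)) simp
  then obtain v where v: "\<forall>i\<in>?I. normal t i \<bullet> v = 1" by blast
  obtain \<delta> \<rho> N g where L: "local_sheets M \<A> a b H t w0 1 \<delta> \<rho> N g" and "\<forall>x\<in>?I. N x \<subseteq> M"
    by (rule local_sheets_exist[OF t fin zero_less_one IM])
  interpret L: local_sheets M \<A> a b H t w0 1 \<delta> \<rho> N g by (rule L)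
  have "\<forall>\<^sub>F e in at_right 0. w0 + e *\<^sub>R v \<in> ball w0 \<rho> - H t ` M \<and>
      L.positive t (w0 + e *\<^sub>R v) = L.positive t w0 + card {y \<in> ?I. normal t y \<bullet> v > 0}"
    by (rule L.eventually_positive) (use v L.\<delta>_pos L.\<rho>_pos in auto)
  moreover have "((\<lambda>e. w0 + e *\<^sub>R v) \<longlongrightarrow> w0) (at_right 0)" by (auto intro!: tendsto_eq_intros)
  from topological_tendstoD[OF this U] have "\<forall>\<^sub>F e in at_right 0. w0 + e *\<^sub>R v \<in> U" .
  ultimately have "\<forall>\<^sub>F e in at_right 0. w0 + e *\<^sub>R v \<in> U \<and> w0 + e *\<^sub>R v \<notin> H t ` M"
    by eventually_elim simp
  then obtain e where "w0 + e *\<^sub>R v \<in> U" "w0 + e *\<^sub>R v \<notin> H t ` M"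
    using eventually_happens'[OF trivial_limit_at_right_real] by blast
  then show thesis by (rule that)
qed

end

lemma alexander_numbering_segment:
  assumes "alexander_numbering M \<A> S A" and seg: "closed_segment w1 w2 \<subseteq> - S ` M"
  shows "A w1 = A w2"
proof -
  have "- S ` M \<noteq> {}" using seg ends_in_segment by blast
  then obtain R where R: "R \<in> components (- S ` M)" "closed_segment w1 w2 \<subseteq> R"
    using exists_component_superset[OF seg _ connected_segment(1)] by blast
  then obtain c where "\<forall>q\<in>R. A q = c" using assms(1) unfolding alexander_numbering_def by blast
  then show ?thesis using subsetD[OF R(2)] ends_in_segment by simp
qed

lemma alexander_numbering_far:
  assumes "alexander_numbering M \<A> S A" and "S ` M \<subseteq> ball 0 r" and w: "w \<notin> ball 0 r"
  shows "A w = - 3/2"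
proof -
  have "connected (- ball (0::real^3) r)" by (rule connected_complement_bounded_convex) auto
  moreover have "- ball 0 r \<subseteq> - S ` M" "- S ` M \<noteq> {}" using assms by blast+
  ultimately obtain R where R: "R \<in> components (- S ` M)" "- ball 0 r \<subseteq> R"
    using exists_component_superset[of "- ball 0 r" "- S ` M"] by blast
  have "\<not> bounded R"
  proof
    assume "bounded R"
    then have "bounded (R \<union> ball 0 r)" by simp
    moreover have "R \<union> ball 0 r = UNIV" using R(2) by blast
    ultimately show False using not_bounded_UNIV by simp
  qed
  then show ?thesis using assms(1) R w unfolding alexander_numbering_def by blast
qed

lemma alexander_numbering_jump:
  assumes "alexander_numbering M \<A> S A" and "y \<in> M" and "fibre M S (S y) = {y}"
  shows "\<forall>\<^sub>F e in at_right 0.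
    A (S y + e *\<^sub>R coorientation \<A> S y) = A (S y - e *\<^sub>R coorientation \<A> S y) + 1"
  using assms unfolding alexander_numbering_def by simp

context local_sheets
begin

text \<open>The numbering and the count of sheets are constant along segments off the image, and they jump
  by one at the same simple points. So their difference is locally constant near every point of the
  ball, which is connected.\<close>
lemma numbering_counts_sheets:
  assumes t: "t \<in> times" and gen: "generic_immersion M \<A> (H t)" and num: "alexander_numbering M \<A> (H t) A"
  obtains K where "\<forall>w\<in>B - H t ` M. A w = K + real (positive t w)"
proof -
  define F where "F = (\<lambda>w. A w - real (positive t w))"
  have tab: "t \<in> {a<..<b}" by (rule times_subset[OF t])
  note gp = generic_immersionD(2)[OF gen]
  have q0: "q0 \<in> B" using \<rho>_pos by simp
  obtain w0 where w0: "w0 \<in> B" "w0 \<notin> H t ` M"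
    by (rule complement_accumulates[OF tab gp open_ball q0])
  have "F w = F w0" if w: "w \<in> B - H t ` M" for w
  proof (rule connected_induction[of B "\<lambda>w. w \<notin> H t ` M" "\<lambda>w. F w = F w0" w0 w])
    show "connected B" by simp
    show "\<exists>z. z \<in> T \<and> z \<notin> H t ` M" if "openin (top_of_set B) T" "x \<in> T" for T x
    proof -
      have "open T" using that(1) open_ball openin_open_trans by blast
      from complement_accumulates[OF tab gp this that(2)] show ?thesis by blast
    qed
    show "\<exists>T. openin (top_of_set B) T \<and> q \<in> T \<and>
        (\<forall>x\<in>T. \<forall>y\<in>T. x \<notin> H t ` M \<and> y \<notin> H t ` M \<and> F x = F w0 \<longrightarrow> F y = F w0)"
      if q: "q \<in> B" for q
    proof -
      have seg: "F w1 = F w2" if s: "closed_segment w1 w2 \<subseteq> B - H t ` M" for w1 w2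
      proof -
        have "A w1 = A w2" by (rule alexander_numbering_segment[OF num]) (use s in blast)
        then show ?thesis unfolding F_def using positive_constant_on_segment[OF t s] by simp
      qed
      have jump: "\<forall>\<^sub>F e in at_right 0. F (H t y + e *\<^sub>R normal t y) = F (H t y - e *\<^sub>R normal t y)"
        if y: "y \<in> M" "H t y \<in> B" and fib: "fibre M (H t) (H t y) = {y}" for y
      proof -
        have nn: "normal t y \<bullet> normal t y = 1"
          using norm_normal[OF tab y(1)] by (simp add: dot_square_norm)
        let ?w = "H t y"
        have e1: "\<forall>\<^sub>F e in at_right 0. ?w + e *\<^sub>R normal t y \<in> B - H t ` M \<and>
            positive t (?w + e *\<^sub>R normal t y) =
              positive t ?w + card {z \<in> fibre M (H t) ?w. normal t z \<bullet> normal t y > 0}"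
          by (rule eventually_positive[OF t y(2)]) (simp add: fib nn)
        have e2: "\<forall>\<^sub>F e in at_right 0. ?w + e *\<^sub>R (- normal t y) \<in> B - H t ` M \<and>
            positive t (?w + e *\<^sub>R (- normal t y)) =
              positive t ?w + card {z \<in> fibre M (H t) ?w. normal t z \<bullet> (- normal t y) > 0}"
          by (rule eventually_positive[OF t y(2)]) (simp add: fib nn)
        have c1: "card {z \<in> fibre M (H t) ?w. normal t z \<bullet> normal t y > 0} = 1"
        proof -
          have "{z \<in> fibre M (H t) ?w. normal t z \<bullet> normal t y > 0} = {y}" using fib nn by auto
          then show ?thesis by simp
        qed
        have c2: "card {z \<in> fibre M (H t) ?w. normal t z \<bullet> (- normal t y) > 0} = 0"
        proof -
          have "{z \<in> fibre M (H t) ?w. normal t z \<bullet> (- normal t y) > 0} = {}" using fib nn by auto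
          then show ?thesis by (simp only: card.empty)
        qed
        from e1[unfolded c1] e2[unfolded c2] alexander_numbering_jump[OF num y(1) fib]
        show ?thesis unfolding F_def by eventually_elim simp
      qed
      obtain r where r: "r > 0" "ball q r \<subseteq> B"
        "\<forall>w\<in>ball q r - H t ` M. \<forall>w'\<in>ball q r - H t ` M. F w = F w'"
        by (rule locally_constant_off_image[OF tab gp open_ball q seg jump])
      show ?thesis
      proof (intro exI[of _ "ball q r"] conjI ballI impI)
        show "openin (top_of_set B) (ball q r)" using r(2) open_ball by (rule open_subset)
        show "q \<in> ball q r" using r(1) by simp
        fix x y assume "x \<in> ball q r" "y \<in> ball q r" "x \<notin> H t ` M \<and> y \<notin> H t ` M \<and> F x = F w0"
        then show "F y = F w0" using r(3) by (metis DiffI)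
      qed
    qed
  qed (use w w0 in auto)
  then have "\<forall>w\<in>B - H t ` M. F w = F w0" by blast
  then have "\<forall>w\<in>B - H t ` M. A w = F w0 + real (positive t w)"
    unfolding F_def by (simp add: algebra_simps)
  then show thesis by (rule that)
qed

text \<open>In the octant of a sign function \<open>\<sigma>\<close> the sheets through \<open>w\<close> with \<open>\<sigma> y = 1\<close> contribute one each;
  these contributions amount to \<open>3/2\<close> on average over the eight octants.\<close>
lemma index_of_triple_point:
  assumes t: "t \<in> times" and gen: "generic_immersion M \<A> (H t)" and w: "w \<in> B"
    and K: "\<forall>w\<in>B - H t ` M. A w = K + real (positive t w)" and triple: "w \<in> triple_points M (H t)"
  shows "index M \<A> (H t) A w = K + real (positive t w) + 3/2"
proof -
  let ?F = "fibre M (H t) w"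
  have card: "card ?F = 3" using triple by (simp add: triple_points_def)
  have fin: "finite ?F" using card card.infinite by fastforce
  note gp = generic_immersionD(2)[OF gen, of w]
  have oct: "octant_number M \<A> (H t) A w \<sigma> = K + real (positive t w) + real (card {y \<in> ?F. \<sigma> y = 1})"
    if \<sigma>: "\<sigma> \<in> ?F \<rightarrow>\<^sub>E {-1, 1}" for \<sigma>
  proof -
    let ?c = "K + real (positive t w) + real (card {y \<in> ?F. \<sigma> y = 1})"
    let ?O = "octant M \<A> (H t) w \<sigma>"
    have \<sigma>1: "\<sigma> y = 1 \<or> \<sigma> y = -1" if "y \<in> ?F" for y using PiE_mem[OF \<sigma> that] by auto
    have ev: "\<forall>\<^sub>F e in at_right 0. A (w + e *\<^sub>R v) = ?c" if v: "v \<in> ?O" for v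
    proof -
      have side: "0 < \<sigma> y * (normal t y \<bullet> v)" if "y \<in> ?F" for y
        using v that by (simp add: octant_def inner_commute)
      have nz: "normal t y \<bullet> v \<noteq> 0" if "y \<in> ?F" for y using side[OF that] by auto
      have "normal t y \<bullet> v > 0 \<longleftrightarrow> \<sigma> y = 1" if "y \<in> ?F" for y
        using side[OF that] \<sigma>1[OF that] by auto
      then have eq: "{y \<in> ?F. normal t y \<bullet> v > 0} = {y \<in> ?F. \<sigma> y = 1}" by blast
      have "\<forall>\<^sub>F e in at_right 0. w + e *\<^sub>R v \<in> B - H t ` M \<and>
          positive t (w + e *\<^sub>R v) = positive t w + card {y \<in> ?F. normal t y \<bullet> v > 0}"
        by (rule eventually_positive[OF t w]) (rule nz)
      then show ?thesis unfolding eq by eventually_elim (use K in simp)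
    qed
    have "\<exists>v. v \<in> ?O"
    proof -
      obtain V where V: "V > 0"
        "\<And>c. \<forall>i\<in>?F. \<bar>c i\<bar> \<le> 1 \<Longrightarrow> \<exists>v. norm v \<le> V \<and> (\<forall>i\<in>?F. normal t i \<bullet> v = c i)"
        using bounded_solutions_exist[OF general_positionD[OF gp]] by blast
      have "\<exists>v. norm v \<le> V \<and> (\<forall>i\<in>?F. normal t i \<bullet> v = \<sigma> i)" by (rule V(2)) (use \<sigma>1 in fastforce)
      then obtain v where "\<forall>i\<in>?F. normal t i \<bullet> v = \<sigma> i" by blast
      then have "v \<in> ?O" unfolding octant_def using \<sigma>1 by (fastforce simp: inner_commute)
      then show ?thesis ..
    qed
    then obtain v where v: "v \<in> ?O" ..
    show ?thesis unfolding octant_number_def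
    proof (rule the_equality)
      show "\<forall>v\<in>?O. \<forall>\<^sub>F e in at_right 0. A (w + e *\<^sub>R v) = ?c" using ev by simp
      fix c assume "\<forall>v\<in>?O. \<forall>\<^sub>F e in at_right 0. A (w + e *\<^sub>R v) = c"
      then have "\<forall>\<^sub>F e in at_right 0. A (w + e *\<^sub>R v) = c" using v by simp
      with ev[OF v] have "\<forall>\<^sub>F e in at_right (0::real). c = ?c" by eventually_elim simp
      then show "c = ?c" using eventually_happens'[OF trivial_limit_at_right_real] by blast
    qed
  qed
  have "(\<Sum>\<sigma>\<in>?F \<rightarrow>\<^sub>E {-1, 1}. octant_number M \<A> (H t) A w \<sigma>) =
      (\<Sum>\<sigma>\<in>?F \<rightarrow>\<^sub>E {-1, 1::real}. (K + real (positive t w)) + real (card {y \<in> ?F. \<sigma> y = 1}))"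
    by (rule sum.cong) (use oct in simp_all)
  also have "\<dots> = 8 * (K + real (positive t w)) + 12"
    unfolding sum.distrib sum_sign_functions_card[OF fin] using fin
    by (simp add: card card_PiE)
  finally show ?thesis unfolding index_def by simp
qed

end

section \<open>Numberings at two times near the event\<close>

context local_sheets
begin

lemma card_fibre_le:
  assumes "t \<in> times" "w \<in> B"
  shows "card (fibre M (H t) w) \<le> card I"
proof -
  have "card (fibre M (H t) w) = card {x \<in> I. g x t w = 0}"
    using bij_betw_same_card[OF sheet_point_bij[OF assms]] by simp
  also have "\<dots> \<le> card I" by (rule card_mono[OF finite_I]) blast
  finally show ?thesis .
qed

lemma zero_on_all_sheets:
  assumes "t \<in> times" "w \<in> B" and "card (fibre M (H t) w) = card I"
  shows "\<forall>x\<in>I. g x t w = 0"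
proof -
  have "card {x \<in> I. g x t w = 0} = card I"
    using bij_betw_same_card[OF sheet_point_bij[OF assms(1,2)]] assms(3) by simp
  then have "{x \<in> I. g x t w = 0} = I" by (intro card_subset_eq[OF finite_I]) auto
  then show ?thesis by blast
qed

text \<open>The inverse of the map with components \<open>g i t\<close> is Lipschitz, as for its linear approximation. In
  particular three transverse sheets have at most one common point in the ball.\<close>
lemma distance_from_sheet_values:
  assumes J: "J \<subseteq> I" and C: "C > 0" "\<And>d. norm d \<le> C * (\<Sum>i\<in>J. \<bar>normal t0 i \<bullet> d\<bar>)"
    and small: "C * (real (card J) * \<epsilon>) \<le> 1/2" and t: "t \<in> times" and w: "w \<in> B" "w' \<in> B"
  shows "norm (w - w') \<le> 2 * C * (\<Sum>i\<in>J. \<bar>g i t w - g i t w'\<bar>)"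
proof -
  have "\<bar>normal t0 i \<bullet> (w - w')\<bar> \<le> \<bar>g i t w - g i t w'\<bar> + \<epsilon> * norm (w - w')" if "i \<in> J" for i
    using almost_linear_onD[OF sheet_almost_linear[OF _ t] w, of i] that J by fastforce
  then have "(\<Sum>i\<in>J. \<bar>normal t0 i \<bullet> (w - w')\<bar>) \<le> (\<Sum>i\<in>J. \<bar>g i t w - g i t w'\<bar> + \<epsilon> * norm (w - w'))"
    by (rule sum_mono)
  also have "\<dots> = (\<Sum>i\<in>J. \<bar>g i t w - g i t w'\<bar>) + real (card J) * \<epsilon> * norm (w - w')"
    by (simp add: sum.distrib)
  finally have "C * (\<Sum>i\<in>J. \<bar>normal t0 i \<bullet> (w - w')\<bar>) \<le>
      C * ((\<Sum>i\<in>J. \<bar>g i t w - g i t w'\<bar>) + real (card J) * \<epsilon> * norm (w - w'))"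
    using C(1) by (intro mult_left_mono) auto
  also have "\<dots> = C * (\<Sum>i\<in>J. \<bar>g i t w - g i t w'\<bar>) + (C * (real (card J) * \<epsilon>)) * norm (w - w')"
    by (simp add: algebra_simps)
  also have "\<dots> \<le> C * (\<Sum>i\<in>J. \<bar>g i t w - g i t w'\<bar>) + 1/2 * norm (w - w')"
    using mult_right_mono[OF small norm_ge_zero] by simp
  finally show ?thesis using C(2)[of "w - w'"] by linarith
qed

end

context surface_homotopy
begin

text \<open>A limit of triple points would have three sheets with more than one common point in each
  neighbourhood.\<close>
lemma finite_triple_points:
  assumes t: "t \<in> {a<..<b}" and gen: "generic_immersion M \<A> (H t)"
  shows "finite (triple_points M (H t))"
proof (rule ccontr)
  assume inf: "infinite (triple_points M (H t))"
  have "triple_points M (H t) \<subseteq> H t ` M"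
  proof
    fix q assume "q \<in> triple_points M (H t)"
    then have "card (fibre M (H t) q) = 3" by (simp add: triple_points_def)
    then have "fibre M (H t) q \<noteq> {}" by auto
    then show "q \<in> H t ` M" by (auto simp: fibre_def)
  qed
  moreover have "compact (H t ` M)" by (rule compact_continuous_image[OF continuous_on_homotopy[OF t] compact_M])
  ultimately obtain l where l: "l islimpt triple_points M (H t)"
    using inf Heine_Borel_imp_Bolzano_Weierstrass by blast
  let ?I = "fibre M (H t) l"
  note gp = generic_immersionD(2)[OF gen, of l]
  note fin = general_positionD(1)[OF gp]
  have IM: "openin (top_of_set M) M \<and> x \<in> M" if "x \<in> ?I" for x using that by (simp add: fibre_def)
  obtain C where C: "C > 0" "card ?I = 3 \<Longrightarrow> \<forall>d. norm d \<le> C * (\<Sum>i\<in>?I. \<bar>normal t i \<bullet> d\<bar>)"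
  proof (cases "card ?I = 3")
    case True
    obtain C where "C > 0" "\<And>d. norm d \<le> C * (\<Sum>i\<in>?I. \<bar>normal t i \<bullet> d\<bar>)"
      using norm_le_sum_inner_basis[OF general_positionD[OF gp]] True by auto
    then show ?thesis by (intro that[of C]) auto
  qed (use that[of 1] in simp)
  (* With three sheets, this makes the errors at most half of the distance. *)
  define \<epsilon> where "\<epsilon> = 1 / (6 * C)"
  have \<epsilon>: "\<epsilon> > 0" "C * (real 3 * \<epsilon>) \<le> 1/2" unfolding \<epsilon>_def using C(1) by auto
  obtain \<delta> \<rho> N g where L: "local_sheets M \<A> a b H t l \<epsilon> \<delta> \<rho> N g" and "\<forall>x\<in>?I. N x \<subseteq> M"
    by (rule local_sheets_exist[OF t fin \<epsilon>(1) IM])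
  interpret L: local_sheets M \<A> a b H t l \<epsilon> \<delta> \<rho> N g by (rule L)
  have tT: "t \<in> {t - \<delta><..<t + \<delta>}" using L.\<delta>_pos by simp
  have "w = w'" if w: "w \<in> triple_points M (H t) \<inter> ball l \<rho>" "w' \<in> triple_points M (H t) \<inter> ball l \<rho>" for w w'
  proof -
    have c3: "card (fibre M (H t) w) = 3" "card (fibre M (H t) w') = 3"
      using w by (auto simp: triple_points_def)
    have "card ?I = 3"
      using L.card_fibre_le[OF tT, of w] w c3 generic_immersionD(1)[OF gen, of l] by auto
    then have z: "\<forall>x\<in>?I. g x t w = 0" "\<forall>x\<in>?I. g x t w' = 0"
      using L.zero_on_all_sheets[OF tT, of w] L.zero_on_all_sheets[OF tT, of w'] w c3 by auto
    have "norm (w - w') \<le> 2 * C * (\<Sum>i\<in>?I. \<bar>g i t w - g i t w'\<bar>)"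
      by (rule L.distance_from_sheet_values[OF subset_refl C(1) _ _ tT])
        (use C(2) \<open>card ?I = 3\<close> \<epsilon>(2) w in auto)
    then show ?thesis using z by simp
  qed
  then have sub: "triple_points M (H t) \<inter> ball l \<rho> \<subseteq> {w}" if "w \<in> triple_points M (H t) \<inter> ball l \<rho>" for w
    using that by blast
  have "finite (triple_points M (H t) \<inter> ball l \<rho>)"
  proof (cases "triple_points M (H t) \<inter> ball l \<rho> = {}")
    case False
    then obtain w where "w \<in> triple_points M (H t) \<inter> ball l \<rho>" by blast
    from sub[OF this] show ?thesis by (rule finite_subset) simp
  qed simp
  then show False using l L.\<rho>_pos unfolding islimpt_eq_infinite_ball by blast
qed

end

text \<open>The part of a quadruple-point event that concerns the homotopy, for one choice of the two radii.\<close>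
locale quadruple_event = surface_homotopy M \<A> a b H
  for M :: "'a::t2_space set" and \<A> :: "'a atlas" and a b :: real and H :: "real \<Rightarrow> 'a \<Rightarrow> real^3" +
  fixes \<tau> :: real and p :: "real^3" and D :: "'a \<Rightarrow> 'a set" and r r' :: real
  assumes event_time: "a < \<tau>" "\<tau> < b"
    and generic: "\<And>t. t \<in> {a<..<b} \<Longrightarrow> t \<noteq> \<tau> \<Longrightarrow> generic_immersion M \<A> (H t)"
    and card_Q: "card (fibre M (H \<tau>) p) = 4"
    and triples: "\<And>P. P \<subseteq> fibre M (H \<tau>) p \<Longrightarrow> card P = 3 \<Longrightarrow> general_position \<A> (H \<tau>) P"
    and radii: "0 < r'" "r' < r"
    and inside: "\<And>t x. t \<in> {a<..<b} \<Longrightarrow> x \<in> M \<Longrightarrow> H \<tau> x \<in> cball p r' \<Longrightarrow> H t x \<in> cball p r'"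
    and outside: "\<And>t x. t \<in> {a<..<b} \<Longrightarrow> x \<in> M \<Longrightarrow> H \<tau> x \<notin> cball p r' \<Longrightarrow> H t x = H \<tau> x"
    and disjoint_domains: "disjoint_family_on D (fibre M (H \<tau>) p)"
    and domain: "\<And>i. i \<in> fibre M (H \<tau>) p \<Longrightarrow> i \<in> D i \<and> openin (top_of_set M) (D i)"
    and double: "\<And>q. q \<in> ball p r - {p} \<Longrightarrow>
      card (fibre M (H \<tau>) q) \<le> 2 \<and> general_position \<A> (H \<tau>) (fibre M (H \<tau>) q)"
begin

abbreviation Q :: "'a set" where "Q \<equiv> fibre M (H \<tau>) p"

text \<open>Comparisons of two numberings, for pairs of times near the event on any of its sides. As a
  statement about a product filter it is stable under finite conjunctions.\<close>
definition near_event ::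
  "(real \<Rightarrow> (real^3 \<Rightarrow> real) \<Rightarrow> real \<Rightarrow> (real^3 \<Rightarrow> real) \<Rightarrow> bool) \<Rightarrow> bool" where
  "near_event P \<longleftrightarrow> (\<forall>\<^sub>F (s, t) in at \<tau> \<times>\<^sub>F at \<tau>. \<forall>A A'. alexander_numbering M \<A> (H s) A \<longrightarrow>
     alexander_numbering M \<A> (H t) A' \<longrightarrow> P s A t A')"

lemma near_event_both:
  assumes "\<forall>\<^sub>F t in at \<tau>. \<forall>A. alexander_numbering M \<A> (H t) A \<longrightarrow> R t A"
  shows "near_event (\<lambda>s A t A'. R s A \<and> R t A')"
  using eventually_prodI[OF assms assms] unfolding near_event_def
  by (rule eventually_mono) (simp add: case_prod_beta)

lemma near_event_combine:
  assumes "near_event P" and "near_event P'"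
    and "\<And>s A t A'. P s A t A' \<Longrightarrow> P' s A t A' \<Longrightarrow> R s A t A'"
  shows "near_event R"
  using eventually_conj[OF assms(1,2)[unfolded near_event_def]] unfolding near_event_def
  by (rule eventually_mono) (use assms(3) in \<open>simp add: case_prod_beta\<close>)

lemma near_event_ball_finite:
  assumes "finite S" and "\<And>q. q \<in> S \<Longrightarrow> near_event (P q)"
  shows "near_event (\<lambda>s A t A'. \<forall>q\<in>S. P q s A t A')"
proof -
  have "\<forall>q\<in>S. \<forall>\<^sub>F st in at \<tau> \<times>\<^sub>F at \<tau>. \<forall>A A'. alexander_numbering M \<A> (H (fst st)) A \<longrightarrow>
     alexander_numbering M \<A> (H (snd st)) A' \<longrightarrow> P q (fst st) A (snd st) A'"
    using assms(2)[unfolded near_event_def case_prod_beta] by (rule ballI)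
  from eventually_ball_finite[OF assms(1) this] show ?thesis
    unfolding near_event_def case_prod_beta by (rule eventually_mono) blast
qed

lemma near_event_times:
  assumes "near_event P"
  shows "\<exists>\<delta>>0. \<forall>s\<in>{\<tau> - \<delta><..<\<tau>}. \<forall>t\<in>{\<tau><..<\<tau> + \<delta>}. \<forall>A A'.
    alexander_numbering M \<A> (H s) A \<and> alexander_numbering M \<A> (H t) A' \<longrightarrow> P s A t A'"
proof -
  obtain P1 P2 where P1: "\<forall>\<^sub>F s in at \<tau>. P1 s" and P2: "\<forall>\<^sub>F t in at \<tau>. P2 t"
    and P: "\<And>s t. P1 s \<Longrightarrow> P2 t \<Longrightarrow> \<forall>A A'. alexander_numbering M \<A> (H s) A \<longrightarrow>
     alexander_numbering M \<A> (H t) A' \<longrightarrow> P s A t A'"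
    using assms unfolding near_event_def eventually_prod_filter by auto
  obtain d where d: "d > 0" "\<forall>t\<in>UNIV. t \<noteq> \<tau> \<and> dist t \<tau> < d \<longrightarrow> P1 t \<and> P2 t"
    using eventually_conj[OF P1 P2] unfolding eventually_at by blast
  have "P1 s" if "s \<in> {\<tau> - d<..<\<tau>}" for s using d(2) that by (auto simp: dist_real_def)
  moreover have "P2 t" if "t \<in> {\<tau><..<\<tau> + d}" for t using d(2) that by (auto simp: dist_real_def)
  ultimately show ?thesis using d(1) P by (intro exI[of _ d]) simp
qed

lemma \<tau>_ab: "\<tau> \<in> {a<..<b}"
  using event_time by simp

lemma eventually_ab: "\<forall>\<^sub>F t in at \<tau>. t \<in> {a<..<b}"
  by (rule eventually_at_in_open'[OF open_greaterThanLessThan \<tau>_ab])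

lemma eventually_generic: "\<forall>\<^sub>F t in at \<tau>. t \<in> {a<..<b} \<and> generic_immersion M \<A> (H t)"
proof -
  have "\<forall>\<^sub>F t in at \<tau>. t \<noteq> \<tau>" by (simp add: eventually_at_filter)
  with eventually_ab show ?thesis by eventually_elim (use generic in blast)
qed

lemma other_time: obtains t where "t \<in> {a<..<b}" "t \<noteq> \<tau>"
  using event_time by (intro that[of "(a + \<tau>) / 2"]) auto

lemma fibre_outside:
  assumes t: "t \<in> {a<..<b}" and q: "q \<notin> cball p r'"
  shows "fibre M (H t) q = fibre M (H \<tau>) q"
proof -
  have "H t x = q \<longleftrightarrow> H \<tau> x = q" if x: "x \<in> M" for x
    using inside[OF t x] outside[OF t x] q by (cases "H \<tau> x \<in> cball p r'") auto
  then show ?thesis unfolding fibre_def by blast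
qed

lemma finite_Q: "finite Q"
  using card_Q card.infinite by fastforce

lemma finite_fibre_at_event: "finite (fibre M (H \<tau>) q)"
proof (cases "q = p")
  case False
  show ?thesis
  proof (cases "q \<in> cball p r'")
    case True
    then have "q \<in> ball p r - {p}" using False radii by auto
    from double[OF this] show ?thesis using general_positionD(1) by blast
  next
    case False
    obtain t where t: "t \<in> {a<..<b}" "t \<noteq> \<tau>" by (rule other_time)
    show ?thesis
      using generic_immersionD(2)[OF generic[OF t], of q] general_positionD(1)
      unfolding fibre_outside[OF t(1) False] by blast
  qed
qed (simp add: finite_Q)

lemma local_sheets_at_event:
  assumes "\<epsilon> > 0"
  obtains \<delta> \<rho> N g where "local_sheets M \<A> a b H \<tau> q \<epsilon> \<delta> \<rho> N g"
proof -
  have IM: "openin (top_of_set M) M \<and> x \<in> M" if "x \<in> fibre M (H \<tau>) q" for x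
    using that by (simp add: fibre_def)
  obtain \<delta> \<rho> N g where "local_sheets M \<A> a b H \<tau> q \<epsilon> \<delta> \<rho> N g" "\<forall>x\<in>fibre M (H \<tau>) q. N x \<subseteq> M"
    by (rule local_sheets_exist[OF \<tau>_ab finite_fibre_at_event assms IM])
  then show thesis by (intro that)
qed

text \<open>At \<open>p\<close> itself four sheets meet, which are not in general position; there one passes to another point
  of the neighbourhood.\<close>
lemma complement_dense_at_event:
  assumes U: "open U" "q \<in> U"
  obtains w where "w \<in> U" "w \<notin> H \<tau> ` M"
proof -
  have double_point: "\<exists>w\<in>U. w \<notin> H \<tau> ` M" if "q' \<in> ball p r - {p}" "q' \<in> U" for q'
    using complement_accumulates[OF \<tau>_ab conjunct2[OF double[OF that(1)]] U(1) that(2)] by blast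
  have "\<exists>w\<in>U. w \<notin> H \<tau> ` M"
  proof (cases "q \<in> cball p r'")
    case False
    obtain t where t: "t \<in> {a<..<b}" "t \<noteq> \<tau>" by (rule other_time)
    have "open (U - cball p r')" "q \<in> U - cball p r'" using U False by auto
    then obtain w where w: "w \<in> U - cball p r'" "w \<notin> H t ` M"
      using complement_accumulates[OF t(1) generic_immersionD(2)[OF generic[OF t]]] by blast
    have "fibre M (H t) w = fibre M (H \<tau>) w" by (rule fibre_outside[OF t(1)]) (use w in blast)
    moreover have "fibre M (H t) w = {}" using w(2) by (auto simp: fibre_def)
    ultimately have "fibre M (H \<tau>) w = {}" by simp
    then have "w \<notin> H \<tau> ` M" by (auto simp: fibre_def)
    then show ?thesis using w(1) by blast
  next
    case True
    show ?thesis
    proof (cases "q = p")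
      case False
      then show ?thesis using double_point[of q] True radii U(2) by auto
    next
      case True
      have "open (U \<inter> ball p r)" "p \<in> U \<inter> ball p r" using U True radii by auto
      then have "U \<inter> ball p r \<noteq> {p}" using not_open_singleton by metis
      then obtain q' where "q' \<in> U \<inter> ball p r" "q' \<noteq> p" using \<open>p \<in> U \<inter> ball p r\<close> by blast
      then show ?thesis using double_point[of q'] by blast
    qed
  qed
  then show thesis using that by blast
qed

lemma off_image_stable:
  assumes "w \<notin> H \<tau> ` M"
  shows "\<forall>\<^sub>F t in at \<tau>. w \<notin> H t ` M"
proof -
  have "H \<tau> x \<noteq> w" if "x \<in> M - {}" for x using assms that by blast
  then obtain d \<rho> where d: "d > 0" "\<rho> > 0" "{\<tau> - d<..<\<tau> + d} \<subseteq> {a<..<b}"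
    "\<forall>t\<in>{\<tau> - d<..<\<tau> + d}. \<forall>x\<in>M - {}. H t x \<notin> ball w \<rho>"
    by (rule image_avoids_nearby[OF \<tau>_ab openin_empty])
  have "\<forall>\<^sub>F t in at \<tau>. t \<in> {\<tau> - d<..<\<tau> + d}"
    by (rule eventually_at_in_open'[OF open_greaterThanLessThan]) (use d(1) in simp)
  then show ?thesis
  proof eventually_elim
    case (elim t)
    then have "\<forall>x\<in>M. H t x \<notin> ball w \<rho>" using d(4) by simp
    then show ?case using d(2) centre_in_ball by blast
  qed
qed

text \<open>All images lie in one ball, outside of which every numbering is \<open>- 3/2\<close>.\<close>
lemma numberings_agree_far:
  obtains w where "near_event (\<lambda>s A t A'. A w = A' w)" "w \<notin> H \<tau> ` M"
proof -
  have "compact (H \<tau> ` M)"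
    by (rule compact_continuous_image[OF continuous_on_homotopy[OF \<tau>_ab] compact_M])
  then have "bounded (H \<tau> ` M \<union> cball p r')" by (simp add: compact_imp_bounded)
  then obtain R where "H \<tau> ` M \<union> cball p r' \<subseteq> ball 0 R" using bounded_subset_ballD by blast
  then have R: "H t ` M \<subseteq> ball 0 R" if t: "t \<in> {a<..<b}" for t
    using inside[OF t] outside[OF t] by (smt (verit) Un_iff image_subset_iff subset_iff image_eqI)
  obtain w :: "real^3" where w: "norm w = \<bar>R\<bar> + 1" using vector_choose_size[of "\<bar>R\<bar> + 1"] by auto
  then have wR: "w \<notin> ball 0 R" by simp
  have "\<forall>\<^sub>F t in at \<tau>. \<forall>A. alexander_numbering M \<A> (H t) A \<longrightarrow> A w = - 3/2"
    using eventually_ab by eventually_elim (use alexander_numbering_far[OF _ R wR] in blast)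
  then have near: "near_event (\<lambda>s A t A'. A w = - 3/2 \<and> A' w = - 3/2)" by (rule near_event_both)
  have "near_event (\<lambda>s A t A'. A w = A' w)" by (rule near_event_combine[OF near near]) simp
  moreover have "w \<notin> H \<tau> ` M" using R[OF \<tau>_ab] wR by blast
  ultimately show thesis by (rule that)
qed

lemma eventually_numbering:
  assumes L: "local_sheets M \<A> a b H \<tau> q \<epsilon> \<delta> \<rho> N g" and w: "w \<in> ball q \<rho>" "w \<notin> H \<tau> ` M"
  shows "\<forall>\<^sub>F t in at \<tau>. \<forall>A. alexander_numbering M \<A> (H t) A \<longrightarrow> (\<forall>w'\<in>ball q \<rho> - H t ` M.
    A w' = A w - real (card {x \<in> fibre M (H \<tau>) q. g x \<tau> w > 0}) +
      real (card {x \<in> fibre M (H \<tau>) q. g x t w' > 0}))"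
proof -
  interpret L: local_sheets M \<A> a b H \<tau> q \<epsilon> \<delta> \<rho> N g by (rule L)
  have ev_times: "\<forall>\<^sub>F t in at \<tau>. t \<in> {\<tau> - \<delta><..<\<tau> + \<delta>}"
    by (rule eventually_at_in_open'[OF open_greaterThanLessThan]) (use L.\<delta>_pos in simp)
  show ?thesis
    using eventually_generic ev_times off_image_stable[OF w(2)] L.positive_time_stable[OF w]
  proof eventually_elim
    case (elim t)
    show ?case
    proof (intro allI impI)
      fix A assume A: "alexander_numbering M \<A> (H t) A"
      obtain K where K: "\<forall>w\<in>ball q \<rho> - H t ` M. A w = K + real (L.positive t w)"
        by (rule L.numbering_counts_sheets[OF elim(2) conjunct2[OF elim(1)] A])
      then have "A w = K + real (L.positive \<tau> w)" using w elim by simp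
      with K show "\<forall>w'\<in>ball q \<rho> - H t ` M. A w' = A w - real (card {x \<in> fibre M (H \<tau>) q. g x \<tau> w > 0}) +
          real (card {x \<in> fibre M (H \<tau>) q. g x t w' > 0})"
        by (simp add: L.positive_def)
    qed
  qed
qed

text \<open>The values of a numbering at \<open>w\<close> and at \<open>w'\<close> differ by a difference of counts of sheets. Off the image
  at the time of the event, these counts do not depend on the time near the event.\<close>
lemma numberings_agree_locally:
  assumes L: "local_sheets M \<A> a b H \<tau> q \<epsilon> \<delta> \<rho> N g"
    and w: "w \<in> ball q \<rho>" "w \<notin> H \<tau> ` M" and w': "w' \<in> ball q \<rho>" "w' \<notin> H \<tau> ` M"
    and agree: "near_event (\<lambda>s A t A'. A w = A' w)"
  shows "near_event (\<lambda>s A t A'. A w' = A' w')"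
proof -
  interpret L: local_sheets M \<A> a b H \<tau> q \<epsilon> \<delta> \<rho> N g by (rule L)
  define c where "c = real (L.positive \<tau> w') - real (L.positive \<tau> w)"
  have "\<forall>\<^sub>F t in at \<tau>. \<forall>A. alexander_numbering M \<A> (H t) A \<longrightarrow> A w' = A w + c"
    using eventually_numbering[OF L w] off_image_stable[OF w'(2)] L.positive_time_stable[OF w']
  proof eventually_elim
    case (elim t)
    show ?case
    proof (intro allI impI)
      fix A assume "alexander_numbering M \<A> (H t) A"
      with elim(1) have "\<forall>w'\<in>ball q \<rho> - H t ` M.
          A w' = A w - real (L.positive \<tau> w) + real (L.positive t w')"
        unfolding L.positive_def by blast
      then show "A w' = A w + c" using w' elim(2,3) by (simp add: c_def)
    qed
  qed
  then have "near_event (\<lambda>s A t A'. A w' = A w + c \<and> A' w' = A' w + c)" by (rule near_event_both)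
  from near_event_combine[OF this agree] show ?thesis by simp
qed

text \<open>Agreement spreads from far away over the connected space, since it spreads over a ball around each
  point and the complement of the image is dense.\<close>
lemma numberings_agree_off_image:
  assumes "w \<notin> H \<tau> ` M"
  shows "near_event (\<lambda>s A t A'. A w = A' w)"
proof -
  let ?agree = "\<lambda>w. near_event (\<lambda>s A t A'. A w = A' w)"
  obtain w0 where w0: "?agree w0" "w0 \<notin> H \<tau> ` M" by (rule numberings_agree_far)
  show ?thesis
  proof (rule connected_induction[of UNIV "\<lambda>w. w \<notin> H \<tau> ` M" ?agree w0 w])
    show "connected (UNIV :: (real^3) set)" by (rule convex_connected[OF convex_UNIV])
    show "\<exists>z. z \<in> T \<and> z \<notin> H \<tau> ` M" if "openin (top_of_set UNIV) T" "q \<in> T" for T q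
    proof -
      have "open T" using that(1) by simp
      from complement_dense_at_event[OF this that(2)] show ?thesis by blast
    qed
    show "\<exists>T. openin (top_of_set UNIV) T \<and> q \<in> T \<and>
        (\<forall>x\<in>T. \<forall>y\<in>T. x \<notin> H \<tau> ` M \<and> y \<notin> H \<tau> ` M \<and> ?agree x \<longrightarrow> ?agree y)" for q
    proof -
      obtain \<delta> \<rho> N g where L: "local_sheets M \<A> a b H \<tau> q 1 \<delta> \<rho> N g"
        by (rule local_sheets_at_event[OF zero_less_one])
      have "q \<in> ball q \<rho>" using local_sheets.\<rho>_pos[OF L] by simp
      moreover have "openin (top_of_set UNIV) (ball q \<rho>)" by simp
      ultimately show ?thesis
        using numberings_agree_locally[OF L] by (intro exI[of _ "ball q \<rho>"]) auto
    qed
  qed (use w0 assms in auto)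
qed

text \<open>The local constants of two numberings are compared at one point off the image at the time of the
  event, where both the numberings and the counts agree.\<close>
lemma common_constant:
  assumes L: "local_sheets M \<A> a b H \<tau> q \<epsilon> \<delta> \<rho> N g"
  shows "near_event (\<lambda>s A t A'. \<exists>K.
     (\<forall>w\<in>ball q \<rho> - H s ` M. A w = K + real (card {x \<in> fibre M (H \<tau>) q. g x s w > 0})) \<and>
     (\<forall>w\<in>ball q \<rho> - H t ` M. A' w = K + real (card {x \<in> fibre M (H \<tau>) q. g x t w > 0})))"
proof -
  have "q \<in> ball q \<rho>" using local_sheets.\<rho>_pos[OF L] by simp
  then obtain w where w: "w \<in> ball q \<rho>" "w \<notin> H \<tau> ` M"
    using complement_dense_at_event[OF open_ball] by blast
  let ?c = "real (card {x \<in> fibre M (H \<tau>) q. g x \<tau> w > 0})"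
  show ?thesis
  proof (rule near_event_combine[OF near_event_both[OF eventually_numbering[OF L w]] numberings_agree_off_image[OF w(2)]])
    fix s A t A'
    assume "(\<forall>w'\<in>ball q \<rho> - H s ` M. A w' = A w - ?c + real (card {x \<in> fibre M (H \<tau>) q. g x s w' > 0})) \<and>
        (\<forall>w'\<in>ball q \<rho> - H t ` M. A' w' = A' w - ?c + real (card {x \<in> fibre M (H \<tau>) q. g x t w' > 0}))"
      and "A w = A' w"
    then show "\<exists>K. (\<forall>w\<in>ball q \<rho> - H s ` M. A w = K + real (card {x \<in> fibre M (H \<tau>) q. g x s w > 0})) \<and>
        (\<forall>w\<in>ball q \<rho> - H t ` M. A' w = K + real (card {x \<in> fibre M (H \<tau>) q. g x t w > 0}))"
      by (intro exI[of _ "A w - ?c"]) simp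
  qed
qed

end

section \<open>Simplices and four almost linear functions\<close>

text \<open>The points \<open>v i\<close> are the images of the vertices. The points \<open>w i\<close> are images of relative interior points of
  the faces; two distinct faces of a simplex meet in a proper face of each, which misses the relative
  interior.\<close>
lemma tetrahedron_vertices_and_faces:
  assumes tet: "tetrahedron M S Q D \<Delta>" and card: "card Q \<ge> 2"
  obtains v w where "\<forall>i\<in>Q. v i \<in> closure \<Delta> \<and> (\<forall>k\<in>Q - {i}. v i \<in> S ` D k)"
    "\<forall>i\<in>Q. w i \<in> closure \<Delta> \<and> w i \<in> S ` D i \<and> (\<forall>k\<in>Q - {i}. w i \<notin> S ` D k)"
proof -
  obtain u :: "'a \<Rightarrow> real^3" and h h' where
    "inj_on u Q \<and> \<not> affine_dependent (u ` Q) \<and>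
      homeomorphism (convex hull (u ` Q)) (closure \<Delta>) h h' \<and>
      h ` interior (convex hull (u ` Q)) = \<Delta> \<and>
      (\<forall>i\<in>Q. h ` (convex hull (u ` (Q - {i}))) = closure \<Delta> \<inter> S ` D i)"
    using tet[unfolded tetrahedron_def, THEN conjunct2] by (elim exE)
  then have u: "inj_on u Q" "\<not> affine_dependent (u ` Q)"
    and h: "homeomorphism (convex hull (u ` Q)) (closure \<Delta>) h h'"
    and faces: "\<forall>i\<in>Q. h ` (convex hull (u ` (Q - {i}))) = closure \<Delta> \<inter> S ` D i"
    by simp_all
  let ?T = "convex hull (u ` Q)" and ?F = "\<lambda>i. convex hull (u ` (Q - {i}))"
  have "h' (h y) = y" if "y \<in> ?T" for y using homeomorphism_apply1[OF h that] .
  then have inj: "inj_on h ?T" by (rule inj_on_inverseI)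
  have face: "?F i face_of ?T" for i
    unfolding face_of_convex_hull_affine_independent[OF u(2)]
    by (intro exI[of _ "u ` (Q - {i})"]) auto
  have sub: "?F i \<subseteq> ?T" for i using face face_of_imp_subset by blast
  have vertex_on: "u i \<in> ?F k" if "i \<in> Q" "k \<noteq> i" for i k using that by (auto intro: hull_inc)
  have vertex_off: "u k \<notin> ?F k" if k: "k \<in> Q" for k
  proof
    assume "u k \<in> ?F k"
    moreover have "u ` (Q - {k}) = u ` Q - {u k}" using u(1) k by (subst inj_on_image_set_diff[OF u(1)]) auto
    ultimately have "u k \<in> affine hull (u ` Q - {u k})"
      using convex_hull_subset_affine_hull by fastforce
    then show False using u(2) k unfolding affine_dependent_def by blast
  qed
  have "\<exists>x. x \<in> ?F i \<and> (\<forall>k\<in>Q - {i}. x \<notin> ?F k)" if i: "i \<in> Q" for i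
  proof -
    have "Q - {i} \<noteq> {}"
    proof
      assume "Q - {i} = {}"
      then have "card Q \<le> card {i}" by (intro card_mono) auto
      then show False using card by simp
    qed
    then have "rel_interior (?F i) \<noteq> {}" by (simp add: rel_interior_eq_empty)
    then obtain x where x: "x \<in> rel_interior (?F i)" by blast
    have "x \<notin> ?F k" if k: "k \<in> Q - {i}" for k
    proof -
      have "?F i \<inter> ?F k face_of ?F i"
        by (rule face_of_subset[OF face_of_Int[OF face face]]) (use sub in blast)+
      moreover have "?F i \<inter> ?F k \<noteq> ?F i" using vertex_on[of k i] vertex_off[of k] k by blast
      ultimately have "(?F i \<inter> ?F k) \<inter> rel_interior (?F i) = {}" by (rule face_of_disjoint_rel_interior)
      then show ?thesis using x rel_interior_subset by blast
    qed
    then show ?thesis using x rel_interior_subset by blast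
  qed
  then have "\<forall>i\<in>Q. \<exists>x. x \<in> ?F i \<and> (\<forall>k\<in>Q - {i}. x \<notin> ?F k)" by blast
  from bchoice[OF this] obtain x where
    x: "\<And>i. i \<in> Q \<Longrightarrow> x i \<in> ?F i \<and> (\<forall>k\<in>Q - {i}. x i \<notin> ?F k)" by blast
  show thesis
  proof (rule that[of "\<lambda>i. h (u i)" "\<lambda>i. h (x i)"])
    show "\<forall>i\<in>Q. h (u i) \<in> closure \<Delta> \<and> (\<forall>k\<in>Q - {i}. h (u i) \<in> S ` D k)"
    proof (intro ballI conjI)
      fix i assume i: "i \<in> Q"
      have "u i \<in> ?T" using i by (auto intro: hull_inc)
      then show "h (u i) \<in> closure \<Delta>" using homeomorphism_image1[OF h] by blast
      fix k assume k: "k \<in> Q - {i}"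
      then have "h (u i) \<in> h ` ?F k" using vertex_on[OF i] by blast
      then show "h (u i) \<in> S ` D k" using faces k by blast
    qed
    show "\<forall>i\<in>Q. h (x i) \<in> closure \<Delta> \<and> h (x i) \<in> S ` D i \<and> (\<forall>k\<in>Q - {i}. h (x i) \<notin> S ` D k)"
    proof (intro ballI conjI notI)
      fix i assume i: "i \<in> Q"
      have "h (x i) \<in> h ` ?F i" using x[OF i] by blast
      then show hx: "h (x i) \<in> closure \<Delta>" "h (x i) \<in> S ` D i" using faces i by blast+
      fix k assume k: "k \<in> Q - {i}" and "h (x i) \<in> S ` D k"
      then have "h (x i) \<in> h ` ?F k" using faces hx(1) by blast
      then obtain z where z: "z \<in> ?F k" "h (x i) = h z" by blast
      have "x i = z" by (rule inj_onD[OF inj z(2)]) (use x[OF i] z(1) sub in blast)+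
      then show False using x[OF i] k z(1) by blast
    qed
  qed
qed

context local_sheets
begin

text \<open>For linear functions, \<open>\<Sum>j. l j * g j\<close> would be constant, with value \<open>l i * g i (v i)\<close> at the vertex \<open>v i\<close>.
  Here it varies between two vertices by at most a small multiple of their distance, which in turn is
  at most a multiple of the height of either.\<close>
lemma vertex_heights_aligned:
  assumes C: "C > 0" "\<And>x d. x \<in> I \<Longrightarrow> norm d \<le> C * (\<Sum>j\<in>I - {x}. \<bar>normal t0 j \<bullet> d\<bar>)"
    and small: "\<And>x. x \<in> I \<Longrightarrow> C * (real (card (I - {x})) * \<epsilon>) \<le> 1/2" and \<epsilon>: "\<epsilon> \<ge> 0"
    and l: "(\<Sum>i\<in>I. l i *\<^sub>R normal t0 i) = 0"
      "\<And>i. i \<in> I \<Longrightarrow> 2 * C * \<epsilon> * (\<Sum>i\<in>I. \<bar>l i\<bar>) < \<bar>l i\<bar>"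
    and t: "t \<in> times" and v: "\<And>i. i \<in> I \<Longrightarrow> v i \<in> B"
      "\<And>i k. i \<in> I \<Longrightarrow> k \<in> I - {i} \<Longrightarrow> g k t (v i) = 0" "\<And>i. i \<in> I \<Longrightarrow> g i t (v i) \<noteq> 0"
    and ik: "i \<in> I" "k \<in> I"
  shows "l i * g i t (v i) > 0 \<longleftrightarrow> l k * g k t (v k) > 0"
proof (cases "i = k")
  case False
  let ?d = "v i - v k" and ?h = "\<lambda>i. g i t (v i)"
  have "(\<Sum>j\<in>I - {k}. \<bar>g j t (v i) - g j t (v k)\<bar>) = (\<Sum>j\<in>I - {k}. if j = i then \<bar>?h i\<bar> else 0)"
    by (rule sum.cong) (use v(2) ik in auto)
  also have "\<dots> = \<bar>?h i\<bar>" using finite_I ik False by simp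
  finally have s1: "(\<Sum>j\<in>I - {k}. \<bar>g j t (v i) - g j t (v k)\<bar>) = \<bar>?h i\<bar>" .
  have "norm ?d \<le> 2 * C * (\<Sum>j\<in>I - {k}. \<bar>g j t (v i) - g j t (v k)\<bar>)"
    by (rule distance_from_sheet_values[OF Diff_subset C(1) C(2)[OF ik(2)] small[OF ik(2)] t v(1)[OF ik(1)] v(1)[OF ik(2)]])
  then have d: "norm ?d \<le> 2 * C * \<bar>?h i\<bar>" unfolding s1 .
  define err where "err j = g j t (v i) - g j t (v k) - normal t0 j \<bullet> ?d" for j
  have err: "\<bar>err j\<bar> \<le> \<epsilon> * norm ?d" if "j \<in> I" for j
    unfolding err_def by (rule almost_linear_onD[OF sheet_almost_linear[OF that t] v(1)[OF ik(1)] v(1)[OF ik(2)]])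
  have "(\<Sum>j\<in>I. l j * (normal t0 j \<bullet> ?d)) = (\<Sum>j\<in>I. l j *\<^sub>R normal t0 j) \<bullet> ?d"
    by (simp add: inner_sum_left)
  then have rel: "(\<Sum>j\<in>I. l j * (normal t0 j \<bullet> ?d)) = 0" using l(1) by simp
  have "(\<Sum>j\<in>I. l j * err j) =
      (\<Sum>j\<in>I. l j * (g j t (v i) - g j t (v k))) - (\<Sum>j\<in>I. l j * (normal t0 j \<bullet> ?d))"
    unfolding err_def by (simp add: algebra_simps sum.distrib sum_subtractf)
  also have "\<dots> = (\<Sum>j\<in>I. l j * (g j t (v i) - g j t (v k)))" using rel by simp
  also have "\<dots> = (\<Sum>j\<in>I. (if j = i then l i * ?h i else 0) - (if j = k then l k * ?h k else 0))"
    by (rule sum.cong) (use v(2) ik False in auto)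
  also have "\<dots> = l i * ?h i - l k * ?h k"
    using finite_I ik by (simp add: sum_subtractf)
  finally have "\<bar>l i * ?h i - l k * ?h k\<bar> = \<bar>\<Sum>j\<in>I. l j * err j\<bar>" by simp
  also have "\<dots> \<le> (\<Sum>j\<in>I. \<bar>l j\<bar> * (\<epsilon> * norm ?d))"
    by (rule order_trans[OF sum_abs]) (auto simp: abs_mult intro!: sum_mono mult_left_mono err)
  also have "\<dots> = (\<Sum>j\<in>I. \<bar>l j\<bar>) * (\<epsilon> * norm ?d)" by (simp add: sum_distrib_right)
  also have "\<dots> \<le> (\<Sum>j\<in>I. \<bar>l j\<bar>) * (\<epsilon> * (2 * C * \<bar>?h i\<bar>))"
    using d \<epsilon> by (intro mult_left_mono) (auto simp: sum_nonneg)
  also have "\<dots> = (2 * C * \<epsilon> * (\<Sum>j\<in>I. \<bar>l j\<bar>)) * \<bar>?h i\<bar>" by (simp add: algebra_simps)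
  also have "\<dots> < \<bar>l i\<bar> * \<bar>?h i\<bar>" using l(2)[OF ik(1)] v(3)[OF ik(1)] by (intro mult_strict_right_mono) auto
  finally have "\<bar>l i * ?h i - l k * ?h k\<bar> < \<bar>l i * ?h i\<bar>" by (simp add: abs_mult)
  then show ?thesis by linarith
qed simp

text \<open>Near a simple point the side of a sheet is one sign region, so it belongs to one component.\<close>
lemma one_side_region:
  assumes t: "t \<in> times" and i: "i \<in> I" and unit: "norm (normal t0 i) = 1" and \<epsilon>: "0 \<le> \<epsilon>" "\<epsilon> \<le> 1/2"
    and u: "u \<in> B" "\<forall>k\<in>I - {i}. g k t u \<noteq> 0" and R: "R \<in> components (- H t ` M)"
  obtains r where "r > 0"
    "\<forall>w\<in>ball u r. \<forall>w'\<in>ball u r. g i t w < 0 \<longrightarrow> g i t w' < 0 \<longrightarrow> w \<in> R \<longrightarrow> w' \<in> R"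
proof -
  have "\<forall>\<^sub>F w in nhds u. g k t w \<noteq> 0" if k: "k \<in> I - {i}" for k
  proof -
    have "isCont (g k t) u"
      using sheet_continuous[OF _ t] k continuous_on_eq_continuous_at[OF open_ball] u(1) by blast
    then have "(g k t \<longlongrightarrow> g k t u) (nhds u)"
      unfolding isCont_def by (subst tendsto_at_iff_tendsto_nhds[symmetric])
    then show ?thesis using u(2) k by (intro tendsto_imp_eventually_ne) auto
  qed
  then have "\<forall>k\<in>I - {i}. \<forall>\<^sub>F w in nhds u. g k t w \<noteq> 0" by blast
  then have "\<forall>\<^sub>F w in nhds u. \<forall>k\<in>I - {i}. g k t w \<noteq> 0"
    using finite_I by (simp add: eventually_ball_finite_distrib)
  from eventually_conj[OF this eventually_nhds_in_open[OF open_ball u(1)]]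
  obtain \<rho>1 where \<rho>1: "\<rho>1 > 0" "\<And>w. dist w u < \<rho>1 \<Longrightarrow> (\<forall>k\<in>I - {i}. g k t w \<noteq> 0) \<and> w \<in> B"
    unfolding eventually_nhds_metric by blast
  have in1: "(\<forall>k\<in>I - {i}. g k t w \<noteq> 0) \<and> w \<in> B" if "w \<in> ball u \<rho>1" for w
    using \<rho>1(2)[of w] that by (simp add: dist_commute)
  have al: "almost_linear_on (ball u \<rho>1) \<epsilon> (g i t) (normal t0 i)"
    by (rule almost_linear_on_subset[OF sheet_almost_linear[OF i t]]) (use in1 in blast)
  have seg: "(w1 \<in> R) = (w2 \<in> R)"
    if s: "closed_segment w1 w2 \<subseteq> {w \<in> ball u \<rho>1. \<forall>x\<in>{i}. g i t w \<noteq> 0}" for w1 w2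
  proof -
    have "closed_segment w1 w2 \<subseteq> - H t ` M"
    proof
      fix w assume "w \<in> closed_segment w1 w2"
      then have "w \<in> ball u \<rho>1" "g i t w \<noteq> 0" using s by blast+
      then show "w \<in> - H t ` M" using in1[of w] image_iff_zero[OF t, of w] by blast
    qed
    then have "closed_segment w1 w2 \<subseteq> R" if "R \<inter> closed_segment w1 w2 \<noteq> {}"
      using components_maximal[OF R connected_segment(1)] that by blast
    then show ?thesis using ends_in_segment by blast
  qed
  show thesis
  proof (rule that[of "\<rho>1 / 10"])
    show "\<rho>1 / 10 > 0" using \<rho>1(1) by simp
    show "\<forall>w\<in>ball u (\<rho>1 / 10). \<forall>w'\<in>ball u (\<rho>1 / 10). g i t w < 0 \<longrightarrow> g i t w' < 0 \<longrightarrow> w \<in> R \<longrightarrow> w' \<in> R"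
    proof (intro ballI impI)
      fix w w' assume w: "w \<in> ball u (\<rho>1 / 10)" "w' \<in> ball u (\<rho>1 / 10)" "g i t w < 0" "g i t w' < 0" "w \<in> R"
      have "(w \<in> R) = (w' \<in> R)"
      proof (rule constant_on_sign_region[where I = "{i}" and c = "normal t0" and v = "- normal t0 i"
            and V = 1 and \<sigma> = "\<lambda>_. -1" and \<epsilon> = \<epsilon> and q = u and \<rho> = \<rho>1 and g = "\<lambda>_. g i t" and \<rho>' = "\<rho>1 / 10"])
        show "(w1 \<in> R) = (w2 \<in> R)" if "closed_segment w1 w2 \<subseteq> {w \<in> ball u \<rho>1. \<forall>x\<in>{i}. g i t w \<noteq> 0}" for w1 w2
          by (rule seg[OF that])
      qed (use w unit \<epsilon> al \<rho>1(1) in \<open>simp_all add: dot_square_norm\<close>)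
      then show "w' \<in> R" using w(5) by simp
    qed
  qed
qed

end

section \<open>The four sheets at the quadruple point\<close>

lemma local_sheets_shrink:
  assumes L: "local_sheets M \<A> a b H t0 q0 \<epsilon> \<delta> \<rho> N g" and \<rho>': "0 < \<rho>'" "\<rho>' \<le> \<rho>"
  shows "local_sheets M \<A> a b H t0 q0 \<epsilon> \<delta> \<rho>' N g"
proof -
  interpret L: local_sheets M \<A> a b H t0 q0 \<epsilon> \<delta> \<rho> N g by (rule L)
  show ?thesis
  proof (intro local_sheets.intro local_sheets_axioms.intro)
    show "surface_homotopy M \<A> a b H" by (rule L.surface_homotopy_axioms)
    show "L.sheet_function t0 x \<epsilon> \<delta> \<rho>' (N x) (g x)" if "x \<in> fibre M (H t0) q0" for x
      by (rule L.sheet_function_shrink[OF L.sheets[OF that] L.\<delta>_pos order_refl \<rho>'(2)])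
    show "\<exists>x\<in>fibre M (H t0) q0. y \<in> N x"
      if "t \<in> {t0 - \<delta><..<t0 + \<delta>}" "y \<in> M" "H t y \<in> ball q0 \<rho>'" for t y
      by (rule L.covered[OF that(1,2)]) (use that(3) \<rho>'(2) in auto)
  qed (fact L.finite_I L.\<delta>_pos \<rho>'(1) L.times L.disjoint_sheets)+
qed

context quadruple_event
begin

lemma triple_points_outside:
  assumes t: "t \<in> {a<..<b}"
  shows "triple_points M (H t) - cball p r' = triple_points M (H \<tau>)"
proof -
  have "q \<notin> cball p r'" if "q \<in> triple_points M (H \<tau>)" for q
  proof
    assume "q \<in> cball p r'"
    moreover have c: "card (fibre M (H \<tau>) q) = 3" using that by (simp add: triple_points_def)
    then have "q \<noteq> p" using card_Q by auto
    ultimately have "q \<in> ball p r - {p}" using radii by auto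
    from double[OF this] show False using c by simp
  qed
  then show ?thesis using fibre_outside[OF t] unfolding triple_points_def by auto
qed

lemma finite_triple_points_at_event: "finite (triple_points M (H \<tau>))"
proof -
  obtain t where t: "t \<in> {a<..<b}" "t \<noteq> \<tau>" by (rule other_time)
  show ?thesis
    unfolding triple_points_outside[OF t(1), symmetric]
    by (rule finite_Diff[OF finite_triple_points[OF t(1) generic[OF t]]])
qed

text \<open>At the time of the event no point of the annulus has more than two preimages. By compactness this
  persists, because the number of preimages is upper semicontinuous in time and space.\<close>
lemma eventually_no_triple_in_annulus:
  assumes r0: "r0 > 0"
  shows "\<forall>\<^sub>F t in at \<tau>. \<forall>q\<in>cball p r' - ball p r0. card (fibre M (H t) q) \<noteq> 3"
proof -
  let ?K = "cball p r' - ball p r0"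
  have "\<exists>\<rho> \<delta>. \<rho> > 0 \<and> \<delta> > 0 \<and>
      (\<forall>t\<in>{\<tau> - \<delta><..<\<tau> + \<delta>}. \<forall>w\<in>ball q \<rho>. card (fibre M (H t) w) \<noteq> 3)" if q: "q \<in> ?K" for q
  proof -
    obtain \<delta> \<rho> N g where L: "local_sheets M \<A> a b H \<tau> q 1 \<delta> \<rho> N g"
      by (rule local_sheets_at_event[OF zero_less_one])
    interpret L: local_sheets M \<A> a b H \<tau> q 1 \<delta> \<rho> N g by (rule L)
    have "q \<in> ball p r - {p}" using q r0 radii by auto
    then have c: "card (fibre M (H \<tau>) q) \<le> 2" using double by blast
    have "card (fibre M (H t) w) \<noteq> 3" if "t \<in> {\<tau> - \<delta><..<\<tau> + \<delta>}" "w \<in> ball q \<rho>" for t w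
      using L.card_fibre_le[OF that] c by simp
    then show ?thesis using L.\<rho>_pos L.\<delta>_pos by blast
  qed
  then have "\<forall>q\<in>?K. \<exists>\<rho> \<delta>. \<rho> > 0 \<and> \<delta> > 0 \<and>
      (\<forall>t\<in>{\<tau> - \<delta><..<\<tau> + \<delta>}. \<forall>w\<in>ball q \<rho>. card (fibre M (H t) w) \<noteq> 3)" by (rule ballI)
  from bchoice[OF this] obtain \<rho> where "\<forall>q\<in>?K. \<exists>\<delta>. \<rho> q > 0 \<and> \<delta> > 0 \<and>
      (\<forall>t\<in>{\<tau> - \<delta><..<\<tau> + \<delta>}. \<forall>w\<in>ball q (\<rho> q). card (fibre M (H t) w) \<noteq> 3)" by (elim exE)
  from bchoice[OF this] obtain \<delta> where \<rho>\<delta>: "\<forall>q\<in>?K. \<rho> q > 0 \<and> \<delta> q > 0 \<and>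
      (\<forall>t\<in>{\<tau> - \<delta> q<..<\<tau> + \<delta> q}. \<forall>w\<in>ball q (\<rho> q). card (fibre M (H t) w) \<noteq> 3)" by (elim exE)
  have "compact ?K" by (rule compact_diff) auto
  then obtain F where F: "F \<subseteq> ?K" "finite F" "?K \<subseteq> (\<Union>q\<in>F. ball q (\<rho> q))"
    by (rule compactE_image[of ?K ?K "\<lambda>q. ball q (\<rho> q)"]) (use \<rho>\<delta> in auto)
  have "\<forall>\<^sub>F t in at \<tau>. t \<in> {\<tau> - \<delta> q<..<\<tau> + \<delta> q}" if "q \<in> F" for q
    by (rule eventually_at_in_open'[OF open_greaterThanLessThan]) (use \<rho>\<delta> F(1) that in auto)
  then have "\<forall>q\<in>F. \<forall>\<^sub>F t in at \<tau>. t \<in> {\<tau> - \<delta> q<..<\<tau> + \<delta> q}" by (rule ballI)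
  then have "\<forall>\<^sub>F t in at \<tau>. \<forall>q\<in>F. t \<in> {\<tau> - \<delta> q<..<\<tau> + \<delta> q}"
    using F(2) by (simp only: eventually_ball_finite_distrib)
  then show ?thesis
  proof eventually_elim
    case (elim t)
    show ?case
    proof
      fix w assume "w \<in> ?K"
      then obtain q where q: "q \<in> F" "w \<in> ball q (\<rho> q)" using F(3) by blast
      then show "card (fibre M (H t) w) \<noteq> 3" using \<rho>\<delta> F(1) elim by blast
    qed
  qed
qed

text \<open>All sheets nearby pass through the triple point, so no sheet has it on its positive side, and its
  index is the local constant plus \<open>3/2\<close>.\<close>
lemma index_constant_outside:
  assumes q: "q \<in> triple_points M (H \<tau>)"
  shows "near_event (\<lambda>s A t A'. index M \<A> (H s) A q = index M \<A> (H t) A' q)"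
proof -
  obtain \<delta> \<rho> N g where L: "local_sheets M \<A> a b H \<tau> q 1 \<delta> \<rho> N g"
    by (rule local_sheets_at_event[OF zero_less_one])
  interpret L: local_sheets M \<A> a b H \<tau> q 1 \<delta> \<rho> N g by (rule L)
  have qB: "q \<in> ball q \<rho>" using L.\<rho>_pos by simp
  have card3: "card (fibre M (H \<tau>) q) = 3" using q by (simp add: triple_points_def)
  have ind: "index M \<A> (H t) A q = K + 3/2"
    if t: "t \<in> {\<tau> - \<delta><..<\<tau> + \<delta>}" "t \<noteq> \<tau>"
      and K: "\<forall>w\<in>ball q \<rho> - H t ` M. A w = K + real (L.positive t w)" for t A K
  proof -
    have tab: "t \<in> {a<..<b}" by (rule L.times_subset[OF t(1)])
    have qt: "q \<in> triple_points M (H t)" using triple_points_outside[OF tab] q by blast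
    then have "card (fibre M (H t) q) = card (fibre M (H \<tau>) q)"
      using card3 by (simp add: triple_points_def)
    from L.zero_on_all_sheets[OF t(1) qB this] have "{x \<in> fibre M (H \<tau>) q. g x t q > 0} = {}" by auto
    then have "L.positive t q = 0" unfolding L.positive_def by (simp only: card.empty)
    then show ?thesis using L.index_of_triple_point[OF t(1) generic[OF tab t(2)] qB K qt] by simp
  qed
  have "\<forall>\<^sub>F t in at \<tau>. t \<in> {\<tau> - \<delta><..<\<tau> + \<delta>}"
    by (rule eventually_at_in_open'[OF open_greaterThanLessThan]) (use L.\<delta>_pos in simp)
  moreover have "\<forall>\<^sub>F t in at \<tau>. t \<noteq> \<tau>" by (simp add: eventually_at_filter)
  ultimately have "\<forall>\<^sub>F t in at \<tau>. \<forall>A. alexander_numbering M \<A> (H t) A \<longrightarrow> t \<in> {\<tau> - \<delta><..<\<tau> + \<delta>} \<and> t \<noteq> \<tau>"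
    by eventually_elim simp
  from near_event_both[OF this] common_constant[OF L, folded L.positive_def]
  show ?thesis
  proof (rule near_event_combine)
    fix s A t A'
    assume times: "(s \<in> {\<tau> - \<delta><..<\<tau> + \<delta>} \<and> s \<noteq> \<tau>) \<and> (t \<in> {\<tau> - \<delta><..<\<tau> + \<delta>} \<and> t \<noteq> \<tau>)"
      and "\<exists>K. (\<forall>w\<in>ball q \<rho> - H s ` M. A w = K + real (L.positive s w)) \<and>
        (\<forall>w\<in>ball q \<rho> - H t ` M. A' w = K + real (L.positive t w))"
    then obtain K where K: "\<forall>w\<in>ball q \<rho> - H s ` M. A w = K + real (L.positive s w)"
      "\<forall>w\<in>ball q \<rho> - H t ` M. A' w = K + real (L.positive t w)" by (elim exE conjE) (rule that)
    show "index M \<A> (H s) A q = index M \<A> (H t) A' q"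
      using ind[OF _ _ K(1)] ind[OF _ _ K(2)] times by simp
  qed
qed

lemma indices_constant_outside:
  "near_event (\<lambda>s A t A'. (\<Sum>q\<in>triple_points M (H \<tau>). index M \<A> (H s) A q) =
     (\<Sum>q\<in>triple_points M (H \<tau>). index M \<A> (H t) A' q))"
proof -
  have all: "near_event (\<lambda>s A t A'. \<forall>q\<in>triple_points M (H \<tau>).
      index M \<A> (H s) A q = index M \<A> (H t) A' q)"
    by (rule near_event_ball_finite[OF finite_triple_points_at_event]) (rule index_constant_outside)
  show ?thesis
    by (rule near_event_combine[OF all all]) (auto intro!: sum.cong)
qed

lemma normals_triple_independent:
  assumes "x \<in> Q"
  shows "inj_on (normal \<tau>) (Q - {x})" "independent (normal \<tau> ` (Q - {x}))"
proof -
  have "card (Q - {x}) = 3" using card_Q assms finite_Q by simp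
  from general_positionD[OF triples[OF Diff_subset this]]
  show "inj_on (normal \<tau>) (Q - {x})" "independent (normal \<tau> ` (Q - {x}))" by blast+
qed

lemma normals_inj: "inj_on (normal \<tau>) Q"
proof (rule inj_onI)
  fix x y assume xy: "x \<in> Q" "y \<in> Q" "normal \<tau> x = normal \<tau> y"
  have "card {x, y} < card Q" using card_Q card_insert_le_m1[of 2 "{y}" x] by simp
  then have "\<not> Q \<subseteq> {x, y}" using card_mono[of "{x, y}" Q] by auto
  then obtain z where "z \<in> Q" "z \<noteq> x" "z \<noteq> y" by blast
  then show "x = y" using inj_onD[OF normals_triple_independent(1)[of z] xy(3)] xy by blast
qed

lemma normals_uniformly_spanning:
  obtains C where "C > 0" "\<forall>x\<in>Q. \<forall>d. norm d \<le> C * (\<Sum>j\<in>Q - {x}. \<bar>normal \<tau> j \<bullet> d\<bar>)"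
proof -
  have "\<exists>C. C > 0 \<and> (\<forall>d. norm d \<le> C * (\<Sum>j\<in>Q - {x}. \<bar>normal \<tau> j \<bullet> d\<bar>))" if x: "x \<in> Q" for x
  proof -
    have "card (Q - {x}) = DIM(real^3)" using card_Q x finite_Q by simp
    from norm_le_sum_inner_basis[OF finite_Diff[OF finite_Q] normals_triple_independent[OF x] this]
    show ?thesis by metis
  qed
  then have "\<forall>x\<in>Q. \<exists>C. C > 0 \<and> (\<forall>d. norm d \<le> C * (\<Sum>j\<in>Q - {x}. \<bar>normal \<tau> j \<bullet> d\<bar>))" by (rule ballI)
  from bchoice[OF this] obtain C where
    C: "\<forall>x\<in>Q. C x > 0 \<and> (\<forall>d. norm d \<le> C x * (\<Sum>j\<in>Q - {x}. \<bar>normal \<tau> j \<bullet> d\<bar>))" by (elim exE)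
  have Q: "Q \<noteq> {}" using card_Q by auto
  show thesis
  proof (rule that[of "\<Sum>x\<in>Q. C x"])
    show "(\<Sum>x\<in>Q. C x) > 0" by (rule sum_pos[OF finite_Q Q]) (use C in blast)
    show "\<forall>x\<in>Q. \<forall>d. norm d \<le> (\<Sum>x\<in>Q. C x) * (\<Sum>j\<in>Q - {x}. \<bar>normal \<tau> j \<bullet> d\<bar>)"
    proof (intro ballI allI)
      fix x and d :: "real^3" assume x: "x \<in> Q"
      have "C x \<le> (\<Sum>x\<in>Q. C x)" by (rule member_le_sum[OF x]) (use C finite_Q in \<open>auto intro: less_imp_le\<close>)
      then have "C x * (\<Sum>j\<in>Q - {x}. \<bar>normal \<tau> j \<bullet> d\<bar>) \<le> (\<Sum>x\<in>Q. C x) * (\<Sum>j\<in>Q - {x}. \<bar>normal \<tau> j \<bullet> d\<bar>)"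
        by (intro mult_right_mono) (auto intro: sum_nonneg)
      moreover have "norm d \<le> C x * (\<Sum>j\<in>Q - {x}. \<bar>normal \<tau> j \<bullet> d\<bar>)" using C x by blast
      ultimately show "norm d \<le> (\<Sum>x\<in>Q. C x) * (\<Sum>j\<in>Q - {x}. \<bar>normal \<tau> j \<bullet> d\<bar>)" by linarith
    qed
  qed
qed

end

text \<open>The constant \<open>C\<close> bounds vectors by their inner products with any three of the four coorientations, and
  \<open>l\<close> is the linear relation of the four. The last condition on \<open>\<epsilon>\<close> makes the errors in this
  relation smaller than each of its terms. Since \<open>\<rho> \<le> r'\<close>, no triple point outside of the support of
  the homotopy is counted twice.\<close>
locale event_sheets = quadruple_event M \<A> a b H \<tau> p D r r' + local_sheets M \<A> a b H \<tau> p \<epsilon> \<delta> \<rho> N g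
  for M :: "'a::t2_space set" and \<A> :: "'a atlas" and a b :: real and H :: "real \<Rightarrow> 'a \<Rightarrow> real^3"
    and \<tau> :: real and p :: "real^3" and D :: "'a \<Rightarrow> 'a set" and r r' :: real
    and \<epsilon> \<delta> \<rho> :: real and N :: "'a \<Rightarrow> 'a set" and g :: "'a \<Rightarrow> real \<Rightarrow> real^3 \<Rightarrow> real" +
  fixes C :: real and l :: "'a \<Rightarrow> real"
  assumes sheet_in_domain: "\<And>i. i \<in> fibre M (H \<tau>) p \<Longrightarrow> N i \<subseteq> D i" and \<rho>_r': "\<rho> \<le> r'"
    and \<epsilon>_pos: "0 < \<epsilon>" and \<epsilon>_quarter: "\<epsilon> \<le> 1/4"
    and C_pos: "C > 0"
    and C_bound: "\<And>x d. x \<in> fibre M (H \<tau>) p \<Longrightarrow>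
      norm d \<le> C * (\<Sum>j\<in>fibre M (H \<tau>) p - {x}. \<bar>coorientation \<A> (H \<tau>) j \<bullet> d\<bar>)"
    and C_\<epsilon>: "C * (3 * \<epsilon>) \<le> 1/2"
    and relation: "(\<Sum>i\<in>fibre M (H \<tau>) p. l i *\<^sub>R coorientation \<A> (H \<tau>) i) = 0"
    and l_\<epsilon>: "\<And>i. i \<in> fibre M (H \<tau>) p \<Longrightarrow>
      2 * C * \<epsilon> * (\<Sum>i\<in>fibre M (H \<tau>) p. \<bar>l i\<bar>) < \<bar>l i\<bar>"

context quadruple_event
begin

lemma event_sheets_exist:
  obtains \<epsilon> \<delta> \<rho> N g C l where "event_sheets M \<A> a b H \<tau> p D r r' \<epsilon> \<delta> \<rho> N g C l"
proof -
  have Q: "Q \<noteq> {}" using card_Q by auto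
  obtain C where C: "C > 0" "\<forall>x\<in>Q. \<forall>d. norm d \<le> C * (\<Sum>j\<in>Q - {x}. \<bar>normal \<tau> j \<bullet> d\<bar>)"
    by (rule normals_uniformly_spanning)
  have card4: "card Q = DIM(real^3) + 1" using card_Q by simp
  have ind: "inj_on (normal \<tau>) (Q - {i}) \<and> independent (normal \<tau> ` (Q - {i}))" if "i \<in> Q" for i
    using normals_triple_independent[OF that] by simp
  obtain l where l: "\<forall>i\<in>Q. l i \<noteq> 0" "(\<Sum>i\<in>Q. l i *\<^sub>R normal \<tau> i) = 0"
    by (rule linear_relation_nonzero_coefficients[OF card4 ind normals_inj])
  define m where "m = Min ((\<lambda>i. \<bar>l i\<bar>) ` Q)"
  have m: "m > 0" "\<And>i. i \<in> Q \<Longrightarrow> m \<le> \<bar>l i\<bar>"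
    unfolding m_def using l(1) finite_Q Q by (auto simp: Min_gr_iff)
  define S where "S = (\<Sum>i\<in>Q. \<bar>l i\<bar>)"
  have S: "S \<ge> 0" unfolding S_def by (simp add: sum_nonneg)
  (* The three bounds serve the slope along nearby coorientations, the injectivity of triples of
     sheet functions, and the linear relation. *)
  define \<epsilon> where "\<epsilon> = min (1/4) (min (1 / (6 * C)) (m / (4 * C * (S + 1))))"
  have \<epsilon>: "\<epsilon> > 0" "\<epsilon> \<le> 1/4" "\<epsilon> \<le> 1 / (6 * C)" "\<epsilon> \<le> m / (4 * C * (S + 1))"
  proof -
    show "\<epsilon> > 0" unfolding \<epsilon>_def using C(1) m(1) S by simp
    show "\<epsilon> \<le> 1/4" unfolding \<epsilon>_def by (rule min.cobounded1)
    show "\<epsilon> \<le> 1 / (6 * C)" unfolding \<epsilon>_def by (rule order_trans[OF min.cobounded2 min.cobounded1])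
    show "\<epsilon> \<le> m / (4 * C * (S + 1))" unfolding \<epsilon>_def by (rule order_trans[OF min.cobounded2 min.cobounded2])
  qed
  have C\<epsilon>: "C * (3 * \<epsilon>) \<le> 1/2" using \<epsilon>(3) C(1) by (simp add: field_simps)
  have l\<epsilon>: "2 * C * \<epsilon> * S < m"
  proof -
    have "2 * C * (m / (4 * C * T)) = m / (2 * T)" if "T > 0" for T
      using C(1) that by (simp add: field_simps)
    from this[of "S + 1"] have eq: "2 * C * (m / (4 * C * (S + 1))) = m / (2 * (S + 1))" using S by linarith
    have "2 * C * \<epsilon> * S \<le> 2 * C * (m / (4 * C * (S + 1))) * S"
      using \<epsilon>(4) C(1) S by (intro mult_right_mono mult_left_mono) auto
    also have "\<dots> = m / (2 * (S + 1)) * S" unfolding eq ..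
    also have "\<dots> = m * (S / (2 * (S + 1)))" by simp
    also have "\<dots> < m * 1" using m(1) S by (intro mult_strict_left_mono) (auto simp: field_simps)
    finally show ?thesis by simp
  qed
  have dom: "openin (top_of_set M) (D i) \<and> i \<in> D i" if "i \<in> Q" for i using domain[OF that] by simp
  obtain \<delta> \<rho> N g where L: "local_sheets M \<A> a b H \<tau> p \<epsilon> \<delta> \<rho> N g" and N: "\<forall>i\<in>Q. N i \<subseteq> D i"
    by (rule local_sheets_exist[OF \<tau>_ab finite_Q \<epsilon>(1) dom])
  have \<rho>: "0 < min \<rho> r'" using local_sheets.\<rho>_pos[OF L] radii by simp
  have "event_sheets M \<A> a b H \<tau> p D r r' \<epsilon> \<delta> (min \<rho> r') N g C l"
  proof (intro event_sheets.intro event_sheets_axioms.intro)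
    show "quadruple_event M \<A> a b H \<tau> p D r r'" by (rule quadruple_event_axioms)
    show "local_sheets M \<A> a b H \<tau> p \<epsilon> \<delta> (min \<rho> r') N g"
      by (rule local_sheets_shrink[OF L \<rho> min.cobounded1])
    show "2 * C * \<epsilon> * (\<Sum>i\<in>Q. \<bar>l i\<bar>) < \<bar>l i\<bar>" if "i \<in> Q" for i
      using l\<epsilon> m(2)[OF that] unfolding S_def by linarith
    show "norm d \<le> C * (\<Sum>j\<in>Q - {x}. \<bar>normal \<tau> j \<bullet> d\<bar>)" if "x \<in> Q" for x d
      using C(2) that by blast
    show "N i \<subseteq> D i" if "i \<in> Q" for i using N that by blast
  qed (fact \<epsilon>(1) \<epsilon>(2) C(1) C\<epsilon> l(2) min.cobounded2)+
  then show thesis by (rule that)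
qed

end

section \<open>Vertices and faces of the small tetrahedron\<close>

context event_sheets
begin

text \<open>Within the ball, the given sheets \<open>D k\<close> and the smaller ones \<open>N k\<close> coincide.\<close>
lemma on_sheet_iff:
  assumes "t \<in> times" "w \<in> B" "k \<in> Q"
  shows "w \<in> H t ` D k \<longleftrightarrow> g k t w = 0"
proof
  assume "w \<in> H t ` D k"
  then obtain y where y: "y \<in> D k" "w = H t y" by blast
  have "y \<in> M" using y(1) domain[OF assms(3)] openin_imp_subset by blast
  then obtain x where x: "x \<in> Q" "y \<in> N x" using covered[OF assms(1)] assms(2) y(2) by blast
  have "D x \<inter> D k \<noteq> {}" using y(1) x sheet_in_domain by blast
  then have "x = k" using disjoint_domains x(1) assms(3) unfolding disjoint_family_on_def by blast
  then show "g k t w = 0" using sheet_point_eq(1)[OF x(1) assms(1) x(2)] y(2) assms(2) by simp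
next
  assume "g k t w = 0"
  then have "w \<in> H t ` N k" using sheet_zero[OF assms(3,1,2)] by simp
  then show "w \<in> H t ` D k" using sheet_in_domain[OF assms(3)] by blast
qed

definition is_vertex :: "real \<Rightarrow> 'a \<Rightarrow> real^3 \<Rightarrow> bool" where
  "is_vertex t i w \<longleftrightarrow> w \<in> B \<and> (\<forall>k\<in>Q - {i}. g k t w = 0)"

definition vertex :: "real \<Rightarrow> 'a \<Rightarrow> real^3" where
  "vertex t i = (SOME w. is_vertex t i w)"

text \<open>Positive if and only if the vertex lies on the positive side of the opposite sheet.\<close>
definition height :: "real \<Rightarrow> 'a \<Rightarrow> real" where
  "height t i = g i t (vertex t i)"

definition four_vertices :: "real \<Rightarrow> bool" where
  "four_vertices t \<longleftrightarrow> t \<in> times \<and> t \<noteq> \<tau> \<and> (\<forall>i\<in>Q. \<exists>w. is_vertex t i w)"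

lemma four_verticesD:
  assumes "four_vertices t"
  shows "t \<in> times" "t \<in> {a<..<b}" "generic_immersion M \<A> (H t)"
    "\<And>i. i \<in> Q \<Longrightarrow> is_vertex t i (vertex t i)"
proof -
  show t: "t \<in> times" using assms unfolding four_vertices_def by simp
  then show ab: "t \<in> {a<..<b}" by (rule times_subset)
  show "generic_immersion M \<A> (H t)" using generic[OF ab] assms unfolding four_vertices_def by simp
  fix i assume "i \<in> Q"
  then have "\<exists>w. is_vertex t i w" using assms unfolding four_vertices_def by simp
  then show "is_vertex t i (vertex t i)" unfolding vertex_def by (rule someI_ex)
qed

lemma card_other_sheets: "i \<in> Q \<Longrightarrow> card (Q - {i}) = 3"
  using card_Q finite_Q by simp

lemma vertex_unique:
  assumes t: "t \<in> times" and i: "i \<in> Q" and w: "is_vertex t i w" "is_vertex t i w'"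
  shows "w = w'"
proof -
  have "norm (w - w') \<le> 2 * C * (\<Sum>k\<in>Q - {i}. \<bar>g k t w - g k t w'\<bar>)"
    by (rule distance_from_sheet_values[OF Diff_subset C_pos C_bound[OF i] _ t])
      (use C_\<epsilon> card_other_sheets[OF i] w in \<open>simp_all add: is_vertex_def\<close>)
  also have "(\<Sum>k\<in>Q - {i}. \<bar>g k t w - g k t w'\<bar>) = 0"
    by (rule sum.neutral) (use w in \<open>simp add: is_vertex_def\<close>)
  finally show ?thesis by simp
qed

text \<open>A vertex of height \<open>0\<close> would be a quadruple point of a generic immersion.\<close>
lemma height_nonzero:
  assumes "four_vertices t" and i: "i \<in> Q"
  shows "height t i \<noteq> 0"
proof
  assume "height t i = 0"
  note v = four_verticesD(4)[OF assms] and t = four_verticesD(1)[OF assms(1)]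
  have vB: "vertex t i \<in> B" using v unfolding is_vertex_def by simp
  have "{x \<in> Q. g x t (vertex t i) = 0} = Q"
    using v \<open>height t i = 0\<close> unfolding is_vertex_def height_def by auto
  then have "card (fibre M (H t) (vertex t i)) = 4"
    using bij_betw_same_card[OF sheet_point_bij[OF t vB]] card_Q by simp
  then show False using generic_immersionD(1)[OF four_verticesD(3)[OF assms(1)], of "vertex t i"] by simp
qed

lemma heights_aligned:
  assumes "four_vertices t" and ik: "i \<in> Q" "k \<in> Q"
  shows "l i * height t i > 0 \<longleftrightarrow> l k * height t k > 0"
  unfolding height_def
proof (rule vertex_heights_aligned[where C = C and l = l])
  show "C * (real (card (Q - {x})) * \<epsilon>) \<le> 1/2" if "x \<in> Q" for x
    using C_\<epsilon> card_other_sheets[OF that] by simp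
  show "norm d \<le> C * (\<Sum>j\<in>Q - {x}. \<bar>normal \<tau> j \<bullet> d\<bar>)" if "x \<in> Q" for x d by (rule C_bound[OF that])
  show "2 * C * \<epsilon> * (\<Sum>i\<in>Q. \<bar>l i\<bar>) < \<bar>l i\<bar>" if "i \<in> Q" for i by (rule l_\<epsilon>[OF that])
  show "vertex t i \<in> B" if "i \<in> Q" for i
    using four_verticesD(4)[OF assms(1) that] unfolding is_vertex_def by simp
  show "g k t (vertex t i) = 0" if "i \<in> Q" "k \<in> Q - {i}" for i k
    using four_verticesD(4)[OF assms(1) that(1)] that(2) unfolding is_vertex_def by simp
  show "g i t (vertex t i) \<noteq> 0" if "i \<in> Q" for i
    using height_nonzero[OF assms(1) that] unfolding height_def .
qed (fact C_pos less_imp_le[OF \<epsilon>_pos] relation four_verticesD(1)[OF assms(1)] ik)+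

lemma vertex_in_ball: "four_vertices t \<Longrightarrow> i \<in> Q \<Longrightarrow> vertex t i \<in> B"
  using four_verticesD(4) unfolding is_vertex_def by simp

lemma vertex_zero_set:
  assumes "four_vertices t" "i \<in> Q"
  shows "{x \<in> Q. g x t (vertex t i) = 0} = Q - {i}"
  using four_verticesD(4)[OF assms] height_nonzero[OF assms] assms(2) unfolding is_vertex_def height_def by auto

lemma vertices_inj: "four_vertices t \<Longrightarrow> inj_on (vertex t) Q"
proof (rule inj_onI)
  fix i k assume t: "four_vertices t" and ik: "i \<in> Q" "k \<in> Q" "vertex t i = vertex t k"
  have "Q - {i} = Q - {k}" using vertex_zero_set[OF t ik(1)] vertex_zero_set[OF t ik(2)] ik(3) by simp
  then show "i = k" using ik by blast
qed

lemma triple_points_in_ball: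
  assumes t: "four_vertices t"
  shows "triple_points M (H t) \<inter> B = vertex t ` Q"
proof
  note tt = four_verticesD(1)[OF t]
  show "triple_points M (H t) \<inter> B \<subseteq> vertex t ` Q"
  proof
    fix w assume w: "w \<in> triple_points M (H t) \<inter> B"
    let ?Z = "{x \<in> Q. g x t w = 0}"
    have wB: "w \<in> B" using w by blast
    have "card ?Z = 3"
      using bij_betw_same_card[OF sheet_point_bij[OF tt wB]] w by (simp add: triple_points_def)
    then have "card (Q - ?Z) = 1" using card_Diff_subset[of ?Z Q] finite_Q card_Q by simp
    then obtain i where i: "Q - ?Z = {i}" by (rule card_1_singletonE)
    then have iQ: "i \<in> Q" by blast
    have "is_vertex t i w" unfolding is_vertex_def using wB i by blast
    then have "w = vertex t i" by (rule vertex_unique[OF tt iQ _ four_verticesD(4)[OF t iQ]])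
    then show "w \<in> vertex t ` Q" using iQ by blast
  qed
  show "vertex t ` Q \<subseteq> triple_points M (H t) \<inter> B"
  proof
    fix w assume "w \<in> vertex t ` Q"
    then obtain i where i: "i \<in> Q" "w = vertex t i" by blast
    have wB: "w \<in> B" using vertex_in_ball[OF t i(1)] i(2) by simp
    have "card (fibre M (H t) w) = 3"
      using bij_betw_same_card[OF sheet_point_bij[OF tt wB]] vertex_zero_set[OF t i(1)]
        card_other_sheets[OF i(1)] i(2) by simp
    then show "w \<in> triple_points M (H t) \<inter> B" using wB by (simp add: triple_points_def)
  qed
qed

lemma positive_at_vertex:
  assumes t: "four_vertices t" and i: "i \<in> Q"
  shows "positive t (vertex t i) = of_bool (height t i > 0)"
proof -
  have "{x \<in> Q. g x t (vertex t i) > 0} = (if height t i > 0 then {i} else {})"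
  proof -
    have z: "g x t (vertex t i) = 0" if "x \<in> Q" "x \<noteq> i" for x
      using four_verticesD(4)[OF t i] that unfolding is_vertex_def by blast
    show ?thesis
    proof (rule set_eqI)
      fix x
      show "x \<in> {x \<in> Q. g x t (vertex t i) > 0} \<longleftrightarrow> x \<in> (if height t i > 0 then {i} else {})"
        using z[of x] i by (cases "x = i") (auto simp: height_def)
    qed
  qed
  then show ?thesis unfolding positive_def by simp
qed

lemma sum_of_inner_indices:
  assumes t: "four_vertices t" and K: "\<forall>w\<in>B - H t ` M. A w = K + real (positive t w)"
  shows "(\<Sum>q\<in>triple_points M (H t) \<inter> B. index M \<A> (H t) A q) =
    4 * K + 6 + real (card {i \<in> Q. height t i > 0})"
proof -
  have "(\<Sum>q\<in>triple_points M (H t) \<inter> B. index M \<A> (H t) A q) =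
      (\<Sum>i\<in>Q. index M \<A> (H t) A (vertex t i))"
    unfolding triple_points_in_ball[OF t] by (simp add: sum.reindex[OF vertices_inj[OF t]])
  also have "\<dots> = (\<Sum>i\<in>Q. (K + 3/2) + (if height t i > 0 then 1 else 0))"
  proof (rule sum.cong[OF refl])
    fix i assume i: "i \<in> Q"
    have "vertex t i \<in> triple_points M (H t)" using triple_points_in_ball[OF t] i by blast
    from index_of_triple_point[OF four_verticesD(1)[OF t] four_verticesD(3)[OF t] vertex_in_ball[OF t i] K this]
    show "index M \<A> (H t) A (vertex t i) = (K + 3/2) + (if height t i > 0 then 1 else 0)"
      unfolding positive_at_vertex[OF t i] by simp
  qed
  also have "\<dots> = 4 * (K + 3/2) + real (card {i \<in> Q. height t i > 0})"
    using finite_Q by (simp add: sum.distrib card_Q sum.If_cases Int_def)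
  finally show ?thesis by simp
qed

lemma tetrahedron_four_vertices:
  assumes t: "t \<in> times" "t \<noteq> \<tau>" and tet: "tetrahedron M (H t) Q D \<Delta>" and cl: "closure \<Delta> \<subseteq> B"
  shows "four_vertices t" "\<And>i. i \<in> Q \<Longrightarrow> vertex t i \<in> closure \<Delta>"
proof -
  have "card Q \<ge> 2" using card_Q by simp
  then obtain v w where v: "\<forall>i\<in>Q. v i \<in> closure \<Delta> \<and> (\<forall>k\<in>Q - {i}. v i \<in> H t ` D k)"
    and "\<forall>i\<in>Q. w i \<in> closure \<Delta> \<and> w i \<in> H t ` D i \<and> (\<forall>k\<in>Q - {i}. w i \<notin> H t ` D k)"
    by (rule tetrahedron_vertices_and_faces[OF tet])
  have vert: "is_vertex t i (v i)" if i: "i \<in> Q" for i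
  proof -
    have vB: "v i \<in> B" using v i cl by blast
    have "g k t (v i) = 0" if k: "k \<in> Q - {i}" for k
      using on_sheet_iff[OF t(1) vB, of k] v i k by blast
    then show ?thesis unfolding is_vertex_def using vB by blast
  qed
  then show g: "four_vertices t" using t unfolding four_vertices_def by blast
  fix i assume i: "i \<in> Q"
  have "vertex t i = v i" by (rule vertex_unique[OF t(1) i four_verticesD(4)[OF g i] vert[OF i]])
  then show "vertex t i \<in> closure \<Delta>" using v i by simp
qed

text \<open>The tetrahedron is connected and misses the sheet, and the opposite vertex lies in its closure
  but not on the sheet.\<close>
lemma tetrahedron_side:
  assumes t: "t \<in> times" "t \<noteq> \<tau>" and tet: "tetrahedron M (H t) Q D \<Delta>" and cl: "closure \<Delta> \<subseteq> B"
    and i: "i \<in> Q"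
  shows "\<And>z. z \<in> \<Delta> \<Longrightarrow> g i t z > 0 \<longleftrightarrow> height t i > 0"
    and "\<And>z. z \<in> closure \<Delta> \<Longrightarrow> g i t z > 0 \<Longrightarrow> height t i > 0"
proof -
  have comp: "\<Delta> \<in> components (- H t ` M)" using tet unfolding tetrahedron_def by (rule conjunct1)
  have sub: "\<Delta> \<subseteq> B" using cl closure_subset by blast
  have nz: "g i t z \<noteq> 0" if "z \<in> \<Delta>" for z
    using image_iff_zero[OF t(1), of z] in_components_subset[OF comp] sub that i by blast
  have cont: "continuous_on \<Delta> (g i t)" by (rule continuous_on_subset[OF sheet_continuous[OF i t(1)] sub])
  have same: "g i t y > 0 \<longleftrightarrow> g i t z > 0" if "y \<in> \<Delta>" "z \<in> \<Delta>" for y z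
    by (rule connected_nonzero_same_sign[OF in_components_connected[OF comp] cont nz that])
  have meets: "\<exists>z\<in>\<Delta>. s * g i t z > 0" if u: "u \<in> closure \<Delta>" "s * g i t u > 0" for u s
  proof -
    have "continuous_on B (\<lambda>w. s * g i t w)" using sheet_continuous[OF i t(1)] by (intro continuous_intros)
    then have "open (B \<inter> (\<lambda>w. s * g i t w) -` {0<..})"
      by (rule continuous_open_preimage[OF _ open_ball open_greaterThan])
    moreover have "u \<in> B \<inter> (\<lambda>w. s * g i t w) -` {0<..}" using u cl by auto
    ultimately have "(B \<inter> (\<lambda>w. s * g i t w) -` {0<..}) \<inter> \<Delta> \<noteq> {}"
      using u(1) open_Int_closure_eq_empty by blast
    then show ?thesis by auto
  qed
  note four = tetrahedron_four_vertices[OF t tet cl]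
  have h: "height t i \<noteq> 0" by (rule height_nonzero[OF four(1) i])
  have v: "g i t (vertex t i) = height t i" unfolding height_def ..
  show side: "g i t z > 0 \<longleftrightarrow> height t i > 0" if z: "z \<in> \<Delta>" for z
  proof (cases "height t i > 0")
    case True
    then obtain y where "y \<in> \<Delta>" "g i t y > 0" using meets[OF four(2)[OF i], of 1] v by auto
    then show ?thesis using same[OF _ z] True by simp
  next
    case False
    then have "-1 * g i t (vertex t i) > 0" using h v by simp
    from meets[OF four(2)[OF i] this] obtain y where "y \<in> \<Delta>" "g i t y < 0" by auto
    then show ?thesis using same[OF _ z, of y] nz[of y] False by auto
  qed
  show "height t i > 0" if "z \<in> closure \<Delta>" "g i t z > 0" for z
    using meets[OF that(1), of 1] that(2) side by auto
qed

text \<open>If the height is positive, then a point of the face on no other sheet witnesses that the face is not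
  outward. If it is negative, then the negative side of the sheet near a point of the face lies in the
  tetrahedron, as it contains points of the tetrahedron and belongs to one component.\<close>
lemma outward_face_iff:
  assumes t: "t \<in> times" "t \<noteq> \<tau>" and tet: "tetrahedron M (H t) Q D \<Delta>" and cl: "closure \<Delta> \<subseteq> B"
    and i: "i \<in> Q"
  shows "outward_face M \<A> (H t) (D i) \<Delta> \<longleftrightarrow> height t i < 0"
proof -
  note side = tetrahedron_side[OF t tet cl i]
  have comp: "\<Delta> \<in> components (- H t ` M)" using tet unfolding tetrahedron_def by (rule conjunct1)
  have tab: "t \<in> {a<..<b}" by (rule times_subset[OF t(1)])
  have DM: "D k \<subseteq> M" if "k \<in> Q" for k using domain[OF that] openin_imp_subset by blast
  have in_N: "x \<in> N k" if x: "k \<in> Q" "x \<in> D k" "H t x \<in> B" for x k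
  proof -
    have "x \<in> M" using DM x(1,2) by blast
    then obtain k' where k': "k' \<in> Q" "x \<in> N k'" using covered[OF t(1) _ x(3)] by blast
    have "D k' \<inter> D k \<noteq> {}" using x(2) k' sheet_in_domain by blast
    then have "k' = k" using disjoint_domains k'(1) x(1) unfolding disjoint_family_on_def by blast
    then show ?thesis using k'(2) by simp
  qed
  have crossing: "\<forall>\<^sub>F e in at_right 0. g i t (H t x + e *\<^sub>R normal t x) > 0"
    "\<forall>\<^sub>F e in at_right 0. g i t (H t x - e *\<^sub>R normal t x) < 0" if x: "x \<in> N i" "H t x \<in> B" for x
  proof -
    have xM: "x \<in> M" using x(1) sheet_subset[OF i] by blast
    note y = sheet_point_eq[OF i t(1) x(1) refl x(2)]
    have nn: "normal t x \<bullet> normal t x = 1" using norm_normal[OF tab xM] by (simp add: dot_square_norm)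
    have "\<forall>\<^sub>F e in at_right 0. g i t (H t x + e *\<^sub>R normal t x) \<noteq> 0 \<and>
        (g i t (H t x + e *\<^sub>R normal t x) > 0 \<longleftrightarrow> g i t (H t x) > 0 \<or> g i t (H t x) = 0 \<and>
          normal t (sheet_point t (H t x) i) \<bullet> normal t x > 0)"
      by (rule eventually_side[OF i t(1) x(2)]) (simp add: y nn)
    then show "\<forall>\<^sub>F e in at_right 0. g i t (H t x + e *\<^sub>R normal t x) > 0"
      by eventually_elim (simp add: y nn)
    have "\<forall>\<^sub>F e in at_right 0. g i t (H t x + e *\<^sub>R (- normal t x)) \<noteq> 0 \<and>
        (g i t (H t x + e *\<^sub>R (- normal t x)) > 0 \<longleftrightarrow> g i t (H t x) > 0 \<or> g i t (H t x) = 0 \<and>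
          normal t (sheet_point t (H t x) i) \<bullet> (- normal t x) > 0)"
      by (rule eventually_side[OF i t(1) x(2)]) (simp add: y nn)
    then show "\<forall>\<^sub>F e in at_right 0. g i t (H t x - e *\<^sub>R normal t x) < 0"
      by eventually_elim (simp add: y nn)
  qed
  show ?thesis
  proof
    assume out: "outward_face M \<A> (H t) (D i) \<Delta>"
    show "height t i < 0"
    proof (rule ccontr)
      assume "\<not> height t i < 0"
      then have pos: "height t i > 0" using height_nonzero[OF tetrahedron_four_vertices(1)[OF t tet cl] i] by simp
      have "card Q \<ge> 2" using card_Q by simp
      then obtain v w where "\<forall>i\<in>Q. v i \<in> closure \<Delta> \<and> (\<forall>k\<in>Q - {i}. v i \<in> H t ` D k)"
        and w: "\<forall>i\<in>Q. w i \<in> closure \<Delta> \<and> w i \<in> H t ` D i \<and> (\<forall>k\<in>Q - {i}. w i \<notin> H t ` D k)"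
        by (rule tetrahedron_vertices_and_faces[OF tet])
      obtain x where x: "x \<in> D i" "w i = H t x" using w i by blast
      have wB: "H t x \<in> B" using w i cl x(2) by auto
      have "y = x" if y: "y \<in> M" "H t y = H t x" for y
      proof -
        obtain k where k: "k \<in> Q" "y \<in> N k" using covered[OF t(1) y(1)] y(2) wB by auto
        then have "y \<in> D k" using sheet_in_domain by blast
        moreover have "w i = H t y" using x(2) y(2) by simp
        ultimately have "w i \<in> H t ` D k" by (rule image_eqI[rotated])
        then have "k = i" using w i k(1) by blast
        then show ?thesis using inj_onD[OF sheet_inj[OF i t(1)] y(2)] k(2) in_N[OF i x(1) wB] by simp
      qed
      then have "fibre M (H t) (H t x) = {x}" using DM[OF i] x(1) unfolding fibre_def by blast
      then have "\<forall>\<^sub>F e in at_right 0. H t x - e *\<^sub>R normal t x \<in> \<Delta> \<and>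
           H t x + e *\<^sub>R normal t x \<notin> closure \<Delta>"
        using out x w i unfolding outward_face_def by auto
      with crossing(2)[OF in_N[OF i x(1) wB] wB]
      have "\<forall>\<^sub>F e in at_right (0::real). False"
        by eventually_elim (use side(1) pos in fastforce)
      then show False using eventually_happens'[OF trivial_limit_at_right_real] by blast
    qed
  next
    assume neg: "height t i < 0"
    show "outward_face M \<A> (H t) (D i) \<Delta>"
      unfolding outward_face_def
    proof (intro ballI impI)
      fix x assume x: "x \<in> D i" and hx: "H t x \<in> closure \<Delta> \<and> fibre M (H t) (H t x) = {x}"
      let ?u = "H t x"
      have uB: "?u \<in> B" using hx cl by blast
      have xN: "x \<in> N i" by (rule in_N[OF i x uB])
      have "\<forall>k\<in>Q - {i}. g k t ?u \<noteq> 0"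
      proof (intro ballI notI)
        fix k assume k: "k \<in> Q - {i}" and z: "g k t ?u = 0"
        have kQ: "k \<in> Q" using k by blast
        note y = sheet_point[OF kQ t(1) uB z]
        have "sheet_point t ?u k \<in> fibre M (H t) ?u"
          using y sheet_subset[OF kQ] unfolding fibre_def by blast
        then have "sheet_point t ?u k = x" using hx by blast
        then show False using sheet_unique[OF kQ i, of x] y(1) xN k by auto
      qed
      moreover have "norm (normal \<tau> i) = 1" using norm_normal[OF \<tau>_ab] i by (simp add: fibre_def)
      moreover have "0 \<le> \<epsilon>" "\<epsilon> \<le> 1/2" using \<epsilon>_pos \<epsilon>_quarter by simp_all
      ultimately obtain s where s: "s > 0"
        "\<forall>w\<in>ball ?u s. \<forall>w'\<in>ball ?u s. g i t w < 0 \<longrightarrow> g i t w' < 0 \<longrightarrow> w \<in> \<Delta> \<longrightarrow> w' \<in> \<Delta>"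
        using one_side_region[OF t(1) i _ _ _ uB _ comp] by blast
      have "ball ?u s \<inter> \<Delta> \<noteq> {}"
        using hx s(1) open_Int_closure_eq_empty[OF open_ball, of ?u s \<Delta>] centre_in_ball by blast
      then obtain z where z: "z \<in> ball ?u s" "z \<in> \<Delta>" by blast
      have "g i t z \<noteq> 0"
        using image_iff_zero[OF t(1), of z] in_components_subset[OF comp] z(2) cl closure_subset i by blast
      then have zneg: "g i t z < 0" using side(1)[OF z(2)] neg by simp
      have "((\<lambda>e. ?u - e *\<^sub>R normal t x) \<longlongrightarrow> ?u) (at_right 0)" by (auto intro!: tendsto_eq_intros)
      then have "\<forall>\<^sub>F e in at_right 0. ?u - e *\<^sub>R normal t x \<in> ball ?u s"
        by (rule topological_tendstoD) (use s(1) in auto)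
      with crossing[OF xN uB]
      show "\<forall>\<^sub>F e in at_right 0. ?u - e *\<^sub>R normal t x \<in> \<Delta> \<and> ?u + e *\<^sub>R normal t x \<notin> closure \<Delta>"
      proof eventually_elim
        case (elim e)
        have "?u - e *\<^sub>R normal t x \<in> \<Delta>" using s(2) z zneg elim(2,3) by blast
        moreover have "?u + e *\<^sub>R normal t x \<notin> closure \<Delta>" using side(2) elim(1) neg by force
        ultimately show ?case ..
      qed
    qed
  qed
qed

lemma outward_number_eq:
  assumes t: "t \<in> times" "t \<noteq> \<tau>" and tet: "tetrahedron M (H t) Q D \<Delta>" and cl: "closure \<Delta> \<subseteq> B"
  shows "outward_number M \<A> (H t) Q D \<Delta> = card {i \<in> Q. height t i < 0}"
proof -
  have "{i \<in> Q. outward_face M \<A> (H t) (D i) \<Delta>} = {i \<in> Q. height t i < 0}"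
    using outward_face_iff[OF t tet cl] by blast
  then show ?thesis unfolding outward_number_def by simp
qed

end

section \<open>The jump of the invariant\<close>

context event_sheets
begin

text \<open>The height of \<open>q t\<close> over the sheet, measured by \<open>s t\<close> along the coorientation at \<open>y t\<close>, and the height
  measured by the sheet function have the same sign: the slope of the latter along this coorientation is
  at least \<open>1/2 - 1/4\<close>.\<close>
lemma crossing_flips_height:
  assumes cross: "crosses_over \<A> H \<tau> p Q D i" and i: "i \<in> Q" and ev: "\<forall>\<^sub>F t in at \<tau>. four_vertices t"
  obtains \<sigma> where "\<sigma> \<in> {-1, 1}" "\<forall>\<^sub>F t in at \<tau>. \<sigma> * height t i * (t - \<tau>) > 0"
proof -
  obtain q y s \<sigma> where \<sigma>: "\<sigma> \<in> {-1, 1::real}"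
    and q: "(q \<longlongrightarrow> p) (at \<tau>)" and y: "(y \<longlongrightarrow> i) (at \<tau>)"
    and main: "\<forall>\<^sub>F t in at \<tau>. q t \<in> (\<Inter>k\<in>Q - {i}. H t ` D k) \<and> y t \<in> D i \<and>
           q t = H t (y t) + s t *\<^sub>R coorientation \<A> (H t) (y t) \<and> \<sigma> * s t * (t - \<tau>) > 0"
    using cross unfolding crosses_over_def by blast
  have iM: "i \<in> M" "H \<tau> i = p" using i by (auto simp: fibre_def)
  have ev_q: "\<forall>\<^sub>F t in at \<tau>. q t \<in> B" by (rule topological_tendstoD[OF q open_ball]) (use \<rho>_pos in simp)
  obtain G where G: "open G" "N i = M \<inter> G" using sheet_openin[OF i] unfolding openin_open by blast
  have ev_N: "\<forall>\<^sub>F t in at \<tau>. y t \<in> G"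
    by (rule topological_tendstoD[OF y G(1)]) (use label_in_sheet[OF i] G(2) in blast)
  obtain d V where V: "d > 0" "{\<tau> - d<..<\<tau> + d} \<subseteq> {a<..<b}" "openin (top_of_set M) V" "i \<in> V"
    "\<forall>t\<in>{\<tau> - d<..<\<tau> + d}. \<forall>x\<in>V. dist (H t x) (H \<tau> i) < \<rho>"
    by (rule homotopy_jointly_continuous[OF \<tau>_ab iM(1) \<rho>_pos])
  obtain G' where G': "open G'" "V = M \<inter> G'" using V(3) unfolding openin_open by blast
  have ev_V: "\<forall>\<^sub>F t in at \<tau>. y t \<in> G'"
    by (rule topological_tendstoD[OF y G'(1)]) (use V(4) G'(2) in blast)
  have ev_d: "\<forall>\<^sub>F t in at \<tau>. t \<in> {\<tau> - d<..<\<tau> + d}"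
    by (rule eventually_at_in_open'[OF open_greaterThanLessThan]) (use V(1) in simp)
  have "\<forall>\<^sub>F t in at \<tau>. \<sigma> * height t i * (t - \<tau>) > 0"
    using ev main ev_q ev_N ev_V ev_d
  proof eventually_elim
    case (elim t)
    note t = four_verticesD(1)[OF elim(1)]
    let ?n = "normal \<tau> i" and ?\<nu> = "normal t (y t)" and ?w = "H t (y t)"
    have yM: "y t \<in> M" using elim(2) domain[OF i] openin_imp_subset by blast
    have yN: "y t \<in> N i" using elim(4) G(2) yM by blast
    have "dist ?w p < \<rho>" using V(5) elim(5,6) G'(2) yM iM(2) by blast
    then have wB: "?w \<in> B" by (simp add: dist_commute)
    have "is_vertex t i (q t)" unfolding is_vertex_def
    proof (intro conjI ballI)
      show "q t \<in> B" by (rule elim(3))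
      fix k assume k: "k \<in> Q - {i}"
      then have "q t \<in> H t ` D k" using elim(2) by blast
      then show "g k t (q t) = 0" using on_sheet_iff[OF t elim(3)] k by blast
    qed
    then have "q t = vertex t i" by (rule vertex_unique[OF t i _ four_verticesD(4)[OF elim(1) i]])
    then have h: "height t i = g i t (q t)" unfolding height_def by simp
    have g0: "g i t ?w = 0" by (rule sheet_point_eq(1)[OF i t yN refl wB])
    have qw: "q t - ?w = s t *\<^sub>R ?\<nu>" using elim(2) by simp
    have "norm ?\<nu> = 1" by (rule norm_normal[OF four_verticesD(2)[OF elim(1)] yM])
    then have "\<bar>height t i - s t * (?n \<bullet> ?\<nu>)\<bar> \<le> \<epsilon> * \<bar>s t\<bar>"
      using almost_linear_onD[OF sheet_almost_linear[OF i t] elim(3) wB] unfolding h g0 qw by simp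
    also have "\<dots> \<le> 1/4 * \<bar>s t\<bar>" using \<epsilon>_quarter by (intro mult_right_mono) auto
    finally have close: "\<bar>height t i - s t * (?n \<bullet> ?\<nu>)\<bar> \<le> 1/4 * \<bar>s t\<bar>" .
    have n\<nu>: "?n \<bullet> ?\<nu> \<ge> 1/2" by (rule sheet_normal[OF i t yN])
    have pos: "\<sigma> * s t * (t - \<tau>) > 0" using elim(2) by blast
    then have "s t \<noteq> 0" by auto
    have "s t * height t i > 0"
    proof (cases "s t > 0")
      case True
      have "s t * (1/2) \<le> s t * (?n \<bullet> ?\<nu>)" using True n\<nu> by (intro mult_left_mono) auto
      then have "height t i > 0" using close True by linarith
      then show ?thesis using True by simp
    next
      case False
      then have neg: "s t < 0" using \<open>s t \<noteq> 0\<close> by simp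
      have "s t * (?n \<bullet> ?\<nu>) \<le> s t * (1/2)" using neg n\<nu> by (intro mult_left_mono_neg) auto
      then have "height t i < 0" using close neg by linarith
      then show ?thesis using neg by (rule mult_neg_neg[rotated])
    qed
    then have "(s t * height t i) * (\<sigma> * s t * (t - \<tau>)) > 0" using pos by (rule mult_pos_pos)
    then have "(s t)\<^sup>2 * (\<sigma> * height t i * (t - \<tau>)) > 0" by (simp add: power2_eq_square algebra_simps)
    then show ?case using \<open>s t \<noteq> 0\<close> by (simp add: zero_less_mult_iff)
  qed
  with \<sigma> show thesis by (rule that)
qed

lemma l_nonzero: "i \<in> Q \<Longrightarrow> l i \<noteq> 0"
proof -
  assume i: "i \<in> Q"
  have "0 \<le> 2 * C * \<epsilon> * (\<Sum>i\<in>Q. \<bar>l i\<bar>)"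
    using C_pos \<epsilon>_pos by (intro mult_nonneg_nonneg sum_nonneg) auto
  also have "\<dots> < \<bar>l i\<bar>" by (rule l_\<epsilon>[OF i])
  finally show "l i \<noteq> 0" by simp
qed

lemma all_heights_flip:
  assumes s: "four_vertices s" and t: "four_vertices t" and i: "i \<in> Q" and flip: "height s i > 0 \<longleftrightarrow> height t i < 0"
    and k: "k \<in> Q"
  shows "height s k > 0 \<longleftrightarrow> height t k < 0"
proof -
  have *: "l k * height s k > 0 \<longleftrightarrow> l i * height s i > 0" "l k * height t k > 0 \<longleftrightarrow> l i * height t i > 0"
    by (rule heights_aligned[OF s k i], rule heights_aligned[OF t k i])
  have "l k \<noteq> 0" "l i \<noteq> 0" using l_nonzero k i by auto
  then show ?thesis
    using * flip height_nonzero[OF s i] height_nonzero[OF t i] height_nonzero[OF s k] height_nonzero[OF t k]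
    by (auto simp: zero_less_mult_iff)
qed

text \<open>The four vertices together have \<open>4 * (K + 3/2) = 4 * K + 6\<close>, and each of them with positive height
  has one more.\<close>
lemma St2_split:
  assumes t: "four_vertices t" and ann: "\<forall>q\<in>cball p r' - B. card (fibre M (H t) q) \<noteq> 3"
    and K: "\<forall>w\<in>B - H t ` M. A w = K + real (positive t w)"
  shows "St2 M \<A> (H t) A = (\<Sum>q\<in>triple_points M (H \<tau>). index M \<A> (H t) A q) +
    (4 * K + 6 + real (card {i \<in> Q. height t i > 0}))"
proof -
  let ?T = "triple_points M (H t)"
  have Bsub: "B \<subseteq> cball p r'" using \<rho>_r' by auto
  have out: "?T - cball p r' = triple_points M (H \<tau>)" by (rule triple_points_outside[OF four_verticesD(2)[OF t]])
  have "?T \<inter> cball p r' = ?T \<inter> B" using ann Bsub unfolding triple_points_def by blast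
  then have split: "?T = (?T - cball p r') \<union> (?T \<inter> B)" by blast
  have fin: "finite ?T" by (rule finite_triple_points[OF four_verticesD(2,3)[OF t]])
  have "St2 M \<A> (H t) A = (\<Sum>q\<in>(?T - cball p r') \<union> (?T \<inter> B). index M \<A> (H t) A q)"
    unfolding St2_def using split by simp
  also have "\<dots> = (\<Sum>q\<in>?T - cball p r'. index M \<A> (H t) A q) + (\<Sum>q\<in>?T \<inter> B. index M \<A> (H t) A q)"
    by (rule sum.union_disjoint) (use fin Bsub in auto)
  finally show ?thesis unfolding out sum_of_inner_indices[OF t K] .
qed

end

context quadruple_event
begin

text \<open>The number of negative heights is \<open>j\<close> before and \<open>j'\<close> after the event, and the heights flip.\<close>
lemma St2_jump:
  assumes cross: "\<exists>i\<in>Q. crosses_over \<A> H \<tau> p Q D i"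
    and tet: "\<forall>\<^sub>F t in at \<tau>. tetrahedron M (H t) Q D (\<Delta> t)"
    and small: "\<forall>e>0. \<forall>\<^sub>F t in at \<tau>. \<Delta> t \<subseteq> ball p e"
    and before_after: "outward_before_after M \<A> H \<tau> p D \<Delta> j j'"
  shows "j + j' = 4" and "\<exists>\<delta>>0. \<forall>s\<in>{\<tau> - \<delta><..<\<tau>}. \<forall>t\<in>{\<tau><..<\<tau> + \<delta>}. \<forall>A A'.
       alexander_numbering M \<A> (H s) A \<and> alexander_numbering M \<A> (H t) A' \<longrightarrow>
       St2 M \<A> (H t) A' - St2 M \<A> (H s) A = real j - real j'"
proof -
  obtain \<epsilon> \<delta> \<rho> N g C l where E: "event_sheets M \<A> a b H \<tau> p D r r' \<epsilon> \<delta> \<rho> N g C l"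
    by (rule event_sheets_exist)
  interpret E: event_sheets M \<A> a b H \<tau> p D r r' \<epsilon> \<delta> \<rho> N g C l by (rule E)
  have ev_times: "\<forall>\<^sub>F t in at \<tau>. t \<in> {\<tau> - \<delta><..<\<tau> + \<delta>}"
    by (rule eventually_at_in_open'[OF open_greaterThanLessThan]) (use E.\<delta>_pos in simp)
  have ev_ne: "\<forall>\<^sub>F t in at \<tau>. t \<noteq> \<tau>" by (simp add: eventually_at_filter)
  (* Half of the radius, so that the closure still lies in the ball. *)
  have ev_small: "\<forall>\<^sub>F t in at \<tau>. \<Delta> t \<subseteq> ball p (\<rho> / 2)" using small E.\<rho>_pos by simp
  have ev: "\<forall>\<^sub>F t in at \<tau>. E.four_vertices t \<and>
      outward_number M \<A> (H t) Q D (\<Delta> t) = card {i \<in> Q. E.height t i < 0}"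
    using ev_times ev_ne ev_small tet
  proof eventually_elim
    case (elim t)
    have "closure (\<Delta> t) \<subseteq> cball p (\<rho> / 2)"
      by (rule closure_minimal) (use elim(3) in auto)
    then have cl: "closure (\<Delta> t) \<subseteq> ball p \<rho>" using E.\<rho>_pos by auto
    show ?case
      using E.tetrahedron_four_vertices(1)[OF elim(1,2,4) cl] E.outward_number_eq[OF elim(1,2,4) cl] by blast
  qed
  then have ev_four: "\<forall>\<^sub>F t in at \<tau>. E.four_vertices t" by eventually_elim simp
  obtain i0 where i0: "i0 \<in> Q" "crosses_over \<A> H \<tau> p Q D i0" using cross by blast
  obtain \<sigma> where \<sigma>: "\<sigma> \<in> {-1, 1}" "\<forall>\<^sub>F t in at \<tau>. \<sigma> * E.height t i0 * (t - \<tau>) > 0"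
    by (rule E.crossing_flips_height[OF i0(2,1) ev_four])
  have left: "\<forall>\<^sub>F s in at \<tau>. s < \<tau> \<longrightarrow> outward_number M \<A> (H s) Q D (\<Delta> s) = j"
    and right: "\<forall>\<^sub>F t in at \<tau>. t > \<tau> \<longrightarrow> outward_number M \<A> (H t) Q D (\<Delta> t) = j'"
    using before_after unfolding outward_before_after_def eventually_at_filter
    by (auto elim: eventually_mono)
  define ok where "ok t \<longleftrightarrow> E.four_vertices t \<and> \<sigma> * E.height t i0 * (t - \<tau>) > 0 \<and>
      (\<forall>q\<in>cball p r' - ball p \<rho>. card (fibre M (H t) q) \<noteq> 3) \<and>
      (t < \<tau> \<longrightarrow> card {i \<in> Q. E.height t i < 0} = j) \<and> (t > \<tau> \<longrightarrow> card {i \<in> Q. E.height t i < 0} = j')" for t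
  have ev_ok: "\<forall>\<^sub>F t in at \<tau>. ok t"
    using ev \<sigma>(2) eventually_no_triple_in_annulus[OF E.\<rho>_pos] left right unfolding ok_def
    by eventually_elim simp
  have counts: "card {i \<in> Q. E.height s i > 0} = j'" "card {i \<in> Q. E.height t i > 0} = j" "j + j' = 4"
    if s: "ok s" "s < \<tau>" and t: "ok t" "t > \<tau>" for s t
  proof -
    have four: "E.four_vertices s" "E.four_vertices t" using s(1) t(1) unfolding ok_def by simp_all
    have "\<sigma> * E.height s i0 < 0" using s unfolding ok_def by (auto simp: zero_less_mult_iff)
    moreover have "\<sigma> * E.height t i0 > 0" using t unfolding ok_def by (auto simp: zero_less_mult_iff)
    ultimately have flip: "E.height s i0 > 0 \<longleftrightarrow> E.height t i0 < 0" using \<sigma>(1) by auto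
    note all = E.all_heights_flip[OF four i0(1) flip]
    have nz: "E.height s k \<noteq> 0" "E.height t k \<noteq> 0" if "k \<in> Q" for k
      using E.height_nonzero[OF four(1) that] E.height_nonzero[OF four(2) that] by blast+
    have cj: "card {i \<in> Q. E.height s i < 0} = j" using s unfolding ok_def by simp
    have cj': "card {i \<in> Q. E.height t i < 0} = j'" using t unfolding ok_def by simp
    have "{i \<in> Q. E.height s i > 0} = {i \<in> Q. E.height t i < 0}" using all by blast
    then show pos: "card {i \<in> Q. E.height s i > 0} = j'" using cj' by simp
    have "{i \<in> Q. E.height t i > 0} = {i \<in> Q. E.height s i < 0}"
      using all nz by (force simp: not_less_iff_gr_or_eq)
    then show "card {i \<in> Q. E.height t i > 0} = j" using cj by simp
    have "{i \<in> Q. E.height s i < 0} \<union> {i \<in> Q. E.height s i > 0} = Q" using nz by force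
    moreover have "card ({i \<in> Q. E.height s i < 0} \<union> {i \<in> Q. E.height s i > 0}) = j + j'"
      unfolding cj[symmetric] pos[symmetric] by (rule card_Un_disjoint) (use finite_Q in auto)
    ultimately show "j + j' = 4" using card_Q by simp
  qed
  obtain d where d: "d > 0" "\<forall>t\<in>UNIV. t \<noteq> \<tau> \<and> dist t \<tau> < d \<longrightarrow> ok t"
    using ev_ok unfolding eventually_at by blast
  have okd: "ok (\<tau> - d / 2)" "ok (\<tau> + d / 2)" using d by (auto simp: dist_real_def)
  show "j + j' = 4" by (rule counts(3)[OF okd(1) _ okd(2)]) (use d(1) in simp_all)
  have "\<forall>\<^sub>F t in at \<tau>. \<forall>A. alexander_numbering M \<A> (H t) A \<longrightarrow> ok t"
    using ev_ok by eventually_elim simp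
  then have near_ok: "near_event (\<lambda>s A t A'. ok s \<and> ok t)" by (rule near_event_both)
  have near_sums: "near_event (\<lambda>s A t A'.
      (\<exists>K. (\<forall>w\<in>ball p \<rho> - H s ` M. A w = K + real (E.positive s w)) \<and>
          (\<forall>w\<in>ball p \<rho> - H t ` M. A' w = K + real (E.positive t w))) \<and>
      (\<Sum>q\<in>triple_points M (H \<tau>). index M \<A> (H s) A q) =
      (\<Sum>q\<in>triple_points M (H \<tau>). index M \<A> (H t) A' q))"
    using common_constant[OF E.local_sheets_axioms, folded E.positive_def] indices_constant_outside
    by (rule near_event_combine) (rule conjI)
  from near_ok near_sums
  have "near_event (\<lambda>s A t A'. s < \<tau> \<longrightarrow> \<tau> < t \<longrightarrow>
      St2 M \<A> (H t) A' - St2 M \<A> (H s) A = real j - real j')"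
  proof (rule near_event_combine, intro impI)
    fix s A t A'
    assume ok: "ok s \<and> ok t" and st: "s < \<tau>" "\<tau> < t"
      and "(\<exists>K. (\<forall>w\<in>ball p \<rho> - H s ` M. A w = K + real (E.positive s w)) \<and>
          (\<forall>w\<in>ball p \<rho> - H t ` M. A' w = K + real (E.positive t w))) \<and>
        (\<Sum>q\<in>triple_points M (H \<tau>). index M \<A> (H s) A q) =
        (\<Sum>q\<in>triple_points M (H \<tau>). index M \<A> (H t) A' q)"
    then obtain K where K: "\<forall>w\<in>ball p \<rho> - H s ` M. A w = K + real (E.positive s w)"
      "\<forall>w\<in>ball p \<rho> - H t ` M. A' w = K + real (E.positive t w)"
      and outer: "(\<Sum>q\<in>triple_points M (H \<tau>). index M \<A> (H s) A q) =
        (\<Sum>q\<in>triple_points M (H \<tau>). index M \<A> (H t) A' q)"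
      by (elim exE conjE) (rule that)
    have Ps: "E.four_vertices s" "\<forall>q\<in>cball p r' - ball p \<rho>. card (fibre M (H s) q) \<noteq> 3"
      and Pt: "E.four_vertices t" "\<forall>q\<in>cball p r' - ball p \<rho>. card (fibre M (H t) q) \<noteq> 3"
      using ok unfolding ok_def by simp_all
    note c = counts[OF conjunct1[OF ok] st(1) conjunct2[OF ok] st(2)]
    show "St2 M \<A> (H t) A' - St2 M \<A> (H s) A = real j - real j'"
      unfolding E.St2_split[OF Ps K(1)] E.St2_split[OF Pt K(2)] outer c(1,2) by simp
  qed
  from near_event_times[OF this] show "\<exists>\<delta>>0. \<forall>s\<in>{\<tau> - \<delta><..<\<tau>}. \<forall>t\<in>{\<tau><..<\<tau> + \<delta>}. \<forall>A A'.
       alexander_numbering M \<A> (H s) A \<and> alexander_numbering M \<A> (H t) A' \<longrightarrow>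
       St2 M \<A> (H t) A' - St2 M \<A> (H s) A = real j - real j'"
    by simp
qed

end

lemma quadruple_point_event_locale:
  assumes surface: "closed_oriented_surface M \<A>" and event: "quadruple_point_event M \<A> a b H \<tau> p D \<Delta>"
  obtains r r' where "quadruple_event M \<A> a b H \<tau> p D r r'"
proof -
  note e = event[unfolded quadruple_point_event_def Let_def]
  obtain r r' where "0 < r' \<and> r' < r \<and>
           (\<forall>t\<in>{a<..<b}. \<forall>x\<in>M.
              if H \<tau> x \<in> cball p r' then H t x \<in> cball p r' else H t x = H \<tau> x) \<and>
           {x \<in> M. H \<tau> x \<in> ball p r} = (\<Union>i\<in>fibre M (H \<tau>) p. D i) \<and>
           disjoint_family_on D (fibre M (H \<tau>) p) \<and>
           (\<forall>i\<in>fibre M (H \<tau>) p. i \<in> D i \<and> openin (top_of_set M) (D i) \<and>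
              (\<forall>t\<in>{a<..<b}. inj_on (H t) (D i))) \<and>
           (\<forall>q\<in>ball p r - {p}. card (fibre M (H \<tau>) q) \<le> 2 \<and>
              general_position \<A> (H \<tau>) (fibre M (H \<tau>) q))"
    using e by (elim conjE exE) (rule that, intro conjI, assumption+)
  note r = this
  have h: "regular_homotopy \<A> a b H" using e by (elim conjE)
  have "quadruple_event M \<A> a b H \<tau> p D r r'"
  proof (intro quadruple_event.intro surface_homotopy.intro quadruple_event_axioms.intro)
    show "closed_oriented_surface M \<A>" by (rule surface)
    show "regular_homotopy \<A> a b H" by (rule h)
    show "a < \<tau>" "\<tau> < b" "card (fibre M (H \<tau>) p) = 4" using e by simp_all
    show "generic_immersion M \<A> (H t)" if "t \<in> {a<..<b}" "t \<noteq> \<tau>" for t using e that by simp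
    show "general_position \<A> (H \<tau>) P" if "P \<subseteq> fibre M (H \<tau>) p" "card P = 3" for P
      using e that by simp
    show "0 < r'" "r' < r" "disjoint_family_on D (fibre M (H \<tau>) p)" using r by simp_all
    have in_out: "\<forall>t\<in>{a<..<b}. \<forall>x\<in>M.
        if H \<tau> x \<in> cball p r' then H t x \<in> cball p r' else H t x = H \<tau> x" using r by (elim conjE)
    show "H t x \<in> cball p r'" if "t \<in> {a<..<b}" "x \<in> M" "H \<tau> x \<in> cball p r'" for t x
      using bspec[OF bspec[OF in_out that(1)] that(2)] that(3) by (simp only: if_True)
    show "H t x = H \<tau> x" if "t \<in> {a<..<b}" "x \<in> M" "H \<tau> x \<notin> cball p r'" for t x
      using bspec[OF bspec[OF in_out that(1)] that(2)] that(3) by (simp only: if_False)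
    show "i \<in> D i \<and> openin (top_of_set M) (D i)" if "i \<in> fibre M (H \<tau>) p" for i
      using r that by simp
    show "card (fibre M (H \<tau>) q) \<le> 2 \<and> general_position \<A> (H \<tau>) (fibre M (H \<tau>) q)"
      if "q \<in> ball p r - {p}" for q using r that by simp
  qed
  then show thesis by (rule that)
qed

theorem theorem3p3:
  fixes M :: "'a::t2_space set" and \<A> :: "'a atlas"
    and H :: "real \<Rightarrow> 'a \<Rightarrow> real^3" and a b \<tau> :: real and p :: "real^3"
    and D :: "'a \<Rightarrow> 'a set" and \<Delta> :: "real \<Rightarrow> (real^3) set" and j j' :: nat
  assumes "closed_oriented_surface M \<A>"
    and "quadruple_point_event M \<A> a b H \<tau> p D \<Delta>"
    and "outward_before_after M \<A> H \<tau> p D \<Delta> j j'"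
    and "positive_direction j j'"
  shows "j \<in> {0, 1, 2} \<and> event_type (4 - j) j j' \<and>
    (\<exists>\<delta>>0. \<forall>s\<in>{\<tau> - \<delta><..<\<tau>}. \<forall>t\<in>{\<tau><..<\<tau> + \<delta>}. \<forall>A A'.
       alexander_numbering M \<A> (H s) A \<and> alexander_numbering M \<A> (H t) A' \<longrightarrow>
       St2 M \<A> (H t) A' - St2 M \<A> (H s) A = 2 * real j - 4)"
proof -
  obtain r r' where "quadruple_event M \<A> a b H \<tau> p D r r'"
    by (rule quadruple_point_event_locale[OF assms(1,2)])
  then interpret quadruple_event M \<A> a b H \<tau> p D r r' .
  note e = assms(2)[unfolded quadruple_point_event_def Let_def]
  have cross: "\<exists>i\<in>Q. crosses_over \<A> H \<tau> p Q D i"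
    and tet: "\<forall>\<^sub>F t in at \<tau>. tetrahedron M (H t) Q D (\<Delta> t)"
    and small: "\<forall>e>0. \<forall>\<^sub>F t in at \<tau>. \<Delta> t \<subseteq> ball p e"
    using e by simp_all
  note jump = St2_jump[OF cross tet small assms(3)]
  have le: "j \<le> 2" "j \<le> j'" using jump(1) assms(4) unfolding positive_direction_def by auto
  then have j: "j = 0 \<or> j = 1 \<or> j = 2" by auto
  then have "j \<in> {0, 1, 2}" "event_type (4 - j) j j'" using le(2) by (auto simp: event_type_def)
  moreover have eq: "real j - real j' = 2 * real j - 4" using jump(1) by linarith
  ultimately show ?thesis using jump(2)[unfolded eq] by (intro conjI)
qed

end
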